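(* Let $(\xi_i)_{i\in\mathbb{Z}}$ be i.i.d. centered random variables with finite second moment $\sigma^2=\mathbb{E}\xi_0^2$. Assume that for a certain $t>2$ and a slowly varying function $h$ one has $\mathbb{P}(\xi_0\ge x)=h(x)/x^t$ as $x\to\infty$ (i.e. for all sufficiently large $x$), and that $\mathbb{E}|\xi_0|^p<\infty$ for a certain $p>2$. Let $c_{ni}>0$ ($n\ge1$, $1\le i\le k_n$) be constants, $S_n=\sum_{i=1}^{k_n}c_{ni}\xi_i$, $\sigma_n^2=\mathrm{var}(S_n)=\sigma^2\sum_{i=1}^{k_n}c_{ni}^2$, and assume $\max_{1\le i\le k_n}c_{ni}^2/\sigma_n^2\to0$ as $n\to\infty$. Put $D_{nt}=\big(\sum_{i=1}^{k_n}c_{ni}^2\big)^{-t/2}\sum_{i=1}^{k_n}c_{ni}^t$. (1) If $x_n\ge a(\ln D_{nt}^{-1})^{1/2}$ with a constant $a>2^{1/2}$, then $$\mathbb{P}(S_n\ge x_n\sigma_n)=(1+o(1))\sum_{i=1}^{k_n}\mathbb{P}(c_{ni}\xi_0\ge x_n\sigma_n)\quad\text{as }n\to\infty.$$ (2) If $0<x_n\le b(\ln D_{nt}^{-1})^{1/2}$ with a constant $b<2^{1/2}$, then $$\mathbb{P}(S_n\ge x_n\sigma_n)=(1-\Phi(x_n))(1+o(1))\quad\text{as }n\to\infty.$$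
   Context: $\Phi$ is the standard normal distribution function. $k_n$ are positive integers. A (measurable, eventually positive) function $h$ is slowly varying if $\lim_{x\to\infty}h(\lambda x)/h(x)=1$ for all $\lambda>0$. Each $o(1)$ denotes a sequence, which may depend on $(x_n)$ and on the underlying distribution, converging to $0$ as $n\to\infty$. *)

theory Defs
  imports "HOL-Probability.Probability"
begin

definition slowly_varying :: "(real \<Rightarrow> real) \<Rightarrow> bool" where
  "slowly_varying h \<longleftrightarrow>
     h \<in> borel_measurable borel \<and>
     eventually (\<lambda>x. h x > 0) at_top \<and>
     (\<forall>l>0. ((\<lambda>x. h (l * x) / h x) \<longlongrightarrow> 1) at_top)"

text \<open>The array \<open>c n i\<close> is only meaningful for \<open>n \<ge> 1\<close> and \<open>1 \<le> i \<le> k n\<close>;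
  the random variables are indexed by all integers.\<close>

definition weighted_sum ::
  "(int \<Rightarrow> 'a \<Rightarrow> real) \<Rightarrow> (nat \<Rightarrow> nat \<Rightarrow> real) \<Rightarrow> (nat \<Rightarrow> nat) \<Rightarrow> nat \<Rightarrow> 'a \<Rightarrow> real" where
  "weighted_sum \<xi> c k n \<omega> = (\<Sum>i = 1..k n. c n i * \<xi> (int i) \<omega>)"

definition var_sum ::
  "'a measure \<Rightarrow> (int \<Rightarrow> 'a \<Rightarrow> real) \<Rightarrow> (nat \<Rightarrow> nat \<Rightarrow> real) \<Rightarrow> (nat \<Rightarrow> nat) \<Rightarrow> nat \<Rightarrow> real" where
  "var_sum M \<xi> c k n = prob_space.variance M (weighted_sum \<xi> c k n)"

definition sd_sum ::
  "'a measure \<Rightarrow> (int \<Rightarrow> 'a \<Rightarrow> real) \<Rightarrow> (nat \<Rightarrow> nat \<Rightarrow> real) \<Rightarrow> (nat \<Rightarrow> nat) \<Rightarrow> nat \<Rightarrow> real" where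
  "sd_sum M \<xi> c k n = sqrt (var_sum M \<xi> c k n)"

definition D_ratio ::
  "(nat \<Rightarrow> nat \<Rightarrow> real) \<Rightarrow> (nat \<Rightarrow> nat) \<Rightarrow> real \<Rightarrow> nat \<Rightarrow> real" where
  "D_ratio c k t n =
     (\<Sum>i = 1..k n. (c n i)\<^sup>2) powr (- t / 2) * (\<Sum>i = 1..k n. c n i powr t)"

end

theory Submission
  imports Defs "HOL-Real_Asymp.Real_Asymp"
begin

text \<open>
  After rescaling, the weights \<open>w i\<close> satisfy \<open>\<Sum> (w i)\<^sup>2 = 1\<close> and everything is measured by
  \<open>L = - ln (\<Sum> w i powr t)\<close>, which tends to infinity; all estimates are uniform in the weights with
  large \<open>L\<close>. By Jensen's inequality \<open>\<Sum> w i powr e\<close> is compared with \<open>exp (- L (e - 2) / (t - 2))\<close>,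
  so error terms decay exponentially in \<open>L\<close>, which absorbs all powers of \<open>L\<close> and of \<open>x\<close>.

  If \<open>x \<ge> a sqrt L\<close> with \<open>a > sqrt 2\<close>, then one big summand is the cheapest way to reach \<open>x\<close>: the sum of
  the variables truncated at \<open>\<eta> x\<close> obeys a Chernoff bound of order \<open>exp (- x\<^sup>2 / 2)\<close>
  (or a high power of \<open>exp (- L) / x\<close> for very large \<open>x\<close>), and this is negligible against the tail sum.

  If \<open>0 < x \<le> b sqrt L\<close> with \<open>b < sqrt 2\<close>, truncation at \<open>1 / L\<close> costs \<open>o (1 - \<Phi> x)\<close>.
  The truncated sum is handled by Lindeberg's exchange argument for a smoothed indicator of \<open>{x..}\<close> whose
  derivatives are bounded by multiples of \<open>exp (x (u - x))\<close>. Since the exponential moment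
  of the sum at \<open>x\<close> is about \<open>exp (x\<^sup>2 / 2)\<close>, the total error is a power of \<open>L\<close> times
  \<open>exp (- \<kappa> L) exp (- x\<^sup>2 / 2)\<close>, which is small relative to \<open>1 - \<Phi> x\<close>.
\<close>

section \<open>Truncated exponentials and the Gaussian tail\<close>

text \<open>The threshold sqrt 2 is where two costs meet: up to slowly varying factors the tail sum
  is of order exp (- L) x^(- t), the Gaussian tail is of order exp (- x^2 / 2), and the exponents
  agree, as far as \<open>L\<close> is concerned, at x^2 = 2 L. Right-tail moments are available
  only below order \<open>t\<close>, and the tail is bounded from below only with an exponent above
  \<open>t\<close>; each such loss costs a small multiple of \<open>L\<close> in the exponent, and
  the strict inequalities for \<open>a\<close> and \<open>b\<close> pay for it. The obstacle that
  shapes the estimates is the asymmetry of the hypotheses: regular variation is known on the right,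
  while on the left there is just a moment of some order above 2. Hence summands are truncated from
  above only, tilts are positive, and two exponents are carried along: \<open>q \<le> 3\<close> for
  both tails, since third moments may be infinite, and \<open>r\<close> for the right tail
  alone.\<close>

lemma exp_le_quadratic_trunc:
  fixes u b q r :: real
  assumes "u \<le> b" "0 < b" "2 < q" "q \<le> 3" "0 < r"
  shows "exp u \<le> 1 + u + u\<^sup>2 / 2 + exp r * \<bar>u\<bar> powr q + exp b * (max u 0 / b) powr r"
proof -
  have nn: "0 \<le> exp b * (max u 0 / b) powr r" by simp
  have er: "exp r \<ge> 1" using assms by simp
  have quad: "1 + u + u\<^sup>2 / 2 \<ge> 1/2"
  proof -
    have "0 \<le> (u + 1)\<^sup>2" by simp
    then show ?thesis by (simp add: power2_eq_square algebra_simps)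
  qed
  \<comment> \<open>Near 0 the cubic Taylor remainder is absorbed by
    \<open>\<bar>u\<bar> powr q\<close> because \<open>q \<le> 3\<close>. For u < -1 and for 1 < u
    \<le> r the quadratic part stays positive and \<open>\<bar>u\<bar> powr q\<close>, being at
    least 1, absorbs the exponential. Beyond \<open>r\<close> the last term takes over.\<close>
  consider "\<bar>u\<bar> \<le> 1" | "u < -1" | "1 < u" "u \<le> r" | "1 < u" "r < u" by linarith
  then show ?thesis
  proof cases
    case 1
    obtain x where x: "\<bar>x\<bar> \<le> \<bar>u\<bar>" "exp u = (\<Sum>m<3. u ^ m / fact m) + exp x / fact 3 * u ^ 3"
      using Maclaurin_exp_le[of u 3] by blast
    have "exp x \<le> exp 1" using x 1 by simp
    then have ex: "exp x \<le> 3" using exp_le by linarith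
    have le1: "exp x / fact 3 \<le> exp r" proof -
      have "exp x \<le> exp r * 6" using ex er by linarith
      then show ?thesis by (simp add: fact_numeral)
    qed
    have le2: "\<bar>u\<bar> ^ 3 \<le> \<bar>u\<bar> powr q"
    proof (cases "u = 0")
      case False
      then have "\<bar>u\<bar> ^ 3 = \<bar>u\<bar> powr 3" by (simp add: powr_numeral)
      also have "\<dots> \<le> \<bar>u\<bar> powr q" using False 1 assms by (intro powr_mono') auto
      finally show ?thesis .
    qed simp
    have "u ^ 3 \<le> \<bar>u\<bar> ^ 3" by (simp add: power_abs[symmetric])
    then have "exp x / fact 3 * u ^ 3 \<le> exp x / fact 3 * \<bar>u\<bar> ^ 3"
      by (intro mult_left_mono) auto
    also have "\<dots> \<le> exp r * \<bar>u\<bar> powr q"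
      using le1 le2 by (intro mult_mono) auto
    finally have cubic: "exp x / fact 3 * u ^ 3 \<le> exp r * \<bar>u\<bar> powr q" .
    have "exp u = 1 + u + u\<^sup>2 / 2 + exp x / fact 3 * u ^ 3"
      using x(2) by (simp add: eval_nat_numeral)
    then show ?thesis using cubic nn by linarith
  next
    case 2
    have "exp u \<le> 1" using 2 by simp
    moreover have "1 \<le> exp r * \<bar>u\<bar> powr q"
    proof -
      have "1 * 1 \<le> exp r * \<bar>u\<bar> powr q" 
        using 2 er assms by (intro mult_mono ge_one_powr_ge_zero) auto
      then show ?thesis by simp
    qed
    ultimately show ?thesis using nn quad by linarith
  next
    case 3
    have "exp u \<le> exp r * 1" using 3 by simp
    also have "\<dots> \<le> exp r * \<bar>u\<bar> powr q"
      using 3 assms by (intro mult_left_mono ge_one_powr_ge_zero) auto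
    finally show ?thesis using nn quad by linarith
  next
    case 4
    have u0: "0 < u" using 4 by simp
    \<comment> \<open>exp u / u^r increases on u \<ge> r, so u \<le> b gives exp u \<le> exp b (u /
      b)^r; obtained here from ln z \<le> z - 1 at z = b / u.\<close>
    have "r * ln (b / u) \<le> r * (b / u - 1)"
      using u0 assms by (intro mult_left_mono ln_le_minus_one) auto
    also have "\<dots> = r / u * (b - u)" using u0 by (simp add: field_simps)
    also have "\<dots> \<le> 1 * (b - u)" using 4 u0 assms by (intro mult_right_mono) auto
    finally have "u \<le> b + r * ln (u / b)"
      using u0 assms by (simp add: ln_div algebra_simps)
    then have "exp u \<le> exp (b + r * ln (u / b))" by simp
    also have "\<dots> = exp b * (max u 0 / b) powr r"
      using u0 assms by (simp add: exp_add powr_def)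
    finally have "exp u \<le> exp b * (max u 0 / b) powr r" .
    moreover have "0 \<le> exp r * \<bar>u\<bar> powr q" by simp
    ultimately show ?thesis using quad by linarith
  qed
qed

section \<open>Mills' ratio and shifts of the Gaussian tail\<close>

definition normal_tail :: "real \<Rightarrow> real" where
  "normal_tail z = 1 - cdf std_normal_distribution z"

interpretation normal: real_distribution std_normal_distribution
  by (rule real_dist_normal_dist)

lemma DERIV_std_normal_density:
  "(std_normal_density has_real_derivative (- z * std_normal_density z)) (at z)"
  unfolding std_normal_density_def
  by (auto intro!: derivative_eq_intros simp: field_simps)

lemma cdf_std_normal_diff:
  assumes "x \<le> y"
  shows "cdf std_normal_distribution y - cdf std_normal_distribution x = integral {x..y} std_normal_density"
proof (cases "x = y")
  case False
  then have xy: "x < y" using assms by simp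
  have "cdf std_normal_distribution y - cdf std_normal_distribution x = measure std_normal_distribution {x<..y}"
    using normal.cdf_diff_eq[OF xy] .
  also have "\<dots> = measure std_normal_distribution {x..y}"
  proof -
    have "AE z in lborel. z \<noteq> x" by (rule AE_lborel_singleton)
    then have "AE z in std_normal_distribution. z \<in> {x<..y} \<longleftrightarrow> z \<in> {x..y}"
      by (subst AE_density) (auto elim!: eventually_mono)
    then show ?thesis by (intro normal.finite_measure_eq_AE) auto
  qed
  also have "\<dots> = (LINT z:{x..y}|lborel. std_normal_density z)"
  proof -
    have "measure std_normal_distribution {x..y} = (LINT z|std_normal_distribution. indicator {x..y} z)"
      by simp
    also have "\<dots> = (LINT z|lborel. std_normal_density z *\<^sub>R indicator {x..y} z)"
      by (subst integral_density) auto
    finally show ?thesis by (simp add: set_lebesgue_integral_def mult.commute)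
  qed
  also have "\<dots> = integral {x..y} std_normal_density"
  proof (intro set_borel_integral_eq_integral)
    show "set_integrable lborel {x..y} std_normal_density"
      unfolding set_integrable_def by (intro integrable_mult_indicator) auto
  qed
  finally show ?thesis .
qed simp

text \<open>Fundamental theorem of calculus on an interval with z in its interior. The formula with
  the integral holds only to the right of z - 1, hence the detour through a neighbourhood of
  z.\<close>

lemma DERIV_normal_tail:
  "(normal_tail has_real_derivative - std_normal_density z) (at z)"
proof -
  have cont: "continuous_on {z-1..z+1} std_normal_density"
    using DERIV_std_normal_density by (meson DERIV_isCont continuous_at_imp_continuous_on)
  have "((\<lambda>u. integral {z-1..u} std_normal_density) has_real_derivative std_normal_density z) (at z within {z-1..z+1})"
    by (rule integral_has_real_derivative[OF cont]) auto
  then have "((\<lambda>u. 1 - cdf std_normal_distribution (z-1) - integral {z-1..u} std_normal_density) has_real_derivative - std_normal_density z) (at z within {z-1..z+1})"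
    by (auto intro!: derivative_eq_intros)
  then have "((\<lambda>u. 1 - cdf std_normal_distribution (z-1) - integral {z-1..u} std_normal_density) has_real_derivative - std_normal_density z) (at z)"
    by (subst (asm) at_within_interior) auto
  then show ?thesis
  proof (rule DERIV_cong_ev[THEN iffD1, OF refl _ refl, rotated])
    have "\<forall>\<^sub>F x in nhds z. x > z - 1"
      using eventually_nhds_in_open[of "{z-1<..}" z] by simp
    then show "\<forall>\<^sub>F x in nhds z. 1 - cdf std_normal_distribution (z-1) - integral {z-1..x} std_normal_density = normal_tail x"
    proof eventually_elim
      case (elim x)
      then show ?case using cdf_std_normal_diff[of "z-1" x] by (simp add: normal_tail_def)
    qed
  qed
qed

lemmas DERIV_normal_tail_chain [derivative_intros] = DERIV_chain2[OF DERIV_normal_tail]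
lemmas DERIV_std_normal_density_chain [derivative_intros] = DERIV_chain2[OF DERIV_std_normal_density]

lemma normal_tail_measurable [measurable]: "normal_tail \<in> borel_measurable borel"
  by (intro borel_measurable_continuous_onI continuous_at_imp_continuous_on ballI DERIV_isCont[OF DERIV_normal_tail])

lemma normal_tail_bounds: "0 \<le> normal_tail z" "normal_tail z \<le> 1"
  using normal.cdf_bounded_prob[of z] normal.cdf_nonneg[of z] by (auto simp: normal_tail_def)

lemma normal_tail_tendsto_at_top: "(normal_tail \<longlongrightarrow> 0) at_top"
  using normal.cdf_lim_at_top_prob unfolding normal_tail_def
  by (auto intro!: tendsto_eq_intros)

lemma normal_tail_tendsto_at_bot: "(normal_tail \<longlongrightarrow> 1) at_bot"
  using normal.cdf_lim_at_bot unfolding normal_tail_def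
  by (auto intro!: tendsto_eq_intros)

lemma normal_tail_antimono: "x \<le> y \<Longrightarrow> normal_tail y \<le> normal_tail x"
  using normal.cdf_nondecreasing by (simp add: normal_tail_def)

lemma std_normal_density_pos: "0 < std_normal_density z"
  by (simp add: std_normal_density_def)

text \<open>The difference of the two sides decreases on the nonnegative half-line and tends to 0.
  This form of Mills' lower bound is valid down to z = 0; it converts errors of size exp (- x^2 / 2)
  into multiples of \<open>normal_tail x\<close> at the price of a factor 1 + x.\<close>

lemma normal_tail_ge:
  assumes "0 \<le> z"
  shows "std_normal_density z / (1 + z) \<le> normal_tail z"
proof -
  let ?g = "\<lambda>z. normal_tail z - std_normal_density z / (1 + z)"
  have lim: "(?g \<longlongrightarrow> 0 - 0) at_top"
    by (intro tendsto_diff normal_tail_tendsto_at_top) (unfold std_normal_density_def, real_asymp)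
  have "0 \<le> ?g z"
  proof (rule tendsto_upperbound)
    show "(?g \<longlongrightarrow> 0) at_top" using lim by simp
    show "\<forall>\<^sub>F y in at_top. ?g y \<le> ?g z"
      using eventually_ge_at_top[of z]
    proof eventually_elim
      case (elim y)
      show ?case
      proof (rule DERIV_nonpos_imp_nonincreasing[OF elim])
        fix x assume x: "z \<le> x" "x \<le> y"
        then have x0: "0 \<le> x" using assms by simp
        let ?d = "- std_normal_density x - (- x * std_normal_density x * (1 + x) - std_normal_density x * 1) / ((1 + x) * (1 + x))"
        have "(?g has_real_derivative ?d) (at x)"
          using x0 by (auto intro!: derivative_eq_intros)
        moreover have "?d = std_normal_density x * (-x / (1+x)^2)"
          using x0 by (simp add: divide_simps) (simp add: algebra_simps power2_eq_square)
        moreover have "\<dots> \<le> 0"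
          using x0 std_normal_density_pos[of x] by (intro mult_nonneg_nonpos) auto
        ultimately show "\<exists>d. (?g has_real_derivative d) (at x) \<and> d \<le> 0" by metis
      qed
    qed
  qed auto
  then show ?thesis by simp
qed

lemma normal_tail_le:
  assumes "0 < z"
  shows "normal_tail z \<le> std_normal_density z / z"
proof -
  let ?g = "\<lambda>z. std_normal_density z / z - normal_tail z"
  have lim: "(?g \<longlongrightarrow> 0 - 0) at_top"
    by (intro tendsto_diff normal_tail_tendsto_at_top) (unfold std_normal_density_def, real_asymp)
  have "0 \<le> ?g z"
  proof (rule tendsto_upperbound)
    show "(?g \<longlongrightarrow> 0) at_top" using lim by simp
    show "\<forall>\<^sub>F y in at_top. ?g y \<le> ?g z"
      using eventually_ge_at_top[of z]
    proof eventually_elim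
      case (elim y)
      show ?case
      proof (rule DERIV_nonpos_imp_nonincreasing[OF elim])
        fix x assume x: "z \<le> x" "x \<le> y"
        then have x0: "0 < x" using assms by simp
        let ?d = "(- x * std_normal_density x * x - std_normal_density x * 1) / (x * x) - (- std_normal_density x)"
        have "(?g has_real_derivative ?d) (at x)"
          using x0 by (auto intro!: derivative_eq_intros)
        moreover have "?d = - std_normal_density x / x^2"
          using x0 by (simp add: divide_simps) (simp add: algebra_simps power2_eq_square)
        moreover have "\<dots> \<le> 0"
          using std_normal_density_pos[of x] by auto
        ultimately show "\<exists>d. (?g has_real_derivative d) (at x) \<and> d \<le> 0" by metis
      qed
    qed
  qed auto
  then show ?thesis by simp
qed

text \<open>Mean value theorem; on the interval from x - h to x the density is at most exp (x h)
  times its value at x, and Mills' lower bound makes the change relative. A shift is thus harmless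
  as soon as h (1 + x) is small.\<close>

lemma normal_tail_shift_left:
  assumes "0 < x" "0 \<le> h"
  shows "normal_tail (x - h) \<le> (1 + h * (1 + x) * exp (x * h)) * normal_tail x"
proof -
  have phi: "std_normal_density x \<le> (1 + x) * normal_tail x"
    using normal_tail_ge[of x] assms by (simp add: divide_simps mult.commute)
  have "normal_tail (x - h) - normal_tail x \<le> h * (std_normal_density x * exp (x * h))"
  proof (cases "h = 0")
    case False
    then have "x - h < x" using assms by simp
    then obtain \<xi> where \<xi>: "x - h < \<xi>" "\<xi> < x"
      "normal_tail x - normal_tail (x - h) = (x - (x - h)) * (- std_normal_density \<xi>)"
      using MVT2[of "x - h" x normal_tail "\<lambda>z. - std_normal_density z"] DERIV_normal_tail by blast
    have "- \<xi>\<^sup>2 / 2 \<le> - x\<^sup>2 / 2 + x * h"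
    proof -
      have "x * (x - \<xi>) \<le> x * h" using \<xi> assms by (intro mult_left_mono) auto
      moreover have "0 \<le> (x - \<xi>)\<^sup>2" by simp
      ultimately show ?thesis by (simp add: power2_eq_square algebra_simps)
    qed
    then have "std_normal_density \<xi> \<le> std_normal_density x * exp (x * h)"
      unfolding std_normal_density_def by (simp add: exp_add[symmetric] divide_right_mono)
    then have "h * std_normal_density \<xi> \<le> h * (std_normal_density x * exp (x * h))"
      using assms by (intro mult_left_mono)
    moreover have "normal_tail (x - h) - normal_tail x = h * std_normal_density \<xi>"
      using \<xi>(3) by simp
    ultimately show ?thesis by linarith
  qed simp
  also have "\<dots> \<le> h * (((1 + x) * normal_tail x) * exp (x * h))"
    using phi assms by (intro mult_left_mono mult_right_mono) auto
  finally show ?thesis by (simp add: algebra_simps)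
qed

lemma normal_tail_shift_right:
  assumes "0 < x" "0 \<le> h"
  shows "(1 - h * (1 + x)) * normal_tail x \<le> normal_tail (x + h)"
proof -
  have phi: "std_normal_density x \<le> (1 + x) * normal_tail x"
    using normal_tail_ge[of x] assms by (simp add: divide_simps mult.commute)
  have "normal_tail x - normal_tail (x + h) \<le> h * std_normal_density x"
  proof (cases "h = 0")
    case False
    then have "x < x + h" using assms by simp
    then obtain \<xi> where \<xi>: "x < \<xi>" "\<xi> < x + h"
      "normal_tail (x + h) - normal_tail x = (x + h - x) * (- std_normal_density \<xi>)"
      using MVT2[of x "x + h" normal_tail "\<lambda>z. - std_normal_density z"] DERIV_normal_tail by blast
    have "x\<^sup>2 \<le> \<xi>\<^sup>2" using \<xi> assms by (intro power_mono) auto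
    then have "std_normal_density \<xi> \<le> std_normal_density x"
      unfolding std_normal_density_def by (simp add: divide_right_mono)
    then have "h * std_normal_density \<xi> \<le> h * std_normal_density x"
      using assms by (intro mult_left_mono)
    moreover have "normal_tail x - normal_tail (x + h) = h * std_normal_density \<xi>"
      using \<xi>(3) by simp
    ultimately show ?thesis by linarith
  qed simp
  also have "\<dots> \<le> h * ((1 + x) * normal_tail x)"
    using phi assms by (intro mult_left_mono) auto
  finally show ?thesis by (simp add: algebra_simps)
qed

text \<open>Gaussian smoothing of the indicator of \<open>{x..}\<close>; it solves the heat equation in \<open>v\<close>,
  so the Gaussian summands of Lindeberg's exchange argument never have to be constructed.\<close>
definition smooth_ind :: "real \<Rightarrow> real \<Rightarrow> real \<Rightarrow> real" where
  "smooth_ind x v u = normal_tail ((x - u) / sqrt v)"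

definition smooth_ind1 :: "real \<Rightarrow> real \<Rightarrow> real \<Rightarrow> real" where
  "smooth_ind1 x v u = std_normal_density ((x - u) / sqrt v) / sqrt v"

definition smooth_ind2 :: "real \<Rightarrow> real \<Rightarrow> real \<Rightarrow> real" where
  "smooth_ind2 x v u = (x - u) / sqrt v * std_normal_density ((x - u) / sqrt v) / v"

lemma smooth_ind_measurable [measurable]:
  "smooth_ind x v \<in> borel_measurable borel"
  "smooth_ind1 x v \<in> borel_measurable borel"
  "smooth_ind2 x v \<in> borel_measurable borel"
  unfolding smooth_ind_def smooth_ind1_def smooth_ind2_def by measurable

lemma DERIV_smooth_ind:
  assumes "0 < v"
  shows "(smooth_ind x v has_real_derivative smooth_ind1 x v u) (at u)"
  unfolding smooth_ind_def smooth_ind1_def using assms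
  by (auto intro!: derivative_eq_intros simp: divide_simps)

lemma DERIV_smooth_ind1:
  assumes "0 < v"
  shows "(smooth_ind1 x v has_real_derivative smooth_ind2 x v u) (at u)"
  unfolding smooth_ind1_def smooth_ind2_def using assms
  by (auto intro!: derivative_eq_intros simp: divide_simps)

lemma DERIV_smooth_ind2:
  assumes "0 < v"
  shows "(smooth_ind2 x v has_real_derivative
    (((x - u) / sqrt v)\<^sup>2 - 1) * std_normal_density ((x - u) / sqrt v) / (v * sqrt v)) (at u)"
  unfolding smooth_ind2_def
  apply (rule DERIV_cong, (rule derivative_intros refl | use assms in simp; fail)+)
  using assms by (simp add: divide_simps power2_eq_square) (simp add: algebra_simps)

lemma DERIV_smooth_ind_var:
  assumes "0 < v"
  shows "((\<lambda>v. smooth_ind x v u) has_real_derivative smooth_ind2 x v u / 2) (at v)"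
proof -
  have "((\<lambda>v. (x - u) / sqrt v) has_real_derivative - ((x - u) / sqrt v) / (2 * v)) (at v)"
    using assms by (auto intro!: derivative_eq_intros simp: divide_simps)
  from DERIV_chain2[OF DERIV_normal_tail this] show ?thesis
    unfolding smooth_ind_def by (rule DERIV_cong) (simp add: smooth_ind2_def mult_ac)
qed

text \<open>By the heat equation this is half the fourth derivative in \<open>u\<close>, whence the
  cubic Hermite polynomial.\<close>

lemma DERIV_smooth_ind2_var:
  assumes "0 < v"
  shows "((\<lambda>v. smooth_ind2 x v u) has_real_derivative
    (((x - u) / sqrt v) ^ 3 - 3 * ((x - u) / sqrt v)) * std_normal_density ((x - u) / sqrt v) / (2 * v\<^sup>2)) (at v)"
proof -
  let ?z = "\<lambda>v. (x - u) / sqrt v"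
  have 1: "(?z has_real_derivative - ?z v / (2 * v)) (at v)"
    using assms by (auto intro!: derivative_eq_intros simp: divide_simps)
  have "((\<lambda>v. ?z v * std_normal_density (?z v) / v) has_real_derivative
    ((- ?z v / (2 * v) * std_normal_density (?z v) + (- ?z v * std_normal_density (?z v)) * (- ?z v / (2 * v)) * ?z v) * v
     - ?z v * std_normal_density (?z v) * 1) / (v * v)) (at v)"
    using assms by (intro DERIV_divide DERIV_mult 1 DERIV_chain2[OF DERIV_std_normal_density] DERIV_ident) auto
  moreover have "((- z / (2 * v) * d + (- z * d) * (- z / (2 * v)) * z) * v - z * d * 1) / (v * v)
    = (z ^ 3 - 3 * z) * d / (2 * v\<^sup>2)" for z d
    using assms by (simp add: divide_simps power2_eq_square power3_eq_cube) (simp add: algebra_simps)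
  ultimately show ?thesis unfolding smooth_ind2_def by metis
qed

text \<open>Completing the square, - z^2 / 2 = - (z - a)^2 / 2 + a^2 / 2 - a z. The factor exp (- (z
  - a)^2 / 2) is spent on the polynomial, recentred at \<open>a\<close>, and a pure exponential in z
  remains. The cube covers the polynomials in the derivatives that occur.\<close>

lemma std_normal_density_poly_bound:
  assumes "0 \<le> a"
  shows "(1 + \<bar>z\<bar>) ^ 3 * std_normal_density z \<le> 27 * (1 + a) ^ 3 * exp (a\<^sup>2 / 2 - a * z)"
proof -
  let ?w = "\<bar>z - a\<bar>"
  \<comment> \<open>The 6 is chosen so that the third power of exp (y^2 / 6) is exactly exp (y^2 /
    2).\<close>
  have "1 + y \<le> 3 * (1 + y\<^sup>2 / 6)" for y :: real
  proof -
    have "(y - 1)\<^sup>2 = y\<^sup>2 - 2 * y + 1" by (simp add: power2_eq_square algebra_simps)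
    then show ?thesis using zero_le_power2[of "y - 1"] zero_le_power2[of y] by argo
  qed
  then have "1 + ?w \<le> 3 * (1 + ?w\<^sup>2 / 6)" .
  also have "\<dots> \<le> 3 * exp (?w\<^sup>2 / 6)" by (intro mult_left_mono exp_ge_add_one_self) auto
  finally have "(1 + ?w) ^ 3 \<le> (3 * exp (?w\<^sup>2 / 6)) ^ 3" by (intro power_mono) auto
  also have "\<dots> = 27 * exp (?w\<^sup>2 / 2)" by (simp add: power_mult_distrib exp_of_nat_mult[symmetric])
  finally have w: "(1 + ?w) ^ 3 \<le> 27 * exp (?w\<^sup>2 / 2)" .
  have "1 + \<bar>z\<bar> \<le> (1 + a) * (1 + ?w)"
  proof -
    have "\<bar>z\<bar> \<le> ?w + a" using assms by linarith
    moreover have "0 \<le> a * ?w" using assms by simp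
    ultimately show ?thesis by (simp only: distrib_left distrib_right mult_1_left mult_1_right)
  qed
  then have "(1 + \<bar>z\<bar>) ^ 3 \<le> ((1 + a) * (1 + ?w)) ^ 3" by (intro power_mono) auto
  also have "\<dots> = (1 + a) ^ 3 * (1 + ?w) ^ 3" by (simp add: power_mult_distrib)
  also have "\<dots> \<le> (1 + a) ^ 3 * (27 * exp (?w\<^sup>2 / 2))" using w assms by (intro mult_left_mono) auto
  finally have 1: "(1 + \<bar>z\<bar>) ^ 3 \<le> 27 * (1 + a) ^ 3 * exp (?w\<^sup>2 / 2)" by (simp add: mult_ac)
  have "1 / sqrt (2 * pi) \<le> 1" using pi_gt3 by (simp add: divide_simps)
  then have "std_normal_density z \<le> 1 * exp (- z\<^sup>2 / 2)"
    unfolding std_normal_density_def by (intro mult_right_mono) auto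
  then have "(1 + \<bar>z\<bar>) ^ 3 * std_normal_density z \<le> (27 * (1 + a) ^ 3 * exp (?w\<^sup>2 / 2)) * exp (- z\<^sup>2 / 2)"
    using 1 assms by (intro mult_mono) auto
  also have "\<dots> = 27 * (1 + a) ^ 3 * exp (?w\<^sup>2 / 2 + - z\<^sup>2 / 2)" by (simp only: exp_add mult_ac)
  also have "?w\<^sup>2 / 2 + - z\<^sup>2 / 2 = a\<^sup>2 / 2 - a * z"
    unfolding power2_abs power2_diff by (simp add: field_simps)
  finally show ?thesis .
qed

text \<open>Dominates the derivatives of \<open>smooth_ind x v\<close>, for every tilt \<open>s\<close>.\<close>
definition tilt_bound :: "real \<Rightarrow> real \<Rightarrow> real \<Rightarrow> real \<Rightarrow> real" where
  "tilt_bound s x v u = 27 * (1 + s * sqrt v) ^ 3 * exp (s\<^sup>2 * v / 2 + s * (u - x))"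

lemma tilt_bound_nonneg: "0 \<le> s \<Longrightarrow> 0 \<le> v \<Longrightarrow> 0 \<le> tilt_bound s x v u"
  by (simp add: tilt_bound_def)

text \<open>The choice a = s sqrt v turns a z into s (x - u), so the variance cancels from the
  linear part of the exponent.\<close>

lemma poly_density_le_tilt_bound:
  assumes "0 < v" "0 \<le> s"
  shows "(1 + \<bar>(x - u) / sqrt v\<bar>) ^ 3 * std_normal_density ((x - u) / sqrt v) \<le> tilt_bound s x v u"
proof -
  have "s * sqrt v * ((x - u) / sqrt v) = s * (x - u)" "(s * sqrt v)\<^sup>2 = s\<^sup>2 * v"
    using assms by (simp_all add: power_mult_distrib)
  then have "(s * sqrt v)\<^sup>2 / 2 - s * sqrt v * ((x - u) / sqrt v) = s\<^sup>2 * v / 2 - s * (x - u)"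
    by (simp only:)
  also have "\<dots> = s\<^sup>2 * v / 2 + s * (u - x)" by (simp add: algebra_simps)
  finally have "(s * sqrt v)\<^sup>2 / 2 - s * sqrt v * ((x - u) / sqrt v) = s\<^sup>2 * v / 2 + s * (u - x)" .
  then show ?thesis
    using std_normal_density_poly_bound[of "s * sqrt v" "(x - u) / sqrt v"] assms
    unfolding tilt_bound_def by simp
qed

lemma one_add_abs_cube: "(1 + \<bar>z\<bar>) ^ 3 = 1 + 3 * \<bar>z\<bar> + 3 * \<bar>z\<bar>\<^sup>2 + \<bar>z\<bar> ^ 3" for z :: real
  by (simp add: power2_eq_square power3_eq_cube algebra_simps)

lemma abs_times_density_le:
  assumes "\<bar>P\<bar> \<le> (1 + \<bar>(x - u) / sqrt v\<bar>) ^ 3" "0 < v" "0 \<le> s"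
  shows "\<bar>P * std_normal_density ((x - u) / sqrt v)\<bar> \<le> tilt_bound s x v u"
proof -
  have "\<bar>P * std_normal_density ((x - u) / sqrt v)\<bar> = \<bar>P\<bar> * std_normal_density ((x - u) / sqrt v)"
    by (simp add: abs_mult)
  also have "\<dots> \<le> (1 + \<bar>(x - u) / sqrt v\<bar>) ^ 3 * std_normal_density ((x - u) / sqrt v)"
    using assms by (intro mult_right_mono) auto
  also have "\<dots> \<le> tilt_bound s x v u" using poly_density_le_tilt_bound assms by blast
  finally show ?thesis .
qed

lemma smooth_ind1_bound:
  assumes "0 < v" "0 \<le> s"
  shows "\<bar>smooth_ind1 x v u\<bar> \<le> tilt_bound s x v u / sqrt v"
proof -
  have "\<bar>1 * std_normal_density ((x - u) / sqrt v)\<bar> \<le> tilt_bound s x v u"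
    using assms by (intro abs_times_density_le) (auto simp: one_add_abs_cube)
  then show ?thesis using assms by (simp add: smooth_ind1_def divide_right_mono)
qed

lemma smooth_ind2_bound:
  assumes "0 < v" "0 \<le> s"
  shows "\<bar>smooth_ind2 x v u\<bar> \<le> tilt_bound s x v u / v"
proof -
  have "\<bar>z\<bar> \<le> (1 + \<bar>z\<bar>) ^ 3" for z :: real
    using zero_le_power2[of z] zero_le_power[of "\<bar>z\<bar>" 3] abs_ge_zero[of z]
    unfolding one_add_abs_cube power2_abs by linarith
  then have "\<bar>(x - u) / sqrt v * std_normal_density ((x - u) / sqrt v)\<bar> \<le> tilt_bound s x v u"
    using assms by (intro abs_times_density_le)
  then have "\<bar>(x - u) / sqrt v * std_normal_density ((x - u) / sqrt v)\<bar> / v \<le> tilt_bound s x v u / v"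
    using assms by (intro divide_right_mono) auto
  then show ?thesis using assms by (simp add: smooth_ind2_def abs_mult)
qed

lemma smooth_ind2_deriv_bound:
  assumes "0 < v" "0 \<le> s"
  shows "\<bar>(((x - u) / sqrt v)\<^sup>2 - 1) * std_normal_density ((x - u) / sqrt v) / (v * sqrt v)\<bar>
    \<le> tilt_bound s x v u / (v * sqrt v)"
proof -
  let ?z = "(x - u) / sqrt v"
  have "\<bar>?z\<^sup>2 - 1\<bar> \<le> (1 + \<bar>?z\<bar>) ^ 3"
    using zero_le_power2[of ?z] zero_le_power[of "\<bar>?z\<bar>" 3] abs_ge_zero[of ?z]
    unfolding one_add_abs_cube power2_abs by linarith
  then have "\<bar>(?z\<^sup>2 - 1) * std_normal_density ?z\<bar> \<le> tilt_bound s x v u"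
    using assms by (intro abs_times_density_le) auto
  then have "\<bar>(?z\<^sup>2 - 1) * std_normal_density ?z\<bar> / (v * sqrt v) \<le> tilt_bound s x v u / (v * sqrt v)"
    using assms by (intro divide_right_mono) auto
  then show ?thesis using assms by (simp add: abs_mult)
qed

lemma smooth_ind2_var_deriv_bound:
  assumes "0 < v" "0 \<le> s"
  shows "\<bar>(((x - u) / sqrt v) ^ 3 - 3 * ((x - u) / sqrt v)) * std_normal_density ((x - u) / sqrt v) / (2 * v\<^sup>2)\<bar>
    \<le> tilt_bound s x v u / (2 * v\<^sup>2)"
proof -
  let ?z = "(x - u) / sqrt v"
  have "\<bar>?z ^ 3 - 3 * ?z\<bar> \<le> \<bar>?z\<bar> ^ 3 + 3 * \<bar>?z\<bar>"
    using abs_triangle_ineq4[of "?z^3" "3 * ?z"] by (simp only: power_abs abs_mult abs_numeral)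
  then have "\<bar>?z ^ 3 - 3 * ?z\<bar> \<le> (1 + \<bar>?z\<bar>) ^ 3"
    using zero_le_power2[of ?z] unfolding one_add_abs_cube power2_abs by linarith
  then have "\<bar>(?z ^ 3 - 3 * ?z) * std_normal_density ?z\<bar> \<le> tilt_bound s x v u"
    using assms by (intro abs_times_density_le) auto
  then have "\<bar>(?z ^ 3 - 3 * ?z) * std_normal_density ?z\<bar> / (2 * v\<^sup>2) \<le> tilt_bound s x v u / (2 * v\<^sup>2)"
    using assms by (intro divide_right_mono) auto
  then show ?thesis using assms by (simp add: abs_mult)
qed

section \<open>Exponential moments of truncated sums\<close>

text \<open>The squares \<open>(w i)\<^sup>2\<close> are probability weights; Jensen's inequality
  for the convex power \<theta> = (r - 2) / (q - 2) is applied to the values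
  \<open>w i powr (q - 2)\<close>.\<close>

lemma power_sum_interpolation:
  fixes w :: "'i \<Rightarrow> real"
  assumes "finite A" "\<And>i. i \<in> A \<Longrightarrow> 0 < w i" "(\<Sum>i\<in>A. (w i)\<^sup>2) = 1" "2 < q" "q \<le> r"
  shows "(\<Sum>i\<in>A. w i powr q) powr ((r - 2) / (q - 2)) \<le> (\<Sum>i\<in>A. w i powr r)"
proof -
  define \<theta> where "\<theta> = (r - 2) / (q - 2)"
  have \<theta>: "1 \<le> \<theta>" "(q - 2) * \<theta> = r - 2" using assms by (auto simp: \<theta>_def)
  have sq: "(w i)\<^sup>2 * w i powr e = w i powr (2 + e)" if "i \<in> A" for i e
    using assms(2)[OF that] by (simp add: powr_add powr_numeral)
  have "A \<noteq> {}" using assms(3) by auto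
  then have "(\<Sum>i\<in>A. (w i)\<^sup>2 *\<^sub>R w i powr (q - 2)) powr \<theta> \<le> (\<Sum>i\<in>A. (w i)\<^sup>2 * (w i powr (q - 2)) powr \<theta>)"
  proof (intro convex_on_sum[OF _ _ powr_convex[of \<theta>]])
    show "w i powr (q - 2) \<in> {0<..}" if "i \<in> A" for i using assms(2)[OF that] by simp
  qed (use assms \<theta>(1) in auto)
  moreover have "(\<Sum>i\<in>A. (w i)\<^sup>2 *\<^sub>R w i powr (q - 2)) = (\<Sum>i\<in>A. w i powr q)"
    by (intro sum.cong refl) (simp add: sq)
  moreover have "(\<Sum>i\<in>A. (w i)\<^sup>2 * (w i powr (q - 2)) powr \<theta>) = (\<Sum>i\<in>A. w i powr r)"
    by (intro sum.cong refl) (simp add: sq powr_powr \<theta>)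
  ultimately show ?thesis by (simp add: \<theta>_def)
qed

section \<open>Standardized i.i.d. sequences and their truncations\<close>

locale iid_standard = prob_space M for M :: "'a measure" +
  fixes Z :: "nat \<Rightarrow> 'a \<Rightarrow> real"
  assumes indep_Z: "indep_vars (\<lambda>_. borel) Z UNIV"
    and distr_Z: "\<And>i. distr M borel (Z i) = distr M borel (Z 0)"
    and square_integrable_Z0: "integrable M (\<lambda>\<omega>. (Z 0 \<omega>)\<^sup>2)"
    and mean_Z0: "expectation (Z 0) = 0"
    and second_moment_Z0: "expectation (\<lambda>\<omega>. (Z 0 \<omega>)\<^sup>2) = 1"
begin

lemma Z_measurable [measurable]: "Z i \<in> borel_measurable M"
  using indep_Z by (auto simp: indep_vars_def)

lemma
  fixes f :: "real \<Rightarrow> real"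
  assumes [measurable]: "f \<in> borel_measurable borel"
  shows integrable_Z_iff: "integrable M (\<lambda>\<omega>. f (Z i \<omega>)) \<longleftrightarrow> integrable M (\<lambda>\<omega>. f (Z 0 \<omega>))"
    and expectation_Z: "expectation (\<lambda>\<omega>. f (Z i \<omega>)) = expectation (\<lambda>\<omega>. f (Z 0 \<omega>))"
proof -
  have "integrable M (\<lambda>\<omega>. f (Z i \<omega>)) \<longleftrightarrow> integrable (distr M borel (Z i)) f" for i
    by (simp add: integrable_distr_eq)
  then show "integrable M (\<lambda>\<omega>. f (Z i \<omega>)) \<longleftrightarrow> integrable M (\<lambda>\<omega>. f (Z 0 \<omega>))"
    using distr_Z[of i] by metis
  have "expectation (\<lambda>\<omega>. f (Z i \<omega>)) = integral\<^sup>L (distr M borel (Z i)) f" for i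
    by (simp add: integral_distr)
  then show "expectation (\<lambda>\<omega>. f (Z i \<omega>)) = expectation (\<lambda>\<omega>. f (Z 0 \<omega>))"
    using distr_Z[of i] by metis
qed

lemma prob_Z:
  assumes [measurable]: "B \<in> sets borel"
  shows "prob {\<omega> \<in> space M. Z i \<omega> \<in> B} = prob {\<omega> \<in> space M. Z 0 \<omega> \<in> B}"
proof -
  have "prob {\<omega> \<in> space M. Z i \<omega> \<in> B} = measure (distr M borel (Z i)) B" for i
    by (subst measure_distr) (auto intro!: arg_cong[where f=prob])
  then show ?thesis using distr_Z[of i] by metis
qed

lemma square_integrable_Z [simp]: "integrable M (\<lambda>\<omega>. (Z i \<omega>)\<^sup>2)"
  using integrable_Z_iff[of "\<lambda>x. x\<^sup>2" i] square_integrable_Z0 by simp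

lemma integrable_Z [simp]: "integrable M (Z i)"
  by (rule square_integrable_imp_integrable) auto

lemma mean_Z [simp]: "expectation (Z i) = 0"
  using expectation_Z[of "\<lambda>x. x" i] mean_Z0 by simp

lemma second_moment_Z [simp]: "expectation (\<lambda>\<omega>. (Z i \<omega>)\<^sup>2) = 1"
  using expectation_Z[of "\<lambda>x. x\<^sup>2" i] second_moment_Z0 by simp

lemma indep_fun_Z:
  assumes "\<And>i. i \<in> A \<Longrightarrow> f i \<in> borel_measurable borel"
  shows "indep_vars (\<lambda>_. borel) (\<lambda>i \<omega>. f i (Z i \<omega>)) A"
  using indep_vars_compose2[OF indep_vars_subset[OF indep_Z], of A f "\<lambda>_. borel"] assms by auto

lemma indep_Z_sum:
  assumes "finite A" "i \<notin> A" "\<And>i. f i \<in> borel_measurable borel"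
  shows "indep_var borel (\<lambda>\<omega>. f i (Z i \<omega>)) borel (\<lambda>\<omega>. \<Sum>j\<in>A. f j (Z j \<omega>) :: real)"
  using assms indep_vars_sum[OF assms(1,2) indep_fun_Z[of "insert i A" f]] by simp

lemma
  assumes "finite A"
  shows square_integrable_weighted_sum: "integrable M (\<lambda>\<omega>. (\<Sum>i\<in>A. a i * Z i \<omega>)\<^sup>2)"
    and second_moment_weighted_sum: "expectation (\<lambda>\<omega>. (\<Sum>i\<in>A. a i * Z i \<omega>)\<^sup>2) = (\<Sum>i\<in>A. (a i)\<^sup>2)"
proof -
  have "integrable M (\<lambda>\<omega>. (\<Sum>i\<in>A. a i * Z i \<omega>)\<^sup>2) \<and>
    expectation (\<lambda>\<omega>. (\<Sum>i\<in>A. a i * Z i \<omega>)\<^sup>2) = (\<Sum>i\<in>A. (a i)\<^sup>2)"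
    using assms
  proof induction
    case (insert i A)
    let ?S = "\<lambda>\<omega>. \<Sum>i\<in>A. a i * Z i \<omega>"
    have ind: "indep_var borel (\<lambda>\<omega>. a i * Z i \<omega>) borel ?S"
      using insert by (intro indep_Z_sum) auto
    have int_S: "integrable M ?S" by simp
    have "(\<lambda>\<omega>. (\<Sum>j\<in>insert i A. a j * Z j \<omega>)\<^sup>2) =
      (\<lambda>\<omega>. (a i)\<^sup>2 * (Z i \<omega>)\<^sup>2 + 2 * (a i * Z i \<omega> * ?S \<omega>) + (?S \<omega>)\<^sup>2)"
      using insert by (auto simp: power2_eq_square algebra_simps)
    moreover have "integrable M (\<lambda>\<omega>. a i * Z i \<omega> * ?S \<omega>)"
      using indep_var_integrable[OF ind] int_S by simp
    moreover have "expectation (\<lambda>\<omega>. a i * Z i \<omega> * ?S \<omega>) = 0"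
      using indep_var_lebesgue_integral[OF ind] int_S by simp
    ultimately show ?case using insert by simp
  qed simp
  then show "integrable M (\<lambda>\<omega>. (\<Sum>i\<in>A. a i * Z i \<omega>)\<^sup>2)"
    "expectation (\<lambda>\<omega>. (\<Sum>i\<in>A. a i * Z i \<omega>)\<^sup>2) = (\<Sum>i\<in>A. (a i)\<^sup>2)" by auto
qed

lemma weighted_sum_chebyshev:
  assumes "finite A" "0 < x"
  shows "prob {\<omega> \<in> space M. \<bar>\<Sum>i\<in>A. a i * Z i \<omega>\<bar> \<ge> x} \<le> (\<Sum>i\<in>A. (a i)\<^sup>2) / x\<^sup>2"
proof -
  have "expectation (\<lambda>\<omega>. \<Sum>i\<in>A. a i * Z i \<omega>) = 0" by simp
  then show ?thesis
    using Chebyshev_inequality[of "\<lambda>\<omega>. \<Sum>i\<in>A. a i * Z i \<omega>" x] assms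
    by (simp add: square_integrable_weighted_sum second_moment_weighted_sum)
qed

text \<open>Truncation from above only: for a positive tilt \<open>s\<close> this already bounds the
  exponential, while the left tail, about which little is known, is left as it is.\<close>

abbreviation "trunc_sum A w y \<omega> \<equiv> \<Sum>i\<in>A. min (w i * Z i \<omega>) y"

definition absmom :: "real \<Rightarrow> real" where "absmom q = expectation (\<lambda>\<omega>. \<bar>Z 0 \<omega>\<bar> powr q)"
definition posmom :: "real \<Rightarrow> real" where "posmom r = expectation (\<lambda>\<omega>. max (Z 0 \<omega>) 0 powr r)"

lemma absmom_nonneg: "0 \<le> absmom q" by (simp add: absmom_def)
lemma posmom_nonneg: "0 \<le> posmom q" by (simp add: posmom_def)

end

text \<open>The exponent \<open>q\<close> measures Taylor errors of second-order expansions, hence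
  \<open>q \<le> 3\<close>, and concerns both tails; \<open>r\<close> concerns the positive part and
  is chosen later, anywhere between 2 and the tail index.\<close>

locale iid_standard_moments = iid_standard +
  fixes q r :: real
  assumes q: "2 < q" "q \<le> 3" and r: "2 < r"
    and integrable_abs_Z0: "integrable M (\<lambda>\<omega>. \<bar>Z 0 \<omega>\<bar> powr q)"
    and integrable_pos_Z0: "integrable M (\<lambda>\<omega>. max (Z 0 \<omega>) 0 powr r)"
begin

lemma
  shows integrable_abs_Z [simp]: "integrable M (\<lambda>\<omega>. \<bar>Z i \<omega>\<bar> powr q)"
    and expectation_abs_Z [simp]: "expectation (\<lambda>\<omega>. \<bar>Z i \<omega>\<bar> powr q) = absmom q"
  using integrable_Z_iff[of "\<lambda>x. \<bar>x\<bar> powr q" i] expectation_Z[of "\<lambda>x. \<bar>x\<bar> powr q" i] integrable_abs_Z0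
  by (simp_all add: absmom_def)

lemma
  shows integrable_pos_Z [simp]: "integrable M (\<lambda>\<omega>. max (Z i \<omega>) 0 powr r)"
    and expectation_pos_Z [simp]: "expectation (\<lambda>\<omega>. max (Z i \<omega>) 0 powr r) = posmom r"
  using integrable_Z_iff[of "\<lambda>x. max x 0 powr r" i] expectation_Z[of "\<lambda>x. max x 0 powr r" i] integrable_pos_Z0
  by (simp_all add: posmom_def)

lemma trunc_abs_le: "0 < w \<Longrightarrow> 0 < y \<Longrightarrow> \<bar>min (w * Z i \<omega>) y\<bar> \<le> w * \<bar>Z i \<omega>\<bar>"
proof -
  assume "0 < w" "0 < y"
  then have "\<bar>min (w * Z i \<omega>) y\<bar> \<le> \<bar>w * Z i \<omega>\<bar>" by (auto simp: min_def)
  then show ?thesis using \<open>0 < w\<close> by (simp add: abs_mult)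
qed

lemma integrable_trunc:
  assumes "0 < w" "0 < y"
  shows "integrable M (\<lambda>\<omega>. min (w * Z i \<omega>) y)"
    and "integrable M (\<lambda>\<omega>. (min (w * Z i \<omega>) y)\<^sup>2)"
    and "integrable M (\<lambda>\<omega>. \<bar>min (w * Z i \<omega>) y\<bar> powr q)"
proof -
  show "integrable M (\<lambda>\<omega>. min (w * Z i \<omega>) y)" by (simp add: integrable_min)
  show "integrable M (\<lambda>\<omega>. (min (w * Z i \<omega>) y)\<^sup>2)"
  proof (rule Bochner_Integration.integrable_bound)
    show "integrable M (\<lambda>\<omega>. w\<^sup>2 * (Z i \<omega>)\<^sup>2)" by simp
    show "AE \<omega> in M. norm ((min (w * Z i \<omega>) y)\<^sup>2) \<le> norm (w\<^sup>2 * (Z i \<omega>)\<^sup>2)"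
    proof (rule AE_I2)
      fix \<omega>
      have "\<bar>min (w * Z i \<omega>) y\<bar>\<^sup>2 \<le> (w * \<bar>Z i \<omega>\<bar>)\<^sup>2"
        using trunc_abs_le[OF assms] by (intro power_mono) auto
      then show "norm ((min (w * Z i \<omega>) y)\<^sup>2) \<le> norm (w\<^sup>2 * (Z i \<omega>)\<^sup>2)"
        by (simp add: power_mult_distrib)
    qed
  qed simp
  show "integrable M (\<lambda>\<omega>. \<bar>min (w * Z i \<omega>) y\<bar> powr q)"
  proof (rule Bochner_Integration.integrable_bound)
    show "integrable M (\<lambda>\<omega>. w powr q * \<bar>Z i \<omega>\<bar> powr q)" by simp
    show "AE \<omega> in M. norm (\<bar>min (w * Z i \<omega>) y\<bar> powr q) \<le> norm (w powr q * \<bar>Z i \<omega>\<bar> powr q)"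
    proof (rule AE_I2)
      fix \<omega>
      have "\<bar>min (w * Z i \<omega>) y\<bar> powr q \<le> (w * \<bar>Z i \<omega>\<bar>) powr q"
        using trunc_abs_le[OF assms] q by (intro powr_mono2) auto
      then show "norm (\<bar>min (w * Z i \<omega>) y\<bar> powr q) \<le> norm (w powr q * \<bar>Z i \<omega>\<bar> powr q)"
        using assms by (simp add: powr_mult)
    qed
  qed simp
qed

text \<open>The last two bounds measure what truncation removes from the mean and the second moment.
  Both losses are proportional to \<open>w powr q\<close>, so that summation over the array produces
  the power sum of order \<open>q\<close>.\<close>

lemma trunc_moments:
  assumes "0 < w" "0 < y"
  shows "expectation (\<lambda>\<omega>. min (w * Z i \<omega>) y) \<le> 0"
    and "expectation (\<lambda>\<omega>. (min (w * Z i \<omega>) y)\<^sup>2) \<le> w\<^sup>2"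
    and "expectation (\<lambda>\<omega>. \<bar>min (w * Z i \<omega>) y\<bar> powr q) \<le> w powr q * absmom q"
    and "- expectation (\<lambda>\<omega>. min (w * Z i \<omega>) y) \<le> w powr q * absmom q * y powr (1 - q)"
    and "w\<^sup>2 - expectation (\<lambda>\<omega>. (min (w * Z i \<omega>) y)\<^sup>2) \<le> w powr q * absmom q * y powr (2 - q)"
proof -
  note [simp] = integrable_trunc[OF assms]
  have "expectation (\<lambda>\<omega>. min (w * Z i \<omega>) y) \<le> expectation (\<lambda>\<omega>. w * Z i \<omega>)"
    by (intro integral_mono) auto
  then show "expectation (\<lambda>\<omega>. min (w * Z i \<omega>) y) \<le> 0" by simp
  have "(min (w * Z i \<omega>) y)\<^sup>2 \<le> w\<^sup>2 * (Z i \<omega>)\<^sup>2" for \<omega>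
  proof -
    have "\<bar>min (w * Z i \<omega>) y\<bar>\<^sup>2 \<le> (w * \<bar>Z i \<omega>\<bar>)\<^sup>2"
      using trunc_abs_le[OF assms] by (intro power_mono) auto
    then show ?thesis by (simp add: power_mult_distrib)
  qed
  then have "expectation (\<lambda>\<omega>. (min (w * Z i \<omega>) y)\<^sup>2) \<le> expectation (\<lambda>\<omega>. w\<^sup>2 * (Z i \<omega>)\<^sup>2)"
    by (intro integral_mono) auto
  then show "expectation (\<lambda>\<omega>. (min (w * Z i \<omega>) y)\<^sup>2) \<le> w\<^sup>2" by simp
  have "\<bar>min (w * Z i \<omega>) y\<bar> powr q \<le> w powr q * \<bar>Z i \<omega>\<bar> powr q" for \<omega>
  proof -
    have "\<bar>min (w * Z i \<omega>) y\<bar> powr q \<le> (w * \<bar>Z i \<omega>\<bar>) powr q"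
      using trunc_abs_le[OF assms] q by (intro powr_mono2) auto
    then show ?thesis using assms by (simp add: powr_mult)
  qed
  then have "expectation (\<lambda>\<omega>. \<bar>min (w * Z i \<omega>) y\<bar> powr q) \<le> expectation (\<lambda>\<omega>. w powr q * \<bar>Z i \<omega>\<bar> powr q)"
    by (intro integral_mono) auto
  then show "expectation (\<lambda>\<omega>. \<bar>min (w * Z i \<omega>) y\<bar> powr q) \<le> w powr q * absmom q" by simp
  \<comment> \<open>Above the level \<open>y\<close> a lower power is traded for the q-th one: u^(e
    - q) \<le> y^(e - q) because e \<le> q.\<close>
  have tail: "\<bar>u\<bar> powr e \<le> \<bar>u\<bar> powr q * y powr (e - q)" if "y < u" "e \<le> q" for u e
  proof -
    have "u powr e = u powr q * u powr (e - q)" by (simp add: powr_add[symmetric])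
    also have "\<dots> \<le> u powr q * y powr (e - q)"
      using that assms by (intro mult_left_mono powr_mono2') auto
    finally show ?thesis using that assms by simp
  qed
  have "w * Z i \<omega> - min (w * Z i \<omega>) y \<le> w powr q * \<bar>Z i \<omega>\<bar> powr q * y powr (1 - q)" for \<omega>
  proof (cases "y < w * Z i \<omega>")
    case True
    then have "w * \<bar>Z i \<omega>\<bar> \<le> w powr q * \<bar>Z i \<omega>\<bar> powr q * y powr (1 - q)"
      using tail[of "w * Z i \<omega>" 1] q assms by (simp add: powr_mult abs_mult)
    moreover have "w * Z i \<omega> \<le> w * \<bar>Z i \<omega>\<bar>" using assms by (intro mult_left_mono) auto
    moreover have "0 \<le> min (w * Z i \<omega>) y" using True assms by simp
    ultimately show ?thesis by linarith
  next
    case False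
    then show ?thesis by (simp add: min_def)
  qed
  then have "expectation (\<lambda>\<omega>. w * Z i \<omega> - min (w * Z i \<omega>) y) \<le>
    expectation (\<lambda>\<omega>. w powr q * \<bar>Z i \<omega>\<bar> powr q * y powr (1 - q))"
    by (intro integral_mono) auto
  then show "- expectation (\<lambda>\<omega>. min (w * Z i \<omega>) y) \<le> w powr q * absmom q * y powr (1 - q)"
    by simp
  have "w\<^sup>2 * (Z i \<omega>)\<^sup>2 - (min (w * Z i \<omega>) y)\<^sup>2 \<le> w powr q * \<bar>Z i \<omega>\<bar> powr q * y powr (2 - q)" for \<omega>
  proof (cases "y < w * Z i \<omega>")
    case True
    then have "(w * Z i \<omega>)\<^sup>2 \<le> w powr q * \<bar>Z i \<omega>\<bar> powr q * y powr (2 - q)"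
      using tail[of "w * Z i \<omega>" 2] q assms by (simp add: powr_mult abs_mult power_mult_distrib)
    then show ?thesis by (smt (verit) power_mult_distrib zero_le_power2)
  next
    case False
    then show ?thesis by (simp add: min_def power_mult_distrib)
  qed
  then have "expectation (\<lambda>\<omega>. w\<^sup>2 * (Z i \<omega>)\<^sup>2 - (min (w * Z i \<omega>) y)\<^sup>2) \<le>
    expectation (\<lambda>\<omega>. w powr q * \<bar>Z i \<omega>\<bar> powr q * y powr (2 - q))"
    by (intro integral_mono) auto
  then show "w\<^sup>2 - expectation (\<lambda>\<omega>. (min (w * Z i \<omega>) y)\<^sup>2) \<le> w powr q * absmom q * y powr (2 - q)"
    by simp
qed

lemma integrable_exp_trunc:
  assumes "0 < s"
  shows "integrable M (\<lambda>\<omega>. exp (s * min (w * Z i \<omega>) y))"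
proof (rule integrable_const_bound[where B = "exp (s * y)"])
  show "AE \<omega> in M. norm (exp (s * min (w * Z i \<omega>) y)) \<le> exp (s * y)"
    using assms by (auto intro!: AE_I2 mult_left_mono)
qed simp

text \<open>Expectation of \<open>exp_le_quadratic_trunc\<close> at u = s Y and b = s y, where Y is
  the truncated variable; the linear term is dropped because the truncated mean is at most 0.
  Passing from 1 + v to exp v lets the bounds multiply over independent summands.\<close>

lemma exp_moment_trunc:
  assumes "0 < w" "0 < y" "0 < s"
  shows "expectation (\<lambda>\<omega>. exp (s * min (w * Z i \<omega>) y)) \<le>
    exp (s\<^sup>2 / 2 * w\<^sup>2 + exp r * absmom q * s powr q * w powr q + posmom r * exp (s * y) * y powr - r * w powr r)"
proof -
  note [simp] = integrable_trunc[OF assms(1,2)]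
  let ?Y = "\<lambda>\<omega>. min (w * Z i \<omega>) y"
  let ?R = "\<lambda>\<omega>. 1 + s * ?Y \<omega> + s\<^sup>2 / 2 * (?Y \<omega>)\<^sup>2 + exp r * s powr q * \<bar>?Y \<omega>\<bar> powr q
    + exp (s * y) * y powr - r * w powr r * max (Z i \<omega>) 0 powr r"
  have "exp (s * ?Y \<omega>) \<le> ?R \<omega>" for \<omega>
  proof -
    have "max (s * ?Y \<omega>) 0 = s * max (?Y \<omega>) 0" "w * max (Z i \<omega>) 0 = max (w * Z i \<omega>) 0"
      using assms max_mult_distrib_left[of s "?Y \<omega>" 0] max_mult_distrib_left[of w "Z i \<omega>" 0] by auto
    \<comment> \<open>The tilt \<open>s\<close> cancels, and under the positive part the truncation
      can be removed, so that only \<open>posmom r\<close> is needed.\<close>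
    then have "max (s * ?Y \<omega>) 0 / (s * y) \<le> w * max (Z i \<omega>) 0 / y"
      using assms by (auto intro!: divide_right_mono)
    then     have "(max (s * ?Y \<omega>) 0 / (s * y)) powr r \<le> (w * max (Z i \<omega>) 0 / y) powr r"
      using r assms by (intro powr_mono2) auto
    also have "\<dots> = y powr - r * w powr r * max (Z i \<omega>) 0 powr r"
      using assms by (simp add: powr_mult powr_divide powr_minus_divide)
    finally have "exp (s * y) * (max (s * ?Y \<omega>) 0 / (s * y)) powr r \<le>
      exp (s * y) * (y powr - r * w powr r * max (Z i \<omega>) 0 powr r)"
      by (intro mult_left_mono) auto
    moreover have "exp (s * ?Y \<omega>) \<le> 1 + s * ?Y \<omega> + (s * ?Y \<omega>)\<^sup>2 / 2 + exp r * \<bar>s * ?Y \<omega>\<bar> powr q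
      + exp (s * y) * (max (s * ?Y \<omega>) 0 / (s * y)) powr r"
      using assms q r by (intro exp_le_quadratic_trunc) (auto intro!: mult_left_mono)
    moreover have "(s * ?Y \<omega>)\<^sup>2 / 2 = s\<^sup>2 / 2 * (?Y \<omega>)\<^sup>2"
      "exp r * \<bar>s * ?Y \<omega>\<bar> powr q = exp r * s powr q * \<bar>?Y \<omega>\<bar> powr q"
      "exp (s * y) * (y powr - r * w powr r * max (Z i \<omega>) 0 powr r) = exp (s * y) * y powr - r * w powr r * max (Z i \<omega>) 0 powr r"
      using assms by (simp_all add: abs_mult powr_mult power_mult_distrib)
    ultimately show ?thesis by linarith
  qed
  then have "expectation (\<lambda>\<omega>. exp (s * ?Y \<omega>)) \<le> expectation ?R"
    using assms by (intro integral_mono integrable_exp_trunc Bochner_Integration.integrable_add) auto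
  also have "expectation ?R = 1 + s * expectation ?Y + s\<^sup>2 / 2 * expectation (\<lambda>\<omega>. (?Y \<omega>)\<^sup>2)
     + exp r * s powr q * expectation (\<lambda>\<omega>. \<bar>?Y \<omega>\<bar> powr q) + exp (s * y) * y powr - r * w powr r * posmom r"
    by (simp add: prob_space)
  also have "\<dots> \<le> 1 + s * 0 + s\<^sup>2 / 2 * w\<^sup>2 + exp r * s powr q * (w powr q * absmom q) + exp (s * y) * y powr - r * w powr r * posmom r"
    using assms trunc_moments[OF assms(1,2)] by (intro add_mono mult_left_mono) auto
  also have "\<dots> = 1 + (s\<^sup>2 / 2 * w\<^sup>2 + exp r * absmom q * s powr q * w powr q + posmom r * exp (s * y) * y powr - r * w powr r)"
    by (simp add: mult_ac)
  also have "\<dots> \<le> exp (s\<^sup>2 / 2 * w\<^sup>2 + exp r * absmom q * s powr q * w powr q + posmom r * exp (s * y) * y powr - r * w powr r)"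
    by (rule exp_ge_add_one_self)
  finally show ?thesis .
qed

text \<open>The excess of the logarithmic exponential moment over the Gaussian value s^2 / 2;
  \<open>Dq\<close> and \<open>Dr\<close> stand for the power sums of the weights of orders
  \<open>q\<close> and \<open>r\<close>.\<close>

definition exp_error :: "real \<Rightarrow> real \<Rightarrow> real \<Rightarrow> real \<Rightarrow> real" where
  "exp_error s y Dq Dr = exp r * absmom q * s powr q * Dq + posmom r * exp (s * y) * y powr - r * Dr"

lemma
  assumes "finite A" "\<And>i. i \<in> A \<Longrightarrow> 0 < w i" "0 < y" "0 < s"
  shows integrable_exp_sum_trunc: "integrable M (\<lambda>\<omega>. exp (s * trunc_sum A w y \<omega>))"
    and exp_moment_sum_trunc: "expectation (\<lambda>\<omega>. exp (s * trunc_sum A w y \<omega>)) \<le>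
      exp (s\<^sup>2 / 2 * (\<Sum>i\<in>A. (w i)\<^sup>2) + exp_error s y (\<Sum>i\<in>A. w i powr q) (\<Sum>i\<in>A. w i powr r))"
proof -
  have eq: "exp (s * trunc_sum A w y \<omega>) = (\<Prod>i\<in>A. exp (s * min (w i * Z i \<omega>) y))" for \<omega>
    using assms(1) by (simp add: sum_distrib_left exp_sum)
  have ind: "indep_vars (\<lambda>_. borel) (\<lambda>i \<omega>. exp (s * min (w i * Z i \<omega>) y)) A"
    by (rule indep_fun_Z) simp
  show "integrable M (\<lambda>\<omega>. exp (s * trunc_sum A w y \<omega>))"
    unfolding eq by (rule indep_vars_integrable[OF assms(1) ind integrable_exp_trunc[OF assms(4)]])
  have "expectation (\<lambda>\<omega>. exp (s * trunc_sum A w y \<omega>)) =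
    (\<Prod>i\<in>A. expectation (\<lambda>\<omega>. exp (s * min (w i * Z i \<omega>) y)))"
    unfolding eq by (rule indep_vars_lebesgue_integral[OF assms(1) ind integrable_exp_trunc[OF assms(4)]])
  also have "\<dots> \<le> (\<Prod>i\<in>A. exp (s\<^sup>2 / 2 * (w i)\<^sup>2 + exp r * absmom q * s powr q * w i powr q
    + posmom r * exp (s * y) * y powr - r * w i powr r))"
    using assms by (intro prod_mono conjI exp_moment_trunc) auto
  also have "\<dots> = exp (\<Sum>i\<in>A. s\<^sup>2 / 2 * (w i)\<^sup>2 + exp r * absmom q * s powr q * w i powr q
    + posmom r * exp (s * y) * y powr - r * w i powr r)"
    using assms(1) by (simp add: exp_sum)
  also have "(\<Sum>i\<in>A. s\<^sup>2 / 2 * (w i)\<^sup>2 + exp r * absmom q * s powr q * w i powr q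
    + posmom r * exp (s * y) * y powr - r * w i powr r) =
    s\<^sup>2 / 2 * (\<Sum>i\<in>A. (w i)\<^sup>2) + exp_error s y (\<Sum>i\<in>A. w i powr q) (\<Sum>i\<in>A. w i powr r)"
    by (simp add: exp_error_def sum.distrib sum_distrib_left)
  finally show "expectation (\<lambda>\<omega>. exp (s * trunc_sum A w y \<omega>)) \<le>
      exp (s\<^sup>2 / 2 * (\<Sum>i\<in>A. (w i)\<^sup>2) + exp_error s y (\<Sum>i\<in>A. w i powr q) (\<Sum>i\<in>A. w i powr r))" .
qed

text \<open>The tilt \<open>s\<close> stays free, since a good choice depends on how
  \<open>x\<close> compares with \<open>L\<close>.\<close>

lemma chernoff_sum_trunc:
  assumes "finite A" "\<And>i. i \<in> A \<Longrightarrow> 0 < w i" "0 < y" "0 < s" "(\<Sum>i\<in>A. (w i)\<^sup>2) = 1"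
  shows "prob {\<omega> \<in> space M. trunc_sum A w y \<omega> \<ge> x} \<le>
    exp (s\<^sup>2 / 2 - s * x + exp_error s y (\<Sum>i\<in>A. w i powr q) (\<Sum>i\<in>A. w i powr r))"
proof -
  let ?T = "\<lambda>\<omega>. \<Sum>i\<in>A. min (w i * Z i \<omega>) y"
  have "{\<omega> \<in> space M. ?T \<omega> \<ge> x} = {\<omega> \<in> space M. exp (s * ?T \<omega>) \<ge> exp (s * x)}"
    using assms(4) by simp
  then have "prob {\<omega> \<in> space M. ?T \<omega> \<ge> x} = prob {\<omega> \<in> space M. exp (s * ?T \<omega>) \<ge> exp (s * x)}"
    by (simp only:)
  also have "\<dots> \<le> expectation (\<lambda>\<omega>. exp (s * ?T \<omega>)) / exp (s * x)"
    using integrable_exp_sum_trunc[OF assms(1-4)]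
    by (intro integral_Markov_inequality_measure[where A="{}"]) auto
  also have "\<dots> \<le> exp (s\<^sup>2 / 2 * 1 + exp_error s y (\<Sum>i\<in>A. w i powr q) (\<Sum>i\<in>A. w i powr r)) / exp (s * x)"
    using exp_moment_sum_trunc[of A w y s, OF assms(1-4)] assms(5) by (intro divide_right_mono) auto
  also have "\<dots> = exp (s\<^sup>2 / 2 - s * x + exp_error s y (\<Sum>i\<in>A. w i powr q) (\<Sum>i\<in>A. w i powr r))"
    by (simp add: exp_diff[symmetric] algebra_simps)
  finally show ?thesis .
qed

end

section \<open>Regularly varying tails\<close>

text \<open>Halve \<open>u\<close> until it falls between U and 2 U. This lets information about the
  single ratio 2 govern all large arguments.\<close>

lemma bounded_of_doubling:
  fixes g :: "real \<Rightarrow> real"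
  assumes "0 < U" "\<And>u. U \<le> u \<Longrightarrow> g (2 * u) \<le> g u" "\<And>u. U \<le> u \<Longrightarrow> u \<le> 2 * U \<Longrightarrow> g u \<le> C" "U \<le> u"
  shows "g u \<le> C"
proof -
  have "\<forall>u. U \<le> u \<and> u \<le> 2 ^ Suc n * U \<longrightarrow> g u \<le> C" for n
  proof (induction n)
    case (Suc n)
    show ?case
    proof (intro allI impI)
      fix u assume u: "U \<le> u \<and> u \<le> 2 ^ Suc (Suc n) * U"
      show "g u \<le> C"
      proof (cases "u \<le> 2 * U")
        case False
        then have "g (u / 2) \<le> C" using u by (intro Suc.IH[rule_format]) auto
        moreover have "g (2 * (u / 2)) \<le> g (u / 2)" using False by (intro assms(2)) auto
        ultimately show ?thesis by simp
      qed (use u assms in auto)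
    qed
  qed (use assms in auto)
  moreover obtain n where "u / U < 2 ^ n" using real_arch_pow[of 2 "u / U"] by auto
  then have "u \<le> 2 ^ Suc n * U" using assms(1,4) by (simp add: field_simps)
  ultimately show ?thesis using assms(4) by blast
qed

text \<open>Regular variation of index - t expressed through the tail alone. Together with
  monotonicity, limits at fixed ratios \<open>l\<close> suffice, without uniformity in
  \<open>l\<close>.\<close>

locale regular_tail =
  fixes G :: "real \<Rightarrow> real" and t :: real
  assumes antimono_G: "\<And>x y. x \<le> y \<Longrightarrow> G y \<le> G x"
    and G_pos: "\<And>x. 0 < G x"
    and tail_ratio: "\<And>l. 0 < l \<Longrightarrow> ((\<lambda>x. G (l * x) / G x) \<longlongrightarrow> l powr - t) at_top"
    and t_gt_2: "2 < t"
begin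

text \<open>A Potter-type bound: as 2^(- t) < 2^(- r), eventually \<open>u powr r * G u\<close> does
  not increase under doubling, and between U and 2 U it is bounded by monotonicity of both
  factors.\<close>

lemma G_le_powr:
  assumes "r < t" "0 < r"
  shows "\<exists>C U. 0 < C \<and> 0 < U \<and> (\<forall>u\<ge>U. G u \<le> C * u powr - r)"
proof -
  have "(2::real) powr - t < 2 powr - r" using assms by simp
  then have "\<forall>\<^sub>F x in at_top. G (2 * x) / G x < 2 powr - r"
    by (intro order_tendstoD(2)[OF tail_ratio]) auto
  then obtain U0 where U0: "\<And>x. U0 \<le> x \<Longrightarrow> G (2 * x) / G x < 2 powr - r"
    unfolding eventually_at_top_linorder by auto
  define U where "U = max U0 1"
  have U: "0 < U" "1 \<le> U" by (auto simp: U_def)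
  let ?C = "(2 * U) powr r * G U"
  have "u powr r * G u \<le> ?C" if "U \<le> u" for u
  proof (rule bounded_of_doubling[where g = "\<lambda>u. u powr r * G u" and U = U])
    show "(2 * u) powr r * G (2 * u) \<le> u powr r * G u" if "U \<le> u" for u
    proof -
      have "G (2 * u) \<le> 2 powr - r * G u"
        using U0[of u] that G_pos[of u] by (simp add: U_def divide_simps)
      then have "(2 * u) powr r * G (2 * u) \<le> (2 * u) powr r * (2 powr - r * G u)"
        by (intro mult_left_mono) auto
      also have "\<dots> = u powr r * G u" using that U by (simp add: powr_mult powr_minus)
      finally show ?thesis .
    qed
    show "u powr r * G u \<le> ?C" if "U \<le> u" "u \<le> 2 * U" for u
      using that U assms less_imp_le[OF G_pos] by (intro mult_mono powr_mono2 antimono_G) auto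
  qed (use that U in auto)
  then have "\<forall>u\<ge>U. G u \<le> ?C * u powr - r"
    using U by (auto simp: powr_minus field_simps)
  moreover have "0 < ?C" using U G_pos[of U] by simp
  ultimately show ?thesis using U by blast
qed

text \<open>The matching lower bound, with an exponent above \<open>t\<close>; the doubling argument
  is applied to the negated function.\<close>

lemma G_ge_powr:
  assumes "t < r"
  shows "\<exists>c U. 0 < c \<and> 0 < U \<and> (\<forall>u\<ge>U. c * u powr - r \<le> G u)"
proof -
  have r0: "0 < r" using assms t_gt_2 by simp
  have "(2::real) powr - r < 2 powr - t" using assms by simp
  then have "\<forall>\<^sub>F x in at_top. 2 powr - r < G (2 * x) / G x"
    by (intro order_tendstoD(1)[OF tail_ratio]) auto
  then obtain U0 where U0: "\<And>x. U0 \<le> x \<Longrightarrow> 2 powr - r < G (2 * x) / G x"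
    unfolding eventually_at_top_linorder by auto
  define U where "U = max U0 1"
  have U: "0 < U" "1 \<le> U" by (auto simp: U_def)
  let ?C = "U powr r * G (2 * U)"
  have "- (u powr r * G u) \<le> - ?C" if "U \<le> u" for u
  proof (rule bounded_of_doubling[where g = "\<lambda>u. - (u powr r * G u)" and U = U])
    show "- ((2 * u) powr r * G (2 * u)) \<le> - (u powr r * G u)" if "U \<le> u" for u
    proof -
      have "2 powr - r * G u \<le> G (2 * u)"
        using U0[of u] that G_pos[of u] by (simp add: U_def divide_simps)
      then have "(2 * u) powr r * (2 powr - r * G u) \<le> (2 * u) powr r * G (2 * u)"
        by (intro mult_left_mono) auto
      moreover have "(2 * u) powr r * (2 powr - r * G u) = u powr r * G u"
        using that U by (simp add: powr_mult powr_minus)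
      ultimately show ?thesis by simp
    qed
    show "- (u powr r * G u) \<le> - ?C" if "U \<le> u" "u \<le> 2 * U" for u
    proof -
      have "?C \<le> u powr r * G u"
        using that U r0 less_imp_le[OF G_pos] by (intro mult_mono powr_mono2 antimono_G) auto
      then show ?thesis by simp
    qed
  qed (use that U in auto)
  then have "\<forall>u\<ge>U. ?C * u powr - r \<le> G u"
    using U by (auto simp: powr_minus field_simps)
  moreover have "0 < ?C" using U G_pos[of "2 * U"] by simp
  ultimately show ?thesis using U by blast
qed

end

text \<open>Dyadic layers: the layer from 2^(m + n) to 2^(m + n + 1) contributes at most a constant
  times 2^((r - s) n), a convergent geometric series as r < s. The offset \<open>m\<close> puts all
  layers beyond \<open>U\<close>.\<close>

lemma (in prob_space) integrable_powr_of_tail_bound: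
  fixes X :: "'a \<Rightarrow> real"
  assumes [measurable]: "X \<in> borel_measurable M"
    and "0 < r" "r < s" "\<And>u. U \<le> u \<Longrightarrow> prob {\<omega> \<in> space M. u \<le> X \<omega>} \<le> C * u powr - s"
  shows "integrable M (\<lambda>\<omega>. max (X \<omega>) 0 powr r)"
proof -
  obtain m where m: "U \<le> 2 ^ m" using real_arch_pow[of 2 U] by (auto intro: less_imp_le)
  let ?B = "\<lambda>n. {\<omega> \<in> space M. 2 ^ (m + n) \<le> X \<omega>}"
  define a where "a n = (2 ^ (m + Suc n)) powr r" for n
  have C: "0 \<le> C"
  proof -
    have "0 \<le> C * (max U 1) powr - s"
      using assms(4)[of "max U 1"] measure_nonneg[of M] order_trans by (metis max.cobounded1)
    moreover have "0 < max U 1 powr - s" by simp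
    ultimately show ?thesis by (simp only: zero_le_mult_iff) linarith
  qed
  have bound: "max (X \<omega>) 0 powr r \<le> (2 ^ m) powr r \<or>
     (\<exists>n. max (X \<omega>) 0 powr r \<le> a n \<and> 2 ^ (m + n) \<le> X \<omega>)" for \<omega>
  proof (cases "X \<omega> \<le> 2 ^ m")
    case True
    then show ?thesis using assms by (intro disjI1 powr_mono2) auto
  next
    case False
    let ?P = "\<lambda>n. X \<omega> \<le> 2 ^ (m + n)"
    obtain n0 where "X \<omega> < 2 ^ n0" using real_arch_pow[of 2 "X \<omega>"] by auto
    also have "(2::real) ^ n0 \<le> 2 ^ (m + n0)" by (intro power_increasing) auto
    finally have "\<exists>n. ?P n" by (blast intro: less_imp_le)
    \<comment> \<open>This least \<open>n\<close> is not 0 because X \<omega> > 2^m; its predecessor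
      \<open>k\<close> identifies the layer 2^(m + k) < X \<omega> \<le> 2^(m + k + 1).\<close>
    define n where "n = (LEAST n. ?P n)"
    have Pn: "?P n" unfolding n_def using \<open>\<exists>n. ?P n\<close> by (rule LeastI_ex)
    have "n \<noteq> 0" using Pn False by (metis add_0_right)
    then obtain k where k: "n = Suc k" by (cases n) auto
    have "\<not> ?P k" using not_less_Least[of k ?P] k by (auto simp: n_def[symmetric])
    moreover have "max (X \<omega>) 0 powr r \<le> a k"
      unfolding a_def using Pn k assms by (intro powr_mono2) auto
    ultimately show ?thesis by (intro disjI2 exI[of _ k]) auto
  qed
  have "(\<integral>\<^sup>+\<omega>. ennreal (max (X \<omega>) 0 powr r) \<partial>M) \<le>
    (\<integral>\<^sup>+\<omega>. ennreal ((2 ^ m) powr r) + (\<Sum>n. ennreal (a n) * indicator (?B n) \<omega>) \<partial>M)"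
  proof (rule nn_integral_mono)
    fix \<omega> assume \<omega>: "\<omega> \<in> space M"
    show "ennreal (max (X \<omega>) 0 powr r) \<le> ennreal ((2 ^ m) powr r) + (\<Sum>n. ennreal (a n) * indicator (?B n) \<omega>)"
      using bound[of \<omega>]
    proof
      assume "max (X \<omega>) 0 powr r \<le> (2 ^ m) powr r"
      then show ?thesis by (intro add_increasing2) (auto intro: ennreal_leI)
    next
      assume "\<exists>n. max (X \<omega>) 0 powr r \<le> a n \<and> 2 ^ (m + n) \<le> X \<omega>"
      then obtain n where n: "max (X \<omega>) 0 powr r \<le> a n" "2 ^ (m + n) \<le> X \<omega>" by auto
      have "ennreal (max (X \<omega>) 0 powr r) \<le> ennreal (a n) * indicator (?B n) \<omega>"
        using n \<omega> by (auto intro: ennreal_leI)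
      also have "\<dots> \<le> (\<Sum>i. ennreal (a i) * indicator (?B i) \<omega>)"
      proof -
        define f where "f i = ennreal (a i) * indicator (?B i) \<omega>" for i
        have "sum f {n} \<le> suminf f" by (rule sum_le_suminf) auto
        then have "f n \<le> suminf f" by simp
        then show ?thesis unfolding f_def .
      qed
      finally show ?thesis by (intro add_increasing) auto
    qed
  qed
  also have "\<dots> = ennreal ((2 ^ m) powr r) + (\<Sum>n. ennreal (a n) * emeasure M (?B n))"
    by (subst nn_integral_add) (auto simp: nn_integral_suminf nn_integral_cmult emeasure_space_1)
  also have "(\<Sum>n. ennreal (a n) * emeasure M (?B n)) \<le>
    (\<Sum>n. ennreal (C * 2 powr r * (2 ^ m) powr (r - s) * (2 powr (r - s)) ^ n))"
  proof (intro suminf_le allI)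
    fix n
    have "U \<le> 2 ^ (m + n)" using m order_trans[OF _ power_increasing[of m "m + n" "2::real"]] by auto
    then have "a n * prob (?B n) \<le> a n * (C * (2 ^ (m + n)) powr - s)"
      using assms(4)[of "2 ^ (m + n)"] by (intro mult_left_mono) (auto simp: a_def)
    also have "\<dots> = C * 2 powr r * (2 ^ m) powr (r - s) * (2 powr (r - s)) ^ n"
      by (simp add: a_def power_add powr_mult powr_realpow[symmetric] powr_powr powr_add[symmetric] algebra_simps)
    finally have "ennreal (a n * prob (?B n)) \<le> ennreal (C * 2 powr r * (2 ^ m) powr (r - s) * (2 powr (r - s)) ^ n)"
      by (rule ennreal_leI)
    then show "ennreal (a n) * emeasure M (?B n) \<le> ennreal (C * 2 powr r * (2 ^ m) powr (r - s) * (2 powr (r - s)) ^ n)"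
      by (simp add: emeasure_eq_measure ennreal_mult a_def)
  qed auto
  also have "\<dots> < \<infinity>"
  proof -
    have "(2::real) powr (r - s) < 2 powr 0" using assms by (subst powr_less_cancel_iff) auto
    then have "norm ((2::real) powr (r - s)) < 1" by simp
    then have "summable (\<lambda>n. C * 2 powr r * (2 ^ m) powr (r - s) * (2 powr (r - s)) ^ n)"
      by (intro summable_mult summable_geometric)
    then show ?thesis using C by (subst suminf_ennreal2) (auto intro!: mult_nonneg_nonneg)
  qed
  finally show ?thesis
    by (intro integrableI_bounded) (auto simp: add_strict_left_mono)
qed

section \<open>Large deviations\<close>

text \<open>Keeping \<open>q\<close> below \<open>t\<close> places it in the range where power sums
  of the weights decay exponentially in \<open>log_D\<close>.\<close>

locale iid_regular_tail = iid_standard +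
  fixes q t :: real
  assumes q_gt: "2 < q" "q \<le> 3" "q < t"
    and integrable_abs_q: "integrable M (\<lambda>\<omega>. \<bar>Z 0 \<omega>\<bar> powr q)"
    and regular: "regular_tail (\<lambda>u. prob {\<omega> \<in> space M. u \<le> Z 0 \<omega>}) t"
begin

definition G :: "real \<Rightarrow> real" where "G u = prob {\<omega> \<in> space M. u \<le> Z 0 \<omega>}"

lemma regular_tail_G: "regular_tail G t"
  using regular unfolding G_def .

sublocale regular_tail G t by (rule regular_tail_G)

text \<open>The tail bound with exponent halfway between \<open>r\<close> and \<open>t\<close>
  leaves room for the r-th moment of the positive part.\<close>

lemma moments_locale:
  assumes "2 < r" "r < t"
  shows "iid_standard_moments M Z q r"
proof -
  obtain C U where "\<forall>u\<ge>U. G u \<le> C * u powr - ((r + t) / 2)"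
    using G_le_powr[of "(r + t) / 2"] assms by auto
  then have "integrable M (\<lambda>\<omega>. max (Z 0 \<omega>) 0 powr r)"
    using assms by (intro integrable_powr_of_tail_bound[where s = "(r + t) / 2" and U = U and C = C])
      (auto simp: G_def)
  then show ?thesis
    using assms q_gt integrable_abs_q by unfold_locales auto
qed

lemma prob_weighted_Z:
  assumes "0 < w"
  shows "prob {\<omega> \<in> space M. z \<le> w * Z i \<omega>} = G (z / w)"
proof -
  have "{\<omega> \<in> space M. z \<le> w * Z i \<omega>} = {\<omega> \<in> space M. Z i \<omega> \<in> {z / w..}}"
    using assms by (auto simp: field_simps)
  then show ?thesis using prob_Z[of "{z / w..}" i] by (simp add: G_def)
qed

lemma prob_Z_and_sum:
  assumes "finite A" "i \<notin> A" and [measurable]: "\<And>i. f i \<in> borel_measurable borel" "B \<in> sets borel" "C \<in> sets borel"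
  shows "prob {\<omega> \<in> space M. f i (Z i \<omega>) \<in> B \<and> (\<Sum>j\<in>A. f j (Z j \<omega>) :: real) \<in> C} =
    prob {\<omega> \<in> space M. f i (Z i \<omega>) \<in> B} * prob {\<omega> \<in> space M. (\<Sum>j\<in>A. f j (Z j \<omega>)) \<in> C}"
proof -
  have eq: "{\<omega> \<in> space M. f i (Z i \<omega>) \<in> B \<and> (\<Sum>j\<in>A. f j (Z j \<omega>)) \<in> C} =
      (\<lambda>\<omega>. (f i (Z i \<omega>), \<Sum>j\<in>A. f j (Z j \<omega>))) -` (B \<times> C) \<inter> space M"
    "{\<omega> \<in> space M. f i (Z i \<omega>) \<in> B} = (\<lambda>\<omega>. f i (Z i \<omega>)) -` B \<inter> space M"
    "{\<omega> \<in> space M. (\<Sum>j\<in>A. f j (Z j \<omega>)) \<in> C} = (\<lambda>\<omega>. \<Sum>j\<in>A. f j (Z j \<omega>)) -` C \<inter> space M"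
    by auto
  show ?thesis unfolding eq
    using indep_varD[OF indep_Z_sum[OF assms(1-3)] assms(4,5)] .
qed

abbreviation "tail_sum A w x \<equiv> \<Sum>i\<in>A. G (x / w i)"
abbreviation "sum_prob A w x \<equiv> prob {\<omega> \<in> space M. x \<le> (\<Sum>i\<in>A. w i * Z i \<omega>)}"

section \<open>Power sums of unit weights and the tail sum\<close>

definition unit_weights :: "nat set \<Rightarrow> (nat \<Rightarrow> real) \<Rightarrow> bool" where
  "unit_weights A w \<longleftrightarrow> finite A \<and> (\<forall>i\<in>A. 0 < w i) \<and> (\<Sum>i\<in>A. (w i)\<^sup>2) = 1"

text \<open>For unit weights the factor with the sum of squares in \<open>D_ratio\<close> equals 1,
  so this is the logarithm of the inverse of that ratio.\<close>

definition log_D :: "nat set \<Rightarrow> (nat \<Rightarrow> real) \<Rightarrow> real" where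
  "log_D A w = ln (inverse (\<Sum>i\<in>A. w i powr t))"

lemma unit_weightsD:
  assumes "unit_weights A w"
  shows "finite A" "\<And>i. i \<in> A \<Longrightarrow> 0 < w i" "(\<Sum>i\<in>A. (w i)\<^sup>2) = 1" "A \<noteq> {}"
  using assms by (auto simp: unit_weights_def)

lemma sum_powr_pos:
  assumes "unit_weights A w"
  shows "0 < (\<Sum>i\<in>A. w i powr e)"
proof (rule sum_pos)
  show "0 < w i powr e" if "i \<in> A" for i using unit_weightsD(2)[OF assms that] by simp
qed (use unit_weightsD[OF assms] in auto)

lemma sum_powr_t:
  assumes "unit_weights A w"
  shows "(\<Sum>i\<in>A. w i powr t) = exp (- log_D A w)"
  using sum_powr_pos[OF assms, of t] by (simp add: log_D_def ln_inverse)

text \<open>As a function of \<open>e\<close>, the logarithm of the power sum is 0 at 2 and - L at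
  \<open>t\<close>; interpolation keeps it below the chord between these exponents. Beyond
  \<open>t\<close> the same inequality puts it above the extended chord.\<close>

lemma sum_powr_le:
  assumes "unit_weights A w" "2 < e" "e \<le> t"
  shows "(\<Sum>i\<in>A. w i powr e) \<le> exp (- ((e - 2) / (t - 2)) * log_D A w)"
proof -
  let ?D = "\<Sum>i\<in>A. w i powr e"
  have "?D powr ((t - 2) / (e - 2)) \<le> exp (- log_D A w)"
    using power_sum_interpolation[of A w e t] unit_weightsD[OF assms(1)] assms sum_powr_t[OF assms(1)] by auto
  then have "(?D powr ((t - 2) / (e - 2))) powr ((e - 2) / (t - 2)) \<le> exp (- log_D A w) powr ((e - 2) / (t - 2))"
    using assms by (intro powr_mono2) auto
  then show ?thesis
    using assms sum_powr_pos[OF assms(1), of e] t_gt_2 by (simp add: powr_powr powr_def mult.commute)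
qed

lemma sum_powr_ge:
  assumes "unit_weights A w" "t \<le> e"
  shows "exp (- ((e - 2) / (t - 2)) * log_D A w) \<le> (\<Sum>i\<in>A. w i powr e)"
  using power_sum_interpolation[of A w t e] unit_weightsD[OF assms(1)] assms sum_powr_t[OF assms(1)] t_gt_2
  by (simp add: powr_def)

text \<open>Every x / w i with x \<ge> 1 is therefore at least exp (L / t): this is what makes
  asymptotic statements about \<open>G\<close> uniform over all weights with large
  \<open>L\<close>.\<close>

lemma weight_le:
  assumes "unit_weights A w" "i \<in> A"
  shows "w i \<le> exp (- log_D A w / t)"
proof -
  have w: "0 < w i" using unit_weightsD assms by blast
  have "w i powr t \<le> (\<Sum>i\<in>A. w i powr t)"
    using assms unit_weightsD by (intro member_le_sum) auto
  then have "(w i powr t) powr (1 / t) \<le> exp (- log_D A w) powr (1 / t)"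
    using t_gt_2 sum_powr_t[OF assms(1)] by (intro powr_mono2) auto
  then show ?thesis using w t_gt_2 by (simp add: powr_powr powr_def)
qed

text \<open>A power lower bound for \<open>G\<close> under every summand, followed by
  \<open>sum_powr_ge\<close>; the condition on \<open>U\<close> and \<open>weight_le\<close> put all
  arguments x / w i in the range of the bound.\<close>

lemma sum_tail_ge:
  assumes "t < e" "0 < U" "\<forall>u\<ge>U. c * u powr - e \<le> G u" "0 \<le> c"
    "unit_weights A w" "1 \<le> x" "U \<le> exp (log_D A w / t)"
  shows "c * x powr - e * exp (- ((e - 2) / (t - 2)) * log_D A w) \<le> tail_sum A w x"
proof -
  have "c * x powr - e * exp (- ((e - 2) / (t - 2)) * log_D A w) \<le> c * x powr - e * (\<Sum>i\<in>A. w i powr e)"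
    using assms sum_powr_ge[of A w e] by (intro mult_left_mono) auto
  also have "\<dots> = (\<Sum>i\<in>A. c * (x / w i) powr - e)"
  proof -
    have "c * (x / w i) powr - e = c * x powr - e * w i powr e" if "i \<in> A" for i
      using unit_weightsD(2)[OF assms(5) that] assms(6)
      by (simp add: powr_divide powr_minus field_simps)
    then show ?thesis by (simp only: sum_distrib_left cong: sum.cong)
  qed
  also have "\<dots> \<le> tail_sum A w x"
  proof (rule sum_mono)
    fix i assume i: "i \<in> A"
    have w: "0 < w i" using unit_weightsD(2)[OF assms(5) i] .
    have "U * w i \<le> exp (log_D A w / t) * exp (- log_D A w / t)"
      using assms w weight_le[OF assms(5) i] by (intro mult_mono) auto
    also have "\<dots> = 1" by (simp add: exp_add[symmetric])
    finally have "U \<le> x / w i" using w assms by (simp add: field_simps)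
    then show "c * (x / w i) powr - e \<le> G (x / w i)" using assms by auto
  qed
  finally show ?thesis .
qed

lemma sum_tail_scaled:
  assumes "0 < l" "0 < \<epsilon>"
  shows "\<exists>L0. \<forall>A w x. unit_weights A w \<longrightarrow> L0 \<le> log_D A w \<longrightarrow> 1 \<le> x \<longrightarrow>
    \<bar>(\<Sum>i\<in>A. G (l * x / w i)) - l powr - t * tail_sum A w x\<bar> \<le> \<epsilon> * tail_sum A w x"
proof -
  have "\<forall>\<^sub>F u in at_top. dist (G (l * u) / G u) (l powr - t) < \<epsilon>"
    using tendstoD[OF tail_ratio[OF assms(1)] assms(2)] .
  then obtain U where U: "\<And>u. U \<le> u \<Longrightarrow> dist (G (l * u) / G u) (l powr - t) < \<epsilon>"
    unfolding eventually_at_top_linorder by auto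
  have *: "\<bar>G (l * u) - l powr - t * G u\<bar> \<le> \<epsilon> * G u" if "U \<le> u" for u
  proof -
    have "G (l * u) - l powr - t * G u = (G (l * u) / G u - l powr - t) * G u"
      using G_pos[of u] by (simp add: left_diff_distrib)
    then have "\<bar>G (l * u) - l powr - t * G u\<bar> = \<bar>G (l * u) / G u - l powr - t\<bar> * G u"
      using G_pos[of u] by (simp add: abs_mult)
    also have "\<dots> \<le> \<epsilon> * G u"
      using U[OF that] G_pos[of u] by (intro mult_right_mono) (auto simp: dist_real_def)
    finally show ?thesis .
  qed
  show ?thesis
  \<comment> \<open>This threshold is equivalent to exp (L / t) \<ge> max U 1, which places all x /
    w i beyond \<open>U\<close>.\<close>
  proof (intro exI[of _ "t * ln (max U 1)"] allI impI)
    fix A w x assume w: "unit_weights A w" and L: "t * ln (max U 1) \<le> log_D A w" and x: "1 \<le> (x::real)"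
    have "ln (max U 1) \<le> log_D A w / t" using L t_gt_2 by (simp add: field_simps)
    then have U1: "max U 1 \<le> exp (log_D A w / t)"
      using exp_le_cancel_iff[of "ln (max U 1)" "log_D A w / t"] exp_ln[of "max U 1"] by simp
    have "\<bar>G (l * x / w i) - l powr - t * G (x / w i)\<bar> \<le> \<epsilon> * G (x / w i)" if i: "i \<in> A" for i
    proof -
      have wi: "0 < w i" using unit_weightsD(2)[OF w i] .
      have "max U 1 * w i \<le> exp (log_D A w / t) * exp (- log_D A w / t)"
        using U1 wi weight_le[OF w i] by (intro mult_mono) auto
      also have "\<dots> = 1" by (simp add: exp_add[symmetric])
      also note x
      finally have "max U 1 \<le> x / w i" using wi by (simp only: pos_le_divide_eq)
      then show ?thesis using *[of "x / w i"] by simp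
    qed
    then have "(\<Sum>i\<in>A. \<bar>G (l * x / w i) - l powr - t * G (x / w i)\<bar>) \<le> (\<Sum>i\<in>A. \<epsilon> * G (x / w i))"
      by (intro sum_mono)
    then have "\<bar>\<Sum>i\<in>A. G (l * x / w i) - l powr - t * G (x / w i)\<bar> \<le> (\<Sum>i\<in>A. \<epsilon> * G (x / w i))"
      by (rule order_trans[OF sum_abs])
    then show "\<bar>(\<Sum>i\<in>A. G (l * x / w i)) - l powr - t * tail_sum A w x\<bar> \<le> \<epsilon> * tail_sum A w x"
      by (simp add: sum_subtractf sum_distrib_left)
  qed
qed

section \<open>One-big-jump bounds\<close>

lemma remaining_sum_chebyshev:
  assumes "unit_weights A w" "0 < z"
  shows "prob {\<omega> \<in> space M. z \<le> \<bar>\<Sum>j\<in>A-{i}. w j * Z j \<omega>\<bar>} \<le> 1 / z\<^sup>2"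
proof -
  have "prob {\<omega> \<in> space M. \<bar>\<Sum>j\<in>A-{i}. w j * Z j \<omega>\<bar> \<ge> z} \<le> (\<Sum>j\<in>A-{i}. (w j)\<^sup>2) / z\<^sup>2"
    using assms unit_weightsD(1) by (intro weighted_sum_chebyshev) auto
  also have "\<dots> \<le> 1 / z\<^sup>2"
    using sum_mono2[of A "A - {i}" "\<lambda>j. (w j)\<^sup>2"] unit_weightsD[OF assms(1)]
    by (intro divide_right_mono) auto
  finally show ?thesis .
qed

text \<open>Either one summand alone carries the deviation, or a summand exceeds \<open>\<eta> x\<close> while the independent
  remainder is at least \<open>\<delta> x\<close>, or no summand exceeds \<open>\<eta> x\<close>.\<close>
lemma big_jump_upper:
  assumes w: "unit_weights A w" and "0 < \<delta>" "\<delta> < 1" "0 < \<eta>" "0 < x"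
  shows "sum_prob A w x \<le>
    (\<Sum>i\<in>A. G ((1 - \<delta>) * x / w i)) + (\<Sum>i\<in>A. G (\<eta> * x / w i)) * (1 / (\<delta> * x)\<^sup>2)
    + prob {\<omega> \<in> space M. x \<le> trunc_sum A w (\<eta> * x) \<omega>}"
proof -
  note wD = unit_weightsD[OF w]
  define E where "E i = {\<omega> \<in> space M. (1 - \<delta>) * x \<le> w i * Z i \<omega>}" for i
  define F where "F i = {\<omega> \<in> space M. w i * Z i \<omega> \<in> {\<eta> * x..} \<and> (\<Sum>j\<in>A-{i}. w j * Z j \<omega>) \<in> {\<delta> * x..}}" for i
  define H where "H = {\<omega> \<in> space M. x \<le> trunc_sum A w (\<eta> * x) \<omega>}"
  have [measurable]: "E i \<in> sets M" "F i \<in> sets M" "H \<in> sets M" for i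
    unfolding E_def F_def H_def by measurable
  have fin: "finite A" using wD by blast
  have "{\<omega> \<in> space M. x \<le> (\<Sum>i\<in>A. w i * Z i \<omega>)} \<subseteq> (\<Union>i\<in>A. E i) \<union> (\<Union>i\<in>A. F i) \<union> H"
  proof
    fix \<omega> assume "\<omega> \<in> {\<omega> \<in> space M. x \<le> (\<Sum>i\<in>A. w i * Z i \<omega>)}"
    then have \<omega>: "\<omega> \<in> space M" "x \<le> (\<Sum>i\<in>A. w i * Z i \<omega>)" by auto
    show "\<omega> \<in> (\<Union>i\<in>A. E i) \<union> (\<Union>i\<in>A. F i) \<union> H"
    proof (cases "\<exists>i\<in>A. \<eta> * x \<le> w i * Z i \<omega>")
      case True
      then obtain i where i: "i \<in> A" "\<eta> * x \<le> w i * Z i \<omega>" by auto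
      have "(\<Sum>i\<in>A. w i * Z i \<omega>) = w i * Z i \<omega> + (\<Sum>j\<in>A-{i}. w j * Z j \<omega>)"
        using fin i by (simp add: sum.remove)
      then have "\<omega> \<in> E i \<or> \<omega> \<in> F i"
        using i \<omega> unfolding E_def F_def by (auto simp: algebra_simps)
      then show ?thesis using i by blast
    next
      case False
      then have "trunc_sum A w (\<eta> * x) \<omega> = (\<Sum>i\<in>A. w i * Z i \<omega>)"
        by (intro sum.cong) auto
      then show ?thesis using \<omega> by (auto simp: H_def)
    qed
  qed
  then have "sum_prob A w x \<le> prob ((\<Union>i\<in>A. E i) \<union> (\<Union>i\<in>A. F i) \<union> H)"
    using fin by (intro finite_measure_mono) auto
  also have "\<dots> \<le> prob ((\<Union>i\<in>A. E i) \<union> (\<Union>i\<in>A. F i)) + prob H"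
    using fin by (intro measure_Un_le) auto
  also have "\<dots> \<le> prob (\<Union>i\<in>A. E i) + prob (\<Union>i\<in>A. F i) + prob H"
    using fin by (intro add_right_mono measure_Un_le) auto
  also have "\<dots> \<le> (\<Sum>i\<in>A. prob (E i)) + (\<Sum>i\<in>A. prob (F i)) + prob H"
    using fin by (intro add_mono finite_measure_subadditive_finite order_refl) auto
  also have "\<dots> \<le> (\<Sum>i\<in>A. G ((1 - \<delta>) * x / w i)) + (\<Sum>i\<in>A. G (\<eta> * x / w i) * (1 / (\<delta> * x)\<^sup>2)) + prob H"
  proof (intro add_mono sum_mono order_refl)
    fix i assume i: "i \<in> A"
    then have wi: "0 < w i" using wD by blast
    show "prob (E i) \<le> G ((1 - \<delta>) * x / w i)"
      unfolding E_def using prob_weighted_Z[OF wi] by simp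
    have "prob (F i) = prob {\<omega> \<in> space M. w i * Z i \<omega> \<in> {\<eta> * x..}} *
       prob {\<omega> \<in> space M. (\<Sum>j\<in>A-{i}. w j * Z j \<omega>) \<in> {\<delta> * x..}}"
      unfolding F_def using fin by (intro prob_Z_and_sum[where f = "\<lambda>i x. w i * x"]) auto
    \<comment> \<open>Chebyshev suffices for the remainder: its bound multiplies a tail sum
      comparable with \<open>tail_sum A w x\<close>, and in the application \<open>x\<close> grows
      with \<open>L\<close>.\<close>
    also have "\<dots> \<le> G (\<eta> * x / w i) * (1 / (\<delta> * x)\<^sup>2)"
    proof (intro mult_mono)
      show "prob {\<omega> \<in> space M. w i * Z i \<omega> \<in> {\<eta> * x..}} \<le> G (\<eta> * x / w i)"
        using prob_weighted_Z[OF wi] by simp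
      have "prob {\<omega> \<in> space M. (\<Sum>j\<in>A-{i}. w j * Z j \<omega>) \<in> {\<delta> * x..}} \<le>
        prob {\<omega> \<in> space M. \<delta> * x \<le> \<bar>\<Sum>j\<in>A-{i}. w j * Z j \<omega>\<bar>}"
        by (intro finite_measure_mono) auto
      also have "\<dots> \<le> 1 / (\<delta> * x)\<^sup>2"
        using assms by (intro remaining_sum_chebyshev) auto
      finally show "prob {\<omega> \<in> space M. (\<Sum>j\<in>A-{i}. w j * Z j \<omega>) \<in> {\<delta> * x..}} \<le> 1 / (\<delta> * x)\<^sup>2" .
    qed (use less_imp_le[OF G_pos] in auto)
    finally show "prob (F i) \<le> G (\<eta> * x / w i) * (1 / (\<delta> * x)\<^sup>2)" .
  qed
  finally show ?thesis by (simp add: H_def sum_divide_distrib)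
qed

text \<open>Disjoint events \<open>B i\<close>: summand i exceeds (1 + \<delta>) x, the remainder is
  at least - \<delta> x, and no other summand makes such a jump. The two subtracted terms account
  for failure of the second and of the third requirement.\<close>

lemma big_jump_lower:
  assumes w: "unit_weights A w" and "0 < \<delta>" "0 < x"
  shows "(\<Sum>i\<in>A. G ((1 + \<delta>) * x / w i)) * (1 - 1 / (\<delta> * x)\<^sup>2 - 1 / x\<^sup>2)
    \<le> sum_prob A w x"
proof -
  note wD = unit_weightsD[OF w]
  have fin: "finite A" using wD by blast
  let ?y = "(1 + \<delta>) * x"
  define E where "E i = {\<omega> \<in> space M. w i * Z i \<omega> \<in> {?y..}}" for i
  define F where "F i = {\<omega> \<in> space M. w i * Z i \<omega> \<in> {?y..} \<and> (\<Sum>j\<in>A-{i}. w j * Z j \<omega>) \<in> {- \<delta> * x..}}" for i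
  define B where "B i = F i - (\<Union>j\<in>A-{i}. E j)" for i
  have [measurable]: "E i \<in> sets M" "F i \<in> sets M" for i
    unfolding E_def F_def by measurable
  have Bm [measurable]: "B i \<in> sets M" for i
    unfolding B_def using fin by (intro sets.Diff sets.finite_UN) auto
  have FE: "F i \<subseteq> E i" for i by (auto simp: E_def F_def)
  have PE: "prob (E i) = G (?y / w i)" if "i \<in> A" for i
    unfolding E_def using prob_weighted_Z[OF wD(2)[OF that]] by simp
  \<comment> \<open>Chebyshev for single summands; as the squared weights add up to 1, a further
    jump has probability at most 1 / x^2.\<close>
  have sumG: "(\<Sum>j\<in>A-{i}. G (?y / w j)) \<le> 1 / x\<^sup>2" for i
  proof -
    have "(\<Sum>j\<in>A-{i}. G (?y / w j)) \<le> (\<Sum>j\<in>A. G (?y / w j))"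
      using fin less_imp_le[OF G_pos] by (intro sum_mono2) auto
    also have "\<dots> \<le> (\<Sum>j\<in>A. (w j)\<^sup>2 / x\<^sup>2)"
    proof (rule sum_mono)
      fix j assume j: "j \<in> A"
      have "G (?y / w j) = prob {\<omega> \<in> space M. ?y \<le> w j * Z j \<omega>}"
        using prob_weighted_Z[OF wD(2)[OF j]] by simp
      also have "\<dots> \<le> prob {\<omega> \<in> space M. \<bar>\<Sum>j\<in>{j}. w j * Z j \<omega>\<bar> \<ge> x}"
      proof (rule finite_measure_mono)
        have "x \<le> ?y" using assms by (simp add: algebra_simps)
        then show "{\<omega> \<in> space M. ?y \<le> w j * Z j \<omega>} \<subseteq> {\<omega> \<in> space M. \<bar>\<Sum>j\<in>{j}. w j * Z j \<omega>\<bar> \<ge> x}"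
          by auto
      qed simp
      also have "\<dots> \<le> (\<Sum>j\<in>{j}. (w j)\<^sup>2) / x\<^sup>2"
        using assms by (intro weighted_sum_chebyshev) auto
      finally show "G (?y / w j) \<le> (w j)\<^sup>2 / x\<^sup>2" by simp
    qed
    also have "\<dots> = 1 / x\<^sup>2" using wD(3) by (simp add: sum_divide_distrib[symmetric])
    finally show ?thesis .
  qed
  have PB: "G (?y / w i) * (1 - 1 / (\<delta> * x)\<^sup>2 - 1 / x\<^sup>2) \<le> prob (B i)" if i: "i \<in> A" for i
  proof -
    have g0: "0 \<le> G (?y / w i)" using G_pos less_imp_le by blast
    have "prob (F i) = prob (E i) * prob {\<omega> \<in> space M. (\<Sum>j\<in>A-{i}. w j * Z j \<omega>) \<in> {- \<delta> * x..}}"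
      unfolding F_def E_def using fin by (intro prob_Z_and_sum[where f = "\<lambda>i x. w i * x"]) auto
    moreover have "1 - 1 / (\<delta> * x)\<^sup>2 \<le> prob {\<omega> \<in> space M. (\<Sum>j\<in>A-{i}. w j * Z j \<omega>) \<in> {- \<delta> * x..}}"
    proof -
      let ?C = "{\<omega> \<in> space M. \<delta> * x \<le> \<bar>\<Sum>j\<in>A-{i}. w j * Z j \<omega>\<bar>}"
      have "1 - prob ?C = prob (space M - ?C)" by (simp add: prob_compl)
      also have "\<dots> \<le> prob {\<omega> \<in> space M. (\<Sum>j\<in>A-{i}. w j * Z j \<omega>) \<in> {- \<delta> * x..}}"
        by (intro finite_measure_mono) auto
      finally show ?thesis using remaining_sum_chebyshev[OF w, of "\<delta> * x" i] assms by simp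
    qed
    ultimately have 1: "G (?y / w i) * (1 - 1 / (\<delta> * x)\<^sup>2) \<le> prob (F i)"
      using PE[OF i] g0 by (simp add: mult_left_mono)
    have "prob (F i \<inter> (\<Union>j\<in>A-{i}. E j)) \<le> prob (\<Union>j\<in>A-{i}. E i \<inter> E j)"
      using FE[of i] fin by (intro finite_measure_mono) auto
    also have "\<dots> \<le> (\<Sum>j\<in>A-{i}. prob (E i \<inter> E j))"
      using fin by (intro finite_measure_subadditive_finite) auto
    also have "\<dots> = (\<Sum>j\<in>A-{i}. G (?y / w i) * G (?y / w j))"
    proof (rule sum.cong[OF refl])
      fix j assume j: "j \<in> A - {i}"
      have eq: "E i \<inter> E j = {\<omega> \<in> space M. w i * Z i \<omega> \<in> {?y..} \<and> (\<Sum>j\<in>{j}. w j * Z j \<omega>) \<in> {?y..}}"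
        by (auto simp: E_def)
      have "prob (E i \<inter> E j) = prob {\<omega> \<in> space M. w i * Z i \<omega> \<in> {?y..}} * prob {\<omega> \<in> space M. (\<Sum>j\<in>{j}. w j * Z j \<omega>) \<in> {?y..}}"
        unfolding eq using j by (intro prob_Z_and_sum[where f = "\<lambda>i x. w i * x"]) auto
      also have "\<dots> = prob (E i) * prob (E j)" by (simp add: E_def)
      finally show "prob (E i \<inter> E j) = G (?y / w i) * G (?y / w j)" using PE i j by simp
    qed
    also have "\<dots> \<le> G (?y / w i) * (1 / x\<^sup>2)"
      unfolding sum_distrib_left[symmetric] using sumG g0 by (intro mult_left_mono)
    finally have 2: "prob (F i \<inter> (\<Union>j\<in>A-{i}. E j)) \<le> G (?y / w i) * (1 / x\<^sup>2)" .
    have "prob (B i) = prob (F i) - prob (F i \<inter> (\<Union>j\<in>A-{i}. E j))"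
      unfolding B_def using fin by (intro finite_measure_Diff') auto
    then show ?thesis using 1 2 by (simp add: right_diff_distrib)
  qed
  have disj: "disjoint_family_on B A"
    using FE by (fastforce simp: disjoint_family_on_def B_def)
  have "(\<Sum>i\<in>A. G (?y / w i) * (1 - 1 / (\<delta> * x)\<^sup>2 - 1 / x\<^sup>2)) \<le> (\<Sum>i\<in>A. prob (B i))"
    using PB by (intro sum_mono)
  also have "\<dots> = prob (\<Union>i\<in>A. B i)"
    using fin disj by (intro finite_measure_finite_Union[symmetric]) auto
  also have "\<dots> \<le> sum_prob A w x"
  proof (rule finite_measure_mono)
    show "(\<Union>i\<in>A. B i) \<subseteq> {\<omega> \<in> space M. x \<le> (\<Sum>i\<in>A. w i * Z i \<omega>)}"
    proof
      fix \<omega> assume "\<omega> \<in> (\<Union>i\<in>A. B i)"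
      then obtain i where i: "i \<in> A" "\<omega> \<in> F i" by (auto simp: B_def)
      have "(\<Sum>i\<in>A. w i * Z i \<omega>) = w i * Z i \<omega> + (\<Sum>j\<in>A-{i}. w j * Z j \<omega>)"
        using fin i by (simp add: sum.remove)
      then show "\<omega> \<in> {\<omega> \<in> space M. x \<le> (\<Sum>i\<in>A. w i * Z i \<omega>)}"
        using i by (auto simp: F_def algebra_simps)
    qed
  qed simp
  finally show ?thesis by (simp add: sum_distrib_right)
qed

text \<open>The exponent of a Chernoff bound is compared with the lower bound c x^(- (t + \<kappa>))
  exp (- (1 + \<kappa>') L) of the tail sum. The level \<open>\<eta>\<close> depends on neither
  \<open>\<epsilon>\<close> nor the weights, which matters when the jumps above \<eta> x are summed
  later.\<close>

lemma truncated_sum_negligible: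
  assumes "sqrt 2 < a"
  shows "\<exists>\<eta>>0. \<forall>\<epsilon>>0. \<exists>L0. \<forall>A w x. unit_weights A w \<longrightarrow> L0 \<le> log_D A w \<longrightarrow> a * sqrt (log_D A w) \<le> x \<longrightarrow>
    prob {\<omega> \<in> space M. x \<le> trunc_sum A w (\<eta> * x) \<omega>} \<le> \<epsilon> * tail_sum A w x"
proof -
  \<comment> \<open>With the midpoint of 2 and \<open>t\<close> the r-th power sum is at most exp (-
    L / 2), enough to beat a factor exp (L / 4) produced by the tilt.\<close>
  define r where "r = (t + 2) / 2"
  \<comment> \<open>As \<open>\<kappa> \<le> 1\<close>, a factor x^(- B) beats x^(- (t + \<kappa>))
    by at least x^(- 2).\<close>
  define B where "B = t + 3"
  \<comment> \<open>Makes \<eta> x^2 \<le> L / 4 equivalent to x^2 \<le> B^2 L.\<close>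
  define \<eta> where "\<eta> = 1 / (4 * B\<^sup>2)"
  define \<kappa>q where "\<kappa>q = (q - 2) / (t - 2)"
  have a2: "2 < a\<^sup>2" using assms by (metis real_sqrt_less_iff real_sqrt_abs abs_of_pos less_trans real_sqrt_gt_0_iff zero_less_numeral)
  have a0: "0 < a" using assms by (metis less_trans real_sqrt_gt_0_iff zero_less_numeral)
  \<comment> \<open>The excess \<open>\<kappa>\<close> over \<open>t\<close> in the power of x
    corresponds to the excess \<open>\<kappa>'\<close> over 1 in the rate of \<open>L\<close>. The
    cap (a^2 - 2) / 4 keeps 1 + \<kappa>' below a^2 / 2, so that \<open>\<beta>\<close> is positive;
    the cap 1 / (t - 2) gives \<open>\<kappa> \<le> 1\<close>.\<close>
  define \<kappa>' where "\<kappa>' = min (min 1 (1 / (t - 2))) ((a\<^sup>2 - 2) / 4)"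
  define \<kappa> where "\<kappa> = (t - 2) * \<kappa>'"
  define \<beta> where "\<beta> = 1 / 2 - (1 + \<kappa>') / a\<^sup>2"
  have t2: "0 < t - 2" using t_gt_2 by simp
  have \<kappa>': "0 < \<kappa>'" "\<kappa>' \<le> 1" using a2 t2 by (auto simp: \<kappa>'_def)
  have \<kappa>'_a: "\<kappa>' \<le> (a\<^sup>2 - 2) / 4" unfolding \<kappa>'_def by (rule min.cobounded2)
  have \<kappa>: "0 < \<kappa>" "\<kappa> \<le> 1"
  proof -
    show "0 < \<kappa>" using t2 \<kappa>' by (simp add: \<kappa>_def)
    have "\<kappa>' \<le> 1 / (t - 2)" by (simp add: \<kappa>'_def)
    then show "\<kappa> \<le> 1" using t2 by (simp add: \<kappa>_def field_simps)
  qed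
  have \<kappa>_exp: "(t + \<kappa> - 2) / (t - 2) = 1 + \<kappa>'" using t2 by (simp add: \<kappa>_def field_simps)
  have \<beta>: "0 < \<beta>"
  proof -
    have "1 + k < 1 / 2 * b" if "2 < b" "k \<le> (b - 2) / 4" for b k :: real
      using that by (simp add: field_simps)
    from this[OF a2 \<kappa>'_a] have "1 + \<kappa>' < 1 / 2 * a\<^sup>2" .
    then have "(1 + \<kappa>') / a\<^sup>2 < 1 / 2" using a0 by (subst pos_divide_less_eq) auto
    then show ?thesis by (simp add: \<beta>_def)
  qed
  have B: "5 < B" using t_gt_2 by (simp add: B_def)
  have \<eta>: "0 < \<eta>" "\<eta> * B\<^sup>2 = 1 / 4" using B by (auto simp: \<eta>_def)
  have \<eta>B: "\<eta> * B \<le> 1 / 4"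
  proof -
    have "\<eta> * B * 1 \<le> \<eta> * B * B" using B \<eta> by (intro mult_left_mono) auto
    also have "\<eta> * B * B = \<eta> * B\<^sup>2" by (simp add: power2_eq_square)
    finally show ?thesis using \<eta>(2) by simp
  qed
  have rt: "2 < r" "r < t" "(r - 2) / (t - 2) = 1 / 2" using t_gt_2 by (auto simp: r_def field_simps)
  interpret iid_standard_moments M Z q r by (rule moments_locale[OF rt(1,2)])
  obtain c U where cU: "0 < c" "0 < U" "\<forall>u\<ge>U. c * u powr - (t + \<kappa>) \<le> G u"
    using G_ge_powr[of "t + \<kappa>"] \<kappa> by auto
  have \<kappa>q: "0 < \<kappa>q" using q_gt by (simp add: \<kappa>q_def)
  define K1 where "K1 = exp r * absmom q"
  define K2 where "K2 = posmom r * \<eta> powr - r"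
  have K: "0 \<le> K1" "0 \<le> K2" by (auto simp: K1_def K2_def absmom_nonneg posmom_nonneg)
  \<comment> \<open>A common bound of \<open>exp_error\<close> for both tilts used below: the
    squared tilt is at most B^2 L in one regime and 2 L + 2 B^2 in the other.\<close>
  define err where "err L = K1 * ((2 + B\<^sup>2) * L + 2 * B\<^sup>2) powr (q / 2) * exp (- \<kappa>q * L) + K2 * exp (- L / 4)" for L
  have "(err \<longlongrightarrow> 0) at_top"
  proof -
    have "((\<lambda>L. ((2 + B\<^sup>2) * L + 2 * B\<^sup>2) powr (q / 2) * exp (- \<kappa>q * L)) \<longlongrightarrow> 0) at_top"
    proof -
      have "((\<lambda>L. (c1 * L + c2) powr e * exp (- k * L)) \<longlongrightarrow> 0) at_top" if "0 < c1" "0 < k" for c1 c2 k e :: real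
        using that by real_asymp
      then show ?thesis using \<kappa>q by (simp add: add_pos_nonneg)
    qed
    moreover have "((\<lambda>L::real. exp (- L / 4)) \<longlongrightarrow> 0) at_top" by real_asymp
    ultimately show ?thesis
      using tendsto_add[OF tendsto_mult_left[of _ _ _ K1] tendsto_mult_left[of _ _ _ K2]]
      unfolding err_def by (fastforce simp: mult.assoc)
  qed
  then have "\<forall>\<^sub>F L in at_top. err L < 1" by (rule order_tendstoD) simp
  then obtain L1 where L1: "\<And>L. L1 \<le> L \<Longrightarrow> err L < 1" unfolding eventually_at_top_linorder by auto
  show ?thesis
  proof (rule exI[of _ \<eta>], intro conjI allI impI)
    show "0 < \<eta>" by (rule \<eta>)
    fix \<epsilon> :: real assume \<epsilon>: "0 < \<epsilon>"
    have "((\<lambda>x. x powr (t + \<kappa>) * exp (- \<beta> * x\<^sup>2 + 1)) \<longlongrightarrow> 0) at_top" using \<beta> by real_asymp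
    then have "\<forall>\<^sub>F x in at_top. x powr (t + \<kappa>) * exp (- \<beta> * x\<^sup>2 + 1) < \<epsilon> * c"
      using \<epsilon> cU by (intro order_tendstoD) auto
    moreover have "((\<lambda>x. exp (B\<^sup>2 + 1) * x powr - 2) \<longlongrightarrow> 0) at_top" by real_asymp
    then have "\<forall>\<^sub>F x in at_top. exp (B\<^sup>2 + 1) * x powr - 2 < \<epsilon> * c"
      using \<epsilon> cU by (intro order_tendstoD) auto
    ultimately have "\<forall>\<^sub>F x in at_top. x powr (t + \<kappa>) * exp (- \<beta> * x\<^sup>2 + 1) < \<epsilon> * c \<and> exp (B\<^sup>2 + 1) * x powr - 2 < \<epsilon> * c"
      by (rule eventually_conj)
    then obtain X1 where X1: "\<And>x. X1 \<le> x \<Longrightarrow> x powr (t + \<kappa>) * exp (- \<beta> * x\<^sup>2 + 1) < \<epsilon> * c"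
      "\<And>x. X1 \<le> x \<Longrightarrow> exp (B\<^sup>2 + 1) * x powr - 2 < \<epsilon> * c" unfolding eventually_at_top_linorder by blast
    \<comment> \<open>The entries ensure in turn that \<open>err L\<close> is below 1, that L \<ge>
      1, that x \<ge> a sqrt L exceeds X1 and 1, and that all x / w i exceed
      \<open>U\<close>.\<close>
    define L0 where "L0 = max (max L1 1) (max ((max X1 1 / a)\<^sup>2) (t * ln U))"
    show "\<exists>L0. \<forall>A w x. unit_weights A w \<longrightarrow> L0 \<le> log_D A w \<longrightarrow> a * sqrt (log_D A w) \<le> x \<longrightarrow>
      prob {\<omega> \<in> space M. x \<le> trunc_sum A w (\<eta> * x) \<omega>} \<le> \<epsilon> * tail_sum A w x"
    proof (intro exI[of _ L0] allI impI)
      fix A w x assume w: "unit_weights A w" and L0: "L0 \<le> log_D A w" and ax: "a * sqrt (log_D A w) \<le> x"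
      define L where "L = log_D A w"
      have L: "L1 \<le> L" "1 \<le> L" "(max X1 1 / a)\<^sup>2 \<le> L" "t * ln U \<le> L" using L0 by (auto simp: L0_def L_def)
      have x1: "max X1 1 \<le> x"
      proof -
        have "max X1 1 / a \<le> sqrt L" using L(3) a0 by (intro real_le_rsqrt) auto
        then have "max X1 1 \<le> a * sqrt L" using a0 by (simp add: field_simps)
        then show ?thesis using ax by (simp add: L_def)
      qed
      then have x: "X1 \<le> x" "1 \<le> x" by auto
      have Lx: "L \<le> x\<^sup>2 / a\<^sup>2"
      proof -
        have "(a * sqrt L)\<^sup>2 \<le> x\<^sup>2" using ax a0 L by (intro power_mono) (auto simp: L_def)
        then show ?thesis using a0 L by (simp add: power_mult_distrib field_simps)
      qed
      have UL: "U \<le> exp (L / t)"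
      proof -
        have "ln U \<le> L / t" using L t_gt_2 by (simp add: field_simps)
        then show ?thesis using cU(2) by (simp add: ln_ge_iff[symmetric] ln_le_cancel_iff[symmetric] del: ln_le_cancel_iff)
      qed
      have low: "c * x powr - (t + \<kappa>) * exp (- (1 + \<kappa>') * L) \<le> tail_sum A w x"
        using sum_tail_ge[OF _ cU(2,3) _ w x(2)] UL \<kappa> cU(1) unfolding \<kappa>_exp L_def by simp
      have Dq: "(\<Sum>i\<in>A. w i powr q) \<le> exp (- \<kappa>q * L)"
        using sum_powr_le[OF w, of q] q_gt by (simp add: \<kappa>q_def L_def)
      have Dr: "(\<Sum>i\<in>A. w i powr r) \<le> exp (- L / 2)"
      proof -
        have "(\<Sum>i\<in>A. w i powr r) \<le> exp (- ((r - 2) / (t - 2)) * log_D A w)"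
          using rt(1,2) by (intro sum_powr_le[OF w]) auto
        then show ?thesis unfolding rt(3) L_def by simp
      qed
      have \<eta>x: "(\<eta> * x) powr - r \<le> \<eta> powr - r * x powr - r" using \<eta> x by (simp add: powr_mult)
      \<comment> \<open>A tilt with exp (s \<eta> x) \<le> exp (L / 4) x^r is admissible: x^r is
        cancelled by the power - r of \<eta> x, and exp (L / 4) by the r-th power sum.\<close>
      have err: "exp_error s (\<eta> * x) (\<Sum>i\<in>A. w i powr q) (\<Sum>i\<in>A. w i powr r) \<le> 1"
        if s: "0 < s" "s\<^sup>2 \<le> (2 + B\<^sup>2) * L + 2 * B\<^sup>2" "s * x * \<eta> \<le> L / 4 + r * ln x" for s
      proof -
        have "s powr q = (s\<^sup>2) powr (q / 2)" using s(1) by (simp add: powr_powr powr_numeral[symmetric] del: powr_numeral)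
        also have "\<dots> \<le> ((2 + B\<^sup>2) * L + 2 * B\<^sup>2) powr (q / 2)" using s q_gt by (intro powr_mono2) auto
        finally have sq: "s powr q \<le> ((2 + B\<^sup>2) * L + 2 * B\<^sup>2) powr (q / 2)" .
        have 1: "exp r * absmom q * s powr q * (\<Sum>i\<in>A. w i powr q) \<le>
          K1 * ((2 + B\<^sup>2) * L + 2 * B\<^sup>2) powr (q / 2) * exp (- \<kappa>q * L)"
          unfolding K1_def[symmetric] using sq Dq K by (intro mult_mono mult_nonneg_nonneg sum_nonneg) auto
        have "exp (s * (\<eta> * x)) * (\<eta> * x) powr - r * (\<Sum>i\<in>A. w i powr r) \<le>
          exp (L / 4 + r * ln x) * (\<eta> powr - r * x powr - r) * exp (- L / 2)"
          using s(3) Dr \<eta>x by (intro mult_mono mult_nonneg_nonneg sum_nonneg) (auto simp: mult_ac)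
        also have "\<dots> = \<eta> powr - r * (exp (r * ln x) * x powr - r) * (exp (L / 4) * exp (- L / 2))"
          by (simp add: exp_add mult_ac)
        also have "exp (r * ln x) * x powr - r = 1" using x by (simp add: powr_def exp_add[symmetric])
        also have "exp (L / 4) * exp (- L / 2) = exp (- L / 4)" by (simp add: exp_add[symmetric])
        finally have "posmom r * (exp (s * (\<eta> * x)) * (\<eta> * x) powr - r * (\<Sum>i\<in>A. w i powr r)) \<le>
          posmom r * (\<eta> powr - r * 1 * exp (- L / 4))"
          using posmom_nonneg by (intro mult_left_mono)
        then have 2: "posmom r * exp (s * (\<eta> * x)) * (\<eta> * x) powr - r * (\<Sum>i\<in>A. w i powr r) \<le> K2 * exp (- L / 4)"
          by (simp add: K2_def mult.assoc)
        show ?thesis unfolding exp_error_def using 1 2 L1[OF L(1)] by (simp add: err_def)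
      qed
      have cher: "prob {\<omega> \<in> space M. x \<le> trunc_sum A w (\<eta> * x) \<omega>} \<le> exp (s\<^sup>2 / 2 - s * x + 1)"
        if s: "0 < s" "s\<^sup>2 \<le> (2 + B\<^sup>2) * L + 2 * B\<^sup>2" "s * x * \<eta> \<le> L / 4 + r * ln x" for s
      proof -
        have "prob {\<omega> \<in> space M. x \<le> trunc_sum A w (\<eta> * x) \<omega>} \<le>
          exp (s\<^sup>2 / 2 - s * x + exp_error s (\<eta> * x) (\<Sum>i\<in>A. w i powr q) (\<Sum>i\<in>A. w i powr r))"
          using unit_weightsD[OF w] \<eta> x s by (intro chernoff_sum_trunc) auto
        also have "\<dots> \<le> exp (s\<^sup>2 / 2 - s * x + 1)" using err[OF s] by simp
        finally show ?thesis .
      qed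
      \<comment> \<open>Criterion relative to the lower bound \<open>low\<close>: an exponent
        \<open>e\<close> is good once it compensates both x^(t + \<kappa>) and exp ((1 + \<kappa>')
        L).\<close>
      have suff: "exp e \<le> \<epsilon> * tail_sum A w x"
        if "x powr (t + \<kappa>) * exp (e + (1 + \<kappa>') * L) \<le> \<epsilon> * c" for e
      proof -
        have "exp e = x powr (t + \<kappa>) * exp (e + (1 + \<kappa>') * L) * (x powr - (t + \<kappa>) * exp (- (1 + \<kappa>') * L))"
        proof -
          have "x powr (t + \<kappa>) * x powr - (t + \<kappa>) = 1" using x by (simp add: powr_add[symmetric] del: powr_minus)
          moreover have "exp (e + (1 + \<kappa>') * L) * exp (- (1 + \<kappa>') * L) = exp e"
            by (simp add: exp_add[symmetric] algebra_simps)
          ultimately show ?thesis by (metis mult.assoc mult.commute mult.left_neutral)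
        qed
        also have "\<dots> \<le> \<epsilon> * c * (x powr - (t + \<kappa>) * exp (- (1 + \<kappa>') * L))"
          using that by (intro mult_right_mono) auto
        also have "\<dots> = \<epsilon> * (c * x powr - (t + \<kappa>) * exp (- (1 + \<kappa>') * L))" by (simp only: mult.assoc)
        also have "\<dots> \<le> \<epsilon> * tail_sum A w x" using low \<epsilon> by (intro mult_left_mono) auto
        finally show ?thesis .
      qed
      have lnx: "0 \<le> ln x" "ln x \<le> x" using x ln_le_minus_one[of x] by auto
      show "prob {\<omega> \<in> space M. x \<le> trunc_sum A w (\<eta> * x) \<omega>} \<le> \<epsilon> * tail_sum A w x"
      \<comment> \<open>The Gaussian tilt s = x is used as long as \<eta> x^2 \<le> L / 4, which is
        this condition by the choice of \<open>\<eta>\<close>; afterwards it is replaced by one of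
        order (L + ln x) / x.\<close>
      proof (cases "x\<^sup>2 \<le> B\<^sup>2 * L")
        case True
        have "x * x * \<eta> \<le> B\<^sup>2 * L * \<eta>" using True \<eta> by (intro mult_right_mono) (auto simp: power2_eq_square)
        also have "\<dots> = L / 4" using \<eta>(2) by (metis mult.commute mult.left_commute times_divide_eq_right mult_1_right)
        also have "\<dots> \<le> L / 4 + r * ln x" using lnx rt by simp
        finally have "prob {\<omega> \<in> space M. x \<le> trunc_sum A w (\<eta> * x) \<omega>} \<le> exp (x\<^sup>2 / 2 - x * x + 1)"
          using True x L by (intro cher) (auto simp: distrib_right intro: add_increasing add_increasing2)
        also have "\<dots> \<le> \<epsilon> * tail_sum A w x"
        proof (rule suff)
          have "(1 + \<kappa>') * L \<le> (1 + \<kappa>') * (x\<^sup>2 / a\<^sup>2)" using Lx \<kappa>' by (intro mult_left_mono) auto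
          also have "\<dots> = (1 / 2 - \<beta>) * x\<^sup>2" by (simp add: \<beta>_def)
          finally have "x\<^sup>2 / 2 - x * x + 1 + (1 + \<kappa>') * L \<le> - \<beta> * x\<^sup>2 + 1"
            by (simp add: power2_eq_square algebra_simps)
          then have "x powr (t + \<kappa>) * exp (x\<^sup>2 / 2 - x * x + 1 + (1 + \<kappa>') * L) \<le> x powr (t + \<kappa>) * exp (- \<beta> * x\<^sup>2 + 1)"
            by (intro mult_left_mono) auto
          then show "x powr (t + \<kappa>) * exp (x\<^sup>2 / 2 - x * x + 1 + (1 + \<kappa>') * L) \<le> \<epsilon> * c"
            using X1(1)[OF x(1)] by simp
        qed
        finally show ?thesis .
      next
        case False
        \<comment> \<open>Chosen so that exp (- s x) = exp (- B L) x^(- B), while s^2 / 2 stays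
          below L + B^2.\<close>
        define s where "s = B * (L + ln x) / x"
        have "0 < L + ln x" using L(2) lnx(1) by linarith
        then have s0: "0 < s" using B x by (simp add: s_def)
        have s2: "s\<^sup>2 \<le> 2 * L + 2 * B\<^sup>2"
        proof -
          have "(L + ln x)\<^sup>2 \<le> 2 * L\<^sup>2 + 2 * (ln x)\<^sup>2"
            using zero_le_power2[of "L - ln x"] by (simp add: power2_eq_square algebra_simps)
          then have "s\<^sup>2 \<le> B\<^sup>2 * (2 * L\<^sup>2 + 2 * (ln x)\<^sup>2) / x\<^sup>2"
            unfolding s_def power_divide power_mult_distrib by (intro divide_right_mono mult_left_mono) auto
          also have "\<dots> = 2 * L * (B\<^sup>2 * L / x\<^sup>2) + 2 * B\<^sup>2 * ((ln x)\<^sup>2 / x\<^sup>2)"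
            by (simp add: power2_eq_square add_divide_distrib algebra_simps)
          also have "\<dots> \<le> 2 * L * 1 + 2 * B\<^sup>2 * 1"
          proof (intro add_mono mult_left_mono)
            show "B\<^sup>2 * L / x\<^sup>2 \<le> 1" using False x by (simp add: field_simps)
            have "(ln x)\<^sup>2 \<le> x\<^sup>2" using lnx by (intro power_mono) auto
            then show "(ln x)\<^sup>2 / x\<^sup>2 \<le> 1" using x by (simp add: field_simps)
          qed (use L in auto)
          finally show ?thesis by simp
        qed
        have "s * x = B * (L + ln x)" using x by (simp add: s_def)
        then have sx: "s * x = B * L + B * ln x" by (simp add: distrib_left)
        have "prob {\<omega> \<in> space M. x \<le> trunc_sum A w (\<eta> * x) \<omega>} \<le> exp (s\<^sup>2 / 2 - s * x + 1)"
        proof (rule cher[OF s0])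
          have "0 \<le> B\<^sup>2 * L" using L by simp
          then show "s\<^sup>2 \<le> (2 + B\<^sup>2) * L + 2 * B\<^sup>2" using s2 by (simp add: distrib_right)
          have "s * x * \<eta> = (\<eta> * B) * (L + ln x)" unfolding sx by (simp add: algebra_simps)
          also have "\<dots> \<le> 1 / 4 * (L + ln x)" using \<eta>B L lnx by (intro mult_right_mono) auto
          also have "\<dots> \<le> L / 4 + r * ln x"
            using mult_right_mono[of "1/4" r "ln x"] rt lnx by (simp add: algebra_simps)
          finally show "s * x * \<eta> \<le> L / 4 + r * ln x" .
        qed
        also have "\<dots> \<le> \<epsilon> * tail_sum A w x"
        proof (rule suff)
          \<comment> \<open>Out of B L, one L pays for s^2 / 2 and (1 + \<kappa>') L for the tail
            sum.\<close>
          have "0 \<le> (B - 2 - \<kappa>') * L" using B \<kappa>' L by (intro mult_nonneg_nonneg) auto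
          moreover have "(B - 2 - \<kappa>') * L = B * L - 2 * L - \<kappa>' * L" by (simp add: algebra_simps)
          moreover have "(1 + \<kappa>') * L = L + \<kappa>' * L" by (simp add: algebra_simps)
          ultimately have "s\<^sup>2 / 2 - s * x + 1 + (1 + \<kappa>') * L \<le> (B\<^sup>2 + 1) - B * ln x"
            using s2 unfolding sx by linarith
          then have "x powr (t + \<kappa>) * exp (s\<^sup>2 / 2 - s * x + 1 + (1 + \<kappa>') * L) \<le>
            x powr (t + \<kappa>) * exp ((B\<^sup>2 + 1) - B * ln x)" by (intro mult_left_mono) auto
          also have "\<dots> = exp (B\<^sup>2 + 1) * x powr (\<kappa> - 3)"
            using x by (simp add: powr_def exp_add[symmetric] exp_diff[symmetric] B_def algebra_simps)
          also have "\<dots> \<le> exp (B\<^sup>2 + 1) * x powr - 2"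
            using x \<kappa> by (intro mult_left_mono powr_mono) auto
          also have "\<dots> \<le> \<epsilon> * c" using X1(2)[OF x(1)] by simp
          finally show "x powr (t + \<kappa>) * exp (s\<^sup>2 / 2 - s * x + 1 + (1 + \<kappa>') * L) \<le> \<epsilon> * c" .
        qed
        finally show ?thesis .
      qed
    qed
  qed
qed

lemma large_deviations:
  assumes "sqrt 2 < a" "0 < \<epsilon>"
  shows "\<exists>L0. \<forall>A w x. unit_weights A w \<longrightarrow> L0 \<le> log_D A w \<longrightarrow> a * sqrt (log_D A w) \<le> x \<longrightarrow>
    \<bar>sum_prob A w x - tail_sum A w x\<bar> \<le> \<epsilon> * tail_sum A w x"
proof -
  have a0: "0 < a" using assms by (metis less_trans real_sqrt_gt_0_iff zero_less_numeral)
  \<comment> \<open>Both directions lose at most 4 e: the upper one 2 e + e + e, the lower one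
    through (1 - 2 e) (1 - e).\<close>
  define e where "e = min \<epsilon> 1 / 4"
  have e: "0 < e" "4 * e \<le> \<epsilon>" "e \<le> 1 / 4" using assms by (auto simp: e_def)
  have "((\<lambda>d. (1 - d) powr - t) \<longlongrightarrow> 1) (at_right 0)" "((\<lambda>d. (1 + d) powr - t) \<longlongrightarrow> 1) (at_right 0)"
    by real_asymp+
  then have "\<forall>\<^sub>F d in at_right 0. (1 - d) powr - t < 1 + e" "\<forall>\<^sub>F d in at_right 0. 1 - e < (1 + d) powr - t"
    using e by (auto intro: order_tendstoD)
  moreover have "\<forall>\<^sub>F d in at_right 0. (0::real) < d \<and> d < 1"
    by (auto simp: eventually_at_right[of 0 1] intro: exI[of _ 1])
  ultimately have "\<forall>\<^sub>F d in at_right 0. (1 - d) powr - t < 1 + e \<and> 1 - e < (1 + d) powr - t \<and> 0 < d \<and> d < 1"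
    by eventually_elim auto
  then obtain \<delta> where \<delta>: "(1 - \<delta>) powr - t < 1 + e" "1 - e < (1 + \<delta>) powr - t" "0 < \<delta>" "\<delta> < 1"
    using eventually_happens'[of "at_right (0::real)"] by auto
  \<comment> \<open>As \<open>\<eta>\<close> is fixed independently of the accuracy, \<eta>^(- t) is
    a constant, and the factor 1 / (\<delta> x)^2 makes the middle term of
    \<open>big_jump_upper\<close> small.\<close>
  obtain \<eta> where \<eta>: "0 < \<eta>" and neg: "\<forall>\<epsilon>>0. \<exists>L0. \<forall>A w x. unit_weights A w \<longrightarrow> L0 \<le> log_D A w \<longrightarrow> a * sqrt (log_D A w) \<le> x \<longrightarrow>
    prob {\<omega> \<in> space M. x \<le> trunc_sum A w (\<eta> * x) \<omega>} \<le> \<epsilon> * tail_sum A w x"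
    using truncated_sum_negligible[OF assms(1)] by blast
  obtain L1 where L1: "\<And>A w x. unit_weights A w \<Longrightarrow> L1 \<le> log_D A w \<Longrightarrow> a * sqrt (log_D A w) \<le> x \<Longrightarrow>
    prob {\<omega> \<in> space M. x \<le> trunc_sum A w (\<eta> * x) \<omega>} \<le> e * tail_sum A w x"
    using neg[rule_format, OF e(1)] by auto
  obtain L2 where L2: "\<And>A w x. unit_weights A w \<Longrightarrow> L2 \<le> log_D A w \<Longrightarrow> 1 \<le> x \<Longrightarrow>
    \<bar>(\<Sum>i\<in>A. G ((1 - \<delta>) * x / w i)) - (1 - \<delta>) powr - t * tail_sum A w x\<bar> \<le> e * tail_sum A w x"
    using sum_tail_scaled[of "1 - \<delta>" e] \<delta> e by auto
  obtain L3 where L3: "\<And>A w x. unit_weights A w \<Longrightarrow> L3 \<le> log_D A w \<Longrightarrow> 1 \<le> x \<Longrightarrow>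
    \<bar>(\<Sum>i\<in>A. G ((1 + \<delta>) * x / w i)) - (1 + \<delta>) powr - t * tail_sum A w x\<bar> \<le> e * tail_sum A w x"
    using sum_tail_scaled[of "1 + \<delta>" e] \<delta> e by auto
  obtain L4 where L4: "\<And>A w x. unit_weights A w \<Longrightarrow> L4 \<le> log_D A w \<Longrightarrow> 1 \<le> x \<Longrightarrow>
    \<bar>(\<Sum>i\<in>A. G (\<eta> * x / w i)) - \<eta> powr - t * tail_sum A w x\<bar> \<le> 1 * tail_sum A w x"
    using sum_tail_scaled[of \<eta> 1] \<eta> by auto
  have "((\<lambda>x. (\<eta> powr - t + 1) * (1 / (\<delta> * x)\<^sup>2)) \<longlongrightarrow> 0) at_top" "((\<lambda>x. 1 / (\<delta> * x)\<^sup>2 + 1 / x\<^sup>2) \<longlongrightarrow> 0) at_top"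
    using \<delta> \<eta> by real_asymp+
  then have "\<forall>\<^sub>F x in at_top. (\<eta> powr - t + 1) * (1 / (\<delta> * x)\<^sup>2) < e" "\<forall>\<^sub>F x in at_top. 1 / (\<delta> * x)\<^sup>2 + 1 / x\<^sup>2 < e"
    using e(1) by (auto intro: order_tendstoD)
  then have "\<forall>\<^sub>F x in at_top. (\<eta> powr - t + 1) * (1 / (\<delta> * x)\<^sup>2) < e \<and> 1 / (\<delta> * x)\<^sup>2 + 1 / x\<^sup>2 < e"
    by (rule eventually_conj)
  then obtain X where X: "\<And>x. X \<le> x \<Longrightarrow> (\<eta> powr - t + 1) * (1 / (\<delta> * x)\<^sup>2) < e"
    "\<And>x. X \<le> x \<Longrightarrow> 1 / (\<delta> * x)\<^sup>2 + 1 / x\<^sup>2 < e" unfolding eventually_at_top_linorder by blast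
  define L0 where "L0 = max (max L1 L2) (max (max L3 L4) ((max X 1 / a)\<^sup>2))"
  show ?thesis
  proof (intro exI[of _ L0] allI impI)
    fix A w x assume w: "unit_weights A w" and L0: "L0 \<le> log_D A w" and ax: "a * sqrt (log_D A w) \<le> x"
    have L: "L1 \<le> log_D A w" "L2 \<le> log_D A w" "L3 \<le> log_D A w" "L4 \<le> log_D A w" "(max X 1 / a)\<^sup>2 \<le> log_D A w"
      using L0 by (auto simp: L0_def)
    have "max X 1 / a \<le> sqrt (log_D A w)" using L(5) a0 by (intro real_le_rsqrt) auto
    then have "max X 1 \<le> a * sqrt (log_D A w)" using a0 by (simp add: field_simps)
    then have x: "X \<le> x" "1 \<le> x" using ax by auto
    let ?P = "sum_prob A w x"
    let ?S = "\<Sum>i\<in>A. G (x / w i)"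
    have S0: "0 \<le> ?S" using less_imp_le[OF G_pos] by (intro sum_nonneg) auto
    have "?P \<le> (1 + 4 * e) * ?S"
    proof -
      have 1: "(\<Sum>i\<in>A. G ((1 - \<delta>) * x / w i)) \<le> (1 + 2 * e) * ?S"
        using L2[OF w L(2) x(2)] mult_right_mono[OF less_imp_le[OF \<delta>(1)] S0] by (simp add: distrib_right)
      have "(\<Sum>i\<in>A. G (\<eta> * x / w i)) \<le> (\<eta> powr - t + 1) * ?S"
        using L4[OF w L(4) x(2)] by (simp add: distrib_right)
      then have "(\<Sum>i\<in>A. G (\<eta> * x / w i)) * (1 / (\<delta> * x)\<^sup>2) \<le> (\<eta> powr - t + 1) * ?S * (1 / (\<delta> * x)\<^sup>2)"
        by (intro mult_right_mono) auto
      also have "\<dots> = ((\<eta> powr - t + 1) * (1 / (\<delta> * x)\<^sup>2)) * ?S" by (simp only: mult_ac)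
      also have "\<dots> \<le> e * ?S" using X(1)[OF x(1)] S0 by (intro mult_right_mono) auto
      finally have 2: "(\<Sum>i\<in>A. G (\<eta> * x / w i)) * (1 / (\<delta> * x)\<^sup>2) \<le> e * ?S" .
      have "?P \<le> (1 + 2 * e) * ?S + e * ?S + e * ?S"
        using big_jump_upper[OF w \<delta>(3,4) \<eta>, of x] x 1 2 L1[OF w L(1) ax] by linarith
      then show ?thesis by (simp add: distrib_right)
    qed
    moreover have "(1 - 4 * e) * ?S \<le> ?P"
    proof -
      have 1: "(1 - 2 * e) * ?S \<le> (\<Sum>i\<in>A. G ((1 + \<delta>) * x / w i))"
        using L3[OF w L(3) x(2)] mult_right_mono[OF less_imp_le[OF \<delta>(2)] S0] by (simp add: left_diff_distrib)
      have "(1 - 4 * e) \<le> (1 - 2 * e) * (1 - e)" using e by (simp add: algebra_simps)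
      then have "(1 - 4 * e) * ?S \<le> ((1 - 2 * e) * (1 - e)) * ?S" using S0 by (intro mult_right_mono) auto
      also have "\<dots> = ((1 - 2 * e) * ?S) * (1 - e)" by (simp only: mult_ac)
      also have "\<dots> \<le> (\<Sum>i\<in>A. G ((1 + \<delta>) * x / w i)) * (1 - 1 / (\<delta> * x)\<^sup>2 - 1 / x\<^sup>2)"
        using 1 X(2)[OF x(1)] e S0 less_imp_le[OF G_pos] by (intro mult_mono sum_nonneg) auto
      also have "\<dots> \<le> ?P" using x \<delta> by (intro big_jump_lower[OF w]) auto
      finally show ?thesis .
    qed
    ultimately have "\<bar>?P - ?S\<bar> \<le> (4 * e) * ?S" by (simp add: abs_le_iff distrib_right left_diff_distrib)
    also have "\<dots> \<le> \<epsilon> * ?S" using e S0 by (intro mult_right_mono) auto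
    finally show "\<bar>?P - ?S\<bar> \<le> \<epsilon> * ?S" .
  qed
qed

end

section \<open>Moderate deviations\<close>

lemma tilt_bound_mono_var:
  assumes "0 \<le> s" "0 \<le> v" "v \<le> v'"
  shows "tilt_bound s x v u \<le> tilt_bound s x v' u"
  unfolding tilt_bound_def using assms
  by (intro mult_mono power_mono) (auto intro!: mult_left_mono divide_right_mono)

text \<open>The condition is one-sided: moving left only lowers the bound, so summands need no
  truncation from below.\<close>

lemma tilt_bound_shift:
  assumes "0 \<le> s" "0 \<le> v" "s * z \<le> 1"
  shows "tilt_bound s x v (u + z) \<le> 3 * tilt_bound s x v u"
proof -
  have "tilt_bound s x v (u + z) = exp (s * z) * tilt_bound s x v u"
    by (simp add: tilt_bound_def exp_add[symmetric] algebra_simps)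
  also have "\<dots> \<le> exp 1 * tilt_bound s x v u"
    using assms by (intro mult_right_mono tilt_bound_nonneg) auto
  also have "\<dots> \<le> 3 * tilt_bound s x v u"
    using assms exp_le by (intro mult_right_mono tilt_bound_nonneg) auto
  finally show ?thesis .
qed

text \<open>One crude majorant for the powers of v that occur. With \<open>v0\<close> a power of 1 /
  L it costs only powers of \<open>L\<close>, which exponential decay absorbs.\<close>

lemma inverse_powers_le:
  fixes v v0 :: real
  assumes "0 < v0" "v0 \<le> 1" "v0 \<le> v"
  shows "1 / sqrt v \<le> 1 / v0\<^sup>2" "1 / v \<le> 1 / v0\<^sup>2" "1 / (v * sqrt v) \<le> 1 / v0\<^sup>2" "1 / v\<^sup>2 \<le> 1 / v0\<^sup>2"
proof -
  have v0: "v0\<^sup>2 \<le> v0" using assms by (simp add: power2_eq_square mult_left_le)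
  have "v0 \<le> sqrt v0" using assms v0 by (intro real_le_rsqrt) auto
  also have "\<dots> \<le> sqrt v" using assms by simp
  finally have s: "v0 \<le> sqrt v" .
  show "1 / sqrt v \<le> 1 / v0\<^sup>2" using s v0 assms by (intro divide_left_mono mult_pos_pos) auto
  show "1 / v \<le> 1 / v0\<^sup>2" using v0 assms by (intro divide_left_mono mult_pos_pos) auto
  have "v0 * v0 \<le> v * sqrt v" using s assms by (intro mult_mono) auto
  then show "1 / (v * sqrt v) \<le> 1 / v0\<^sup>2" using assms unfolding power2_eq_square
    by (intro divide_left_mono mult_pos_pos) auto
  show "1 / v\<^sup>2 \<le> 1 / v0\<^sup>2" using assms by (intro divide_left_mono mult_pos_pos power_mono) auto
qed

text \<open>The remainder is measured by the q-th power since third moments may be infinite: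
  expansion to third order for \<bar>z\<bar> \<le> 1, where \<bar>z\<bar>^3 \<le> \<bar>z\<bar>^q,
  and to second order beyond, where z^2 \<le> \<bar>z\<bar>^q.\<close>

lemma smooth_ind_taylor:
  assumes v: "0 < v0" "v0 \<le> 1" "v0 \<le> v" and "0 \<le> s" "s * z \<le> 1" and q: "2 < q" "q \<le> 3"
  shows "\<bar>smooth_ind x v (u + z) - smooth_ind x v u - smooth_ind1 x v u * z - smooth_ind2 x v u * z\<^sup>2 / 2\<bar>
    \<le> 3 / v0\<^sup>2 * tilt_bound s x v u * \<bar>z\<bar> powr q" (is "\<bar>?R\<bar> \<le> _")
proof (cases "z = 0")
  case False
  have v0: "0 < v" using v by simp
  let ?tb = "tilt_bound s x v"
  define f3 where "f3 u = (((x - u) / sqrt v)\<^sup>2 - 1) * std_normal_density ((x - u) / sqrt v) / (v * sqrt v)" for u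
  define diff where "diff m = (if m = 0 then smooth_ind x v else if m = 1 then smooth_ind1 x v
    else if m = 2 then smooth_ind2 x v else f3)" for m :: nat
  have D: "DERIV (diff m) y :> diff (Suc m) y" if "m < 3" for m y
  proof -
    have "m = 0 \<or> m = 1 \<or> m = 2" using that by linarith
    then show ?thesis
      by (elim disjE) (auto simp: diff_def f3_def DERIV_smooth_ind[OF v0] DERIV_smooth_ind1[OF v0] DERIV_smooth_ind2[OF v0])
  qed
  \<comment> \<open>Intermediate points lie to the right of u by at most max z 0, so the tilt grows
    by at most exp 1 \<le> 3.\<close>
  have near: "?tb y \<le> 3 * ?tb u" if "if u + z < u then u + z < y \<and> y < u else u < y \<and> y < u + z" for y
  proof -
    have "s * (y - u) \<le> 1"
    proof (cases "z < 0")
      case True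
      then have "s * (y - u) \<le> 0" using that assms by (intro mult_nonneg_nonpos) auto
      then show ?thesis by simp
    next
      case False
      then have "s * (y - u) \<le> s * z" using that assms by (intro mult_left_mono) auto
      then show ?thesis using assms by simp
    qed
    then show ?thesis using tilt_bound_shift[of s v "y - u" x u] assms v0 by simp
  qed
  have tb0: "0 \<le> ?tb u" using assms v0 by (intro tilt_bound_nonneg) auto
  show ?thesis
  proof (cases "\<bar>z\<bar> \<le> 1")
    case True
    obtain y where y: "if u + z < u then u + z < y \<and> y < u else u < y \<and> y < u + z"
      "smooth_ind x v (u + z) = (\<Sum>m<3. diff m u / fact m * (u + z - u) ^ m) + diff 3 y / fact 3 * (u + z - u) ^ 3"
    proof -
      have "\<exists>y. (if u + z < u then u + z < y \<and> y < u else u < y \<and> y < u + z) \<and>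
        smooth_ind x v (u + z) = (\<Sum>m<3. diff m u / fact m * (u + z - u) ^ m) + diff 3 y / fact 3 * (u + z - u) ^ 3"
        using D False by (intro Taylor[of _ _ _ "u - \<bar>z\<bar>" "u + \<bar>z\<bar>"]) (auto simp: diff_def[of 0])
      then show ?thesis using that by blast
    qed
    have "\<bar>f3 y\<bar> \<le> ?tb y / (v * sqrt v)"
      unfolding f3_def using v0 assms by (intro smooth_ind2_deriv_bound)
    also have "\<dots> = ?tb y * (1 / (v * sqrt v))" by simp
    also have "\<dots> \<le> (3 * ?tb u) * (1 / v0\<^sup>2)"
      using near[OF y(1)] inverse_powers_le[OF v] tb0 v0 by (intro mult_mono) auto
    finally have f3: "\<bar>f3 y\<bar> \<le> 3 / v0\<^sup>2 * ?tb u" by simp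
    have z3: "\<bar>z\<bar> ^ 3 \<le> \<bar>z\<bar> powr q"
    proof -
      have "\<bar>z\<bar> ^ 3 = \<bar>z\<bar> powr 3" using False by (simp add: powr_numeral)
      also have "\<dots> \<le> \<bar>z\<bar> powr q" using False True assms by (intro powr_mono') auto
      finally show ?thesis .
    qed
    have "?R = f3 y / 6 * z ^ 3"
      using y(2) by (simp add: diff_def eval_nat_numeral)
    then have "\<bar>?R\<bar>
      = \<bar>f3 y / 6 * z ^ 3\<bar>" by (simp only:)
    also have "\<dots> = \<bar>f3 y\<bar> / 6 * \<bar>z\<bar> ^ 3" by (simp add: abs_mult power_abs)
    also have "\<dots> \<le> \<bar>f3 y\<bar> * \<bar>z\<bar> ^ 3" by (intro mult_right_mono) auto
    also have "\<dots> \<le> (3 / v0\<^sup>2 * ?tb u) * \<bar>z\<bar> powr q" using f3 z3 tb0 by (intro mult_mono) auto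
    finally show ?thesis .
  next
    case z1: False
    obtain y where y: "if u + z < u then u + z < y \<and> y < u else u < y \<and> y < u + z"
      "smooth_ind x v (u + z) = (\<Sum>m<2. diff m u / fact m * (u + z - u) ^ m) + diff 2 y / fact 2 * (u + z - u) ^ 2"
    proof -
      have "\<exists>y. (if u + z < u then u + z < y \<and> y < u else u < y \<and> y < u + z) \<and>
        smooth_ind x v (u + z) = (\<Sum>m<2. diff m u / fact m * (u + z - u) ^ m) + diff 2 y / fact 2 * (u + z - u) ^ 2"
        using D False by (intro Taylor[of _ _ _ "u - \<bar>z\<bar>" "u + \<bar>z\<bar>"]) (auto simp: diff_def[of 0])
      then show ?thesis using that by blast
    qed
    have "\<bar>smooth_ind2 x v y\<bar> \<le> ?tb y * (1 / v)"
      using smooth_ind2_bound[OF v0 \<open>0 \<le> s\<close>, of x y] by simp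
    also have "\<dots> \<le> (3 * ?tb u) * (1 / v0\<^sup>2)"
      using near[OF y(1)] inverse_powers_le[OF v] tb0 v0 by (intro mult_mono) auto
    finally have 1: "\<bar>smooth_ind2 x v y\<bar> \<le> 3 / v0\<^sup>2 * ?tb u" by simp
    have "\<bar>smooth_ind2 x v u\<bar> \<le> ?tb u * (1 / v)"
      using smooth_ind2_bound[OF v0 \<open>0 \<le> s\<close>, of x u] by simp
    also have "\<dots> \<le> (3 * ?tb u) * (1 / v0\<^sup>2)"
      using inverse_powers_le[OF v] tb0 v0 by (intro mult_mono) auto
    finally have 2: "\<bar>smooth_ind2 x v u\<bar> \<le> 3 / v0\<^sup>2 * ?tb u" by simp
    have z2: "z\<^sup>2 \<le> \<bar>z\<bar> powr q"
    proof -
      have "z\<^sup>2 = \<bar>z\<bar> powr 2" using False by (simp add: powr_numeral)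
      also have "\<dots> \<le> \<bar>z\<bar> powr q" using z1 assms by (intro powr_mono) auto
      finally show ?thesis .
    qed
    have "?R
      = (smooth_ind2 x v y - smooth_ind2 x v u) / 2 * z\<^sup>2"
      using y(2) by (simp add: diff_def eval_nat_numeral algebra_simps)
    then have "\<bar>?R\<bar>
      = \<bar>(smooth_ind2 x v y - smooth_ind2 x v u) / 2 * z\<^sup>2\<bar>" by (simp only:)
    also have "\<dots> = \<bar>smooth_ind2 x v y - smooth_ind2 x v u\<bar> / 2 * z\<^sup>2" by (simp add: abs_mult)
    also have "\<dots> \<le> (3 / v0\<^sup>2 * ?tb u) * \<bar>z\<bar> powr q" using 1 2 z2 tb0 by (intro mult_mono) auto
    finally show ?thesis .
  qed
qed simp

text \<open>Counterpart of the Taylor expansion for a Gaussian summand of variance \<open>d\<close>,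
  by two applications of the mean value theorem in the variance. Its first-order term has the shape
  of the quadratic term of \<open>smooth_ind_taylor\<close>, and the two are meant to
  cancel.\<close>

lemma smooth_ind_time_step:
  assumes v: "0 < v0" "v0 \<le> 1" "v0 \<le> v" and "0 \<le> s" "0 \<le> d"
  shows "\<bar>smooth_ind x (v + d) u - smooth_ind x v u - d * smooth_ind2 x v u / 2\<bar>
    \<le> d\<^sup>2 / v0\<^sup>2 * tilt_bound s x (v + d) u"
proof (cases "d = 0")
  case False
  then have d: "0 < d" using assms by simp
  have v0: "0 < v" using v by simp
  define g where "g v = (((x - u) / sqrt v) ^ 3 - 3 * ((x - u) / sqrt v)) * std_normal_density ((x - u) / sqrt v) / (2 * v\<^sup>2)" for v
  obtain v1 where v1: "v < v1" "v1 < v + d" "smooth_ind x (v + d) u - smooth_ind x v u = (v + d - v) * (smooth_ind2 x v1 u / 2)"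
  proof -
    have "\<exists>v1. v < v1 \<and> v1 < v + d \<and> smooth_ind x (v + d) u - smooth_ind x v u = (v + d - v) * (smooth_ind2 x v1 u / 2)"
      using d v0 by (intro MVT2 DERIV_smooth_ind_var) auto
    then show ?thesis using that by auto
  qed
  obtain v2 where v2: "v < v2" "v2 < v1" "smooth_ind2 x v1 u - smooth_ind2 x v u = (v1 - v) * g v2"
  proof -
    have "\<exists>v2. v < v2 \<and> v2 < v1 \<and> smooth_ind2 x v1 u - smooth_ind2 x v u = (v1 - v) * g v2"
      unfolding g_def using v1 v0 by (intro MVT2 DERIV_smooth_ind2_var) auto
    then show ?thesis using that by auto
  qed
  have "smooth_ind x (v + d) u - smooth_ind x v u - d * smooth_ind2 x v u / 2 = d / 2 * (smooth_ind2 x v1 u - smooth_ind2 x v u)"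
    using v1(3) by (simp add: algebra_simps)
  also have "\<dots> = d / 2 * (v1 - v) * g v2" using v2(3) by simp
  finally have "\<bar>smooth_ind x (v + d) u - smooth_ind x v u - d * smooth_ind2 x v u / 2\<bar> = \<bar>d / 2 * (v1 - v) * g v2\<bar>"
    by (simp only:)
  also have "\<dots> = d / 2 * (v1 - v) * \<bar>g v2\<bar>" using d v1 by (simp add: abs_mult)
  also have "\<dots> \<le> d * d * (1 / v0\<^sup>2 * tilt_bound s x (v + d) u)"
  proof (intro mult_mono)
    have "\<bar>g v2\<bar> \<le> tilt_bound s x v2 u / (2 * v2\<^sup>2)"
      unfolding g_def using v2 v0 assms by (intro smooth_ind2_var_deriv_bound) auto
    also have "\<dots> = 1 / 2 * (1 / v2\<^sup>2 * tilt_bound s x v2 u)" by simp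
    also have "\<dots> \<le> 1 * (1 / v0\<^sup>2 * tilt_bound s x (v + d) u)"
      using inverse_powers_le(4)[OF v(1,2), of v2] v v1 v2 assms
      by (intro mult_mono tilt_bound_mono_var mult_nonneg_nonneg tilt_bound_nonneg) auto
    finally show "\<bar>g v2\<bar> \<le> 1 / v0\<^sup>2 * tilt_bound s x (v + d) u" by simp
  qed (use d v1 in auto)
  finally show ?thesis by (simp add: power2_eq_square)
qed simp

section \<open>Lindeberg's exchange for truncated sums\<close>

context iid_standard_moments
begin

text \<open>One exchange: summand i is traded for an increase of the smoothing variance by
  \<open>(w i)\<^sup>2\<close>. The terms up to second order almost cancel; all that is left is of
  order \<open>w i powr q\<close> times the bound \<open>Q\<close> of the tilted
  expectation.\<close>

lemma lindeberg_step:
  assumes A: "finite A" "i \<notin> A" "\<And>j. j \<in> insert i A \<Longrightarrow> 0 < w j" "w i \<le> 1"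
    and v: "0 < v0" "v0 \<le> 1" "v0 \<le> v" and s: "0 < s" "0 < y" "y \<le> 1" "s * y \<le> 1"
    and tilt: "expectation (\<lambda>\<omega>. tilt_bound s x (v + (w i)\<^sup>2) (trunc_sum A w y \<omega>)) \<le> Q"
  shows "\<bar>expectation (\<lambda>\<omega>. smooth_ind x v (trunc_sum (insert i A) w y \<omega>)) -
    expectation (\<lambda>\<omega>. smooth_ind x (v + (w i)\<^sup>2) (trunc_sum A w y \<omega>))\<bar>
    \<le> (6 * absmom q + 1) * y powr (1 - q) / v0\<^sup>2 * Q * w i powr q"
proof -
  define W where "W \<omega> = trunc_sum A w y \<omega>" for \<omega>
  define Y where "Y \<omega> = min (w i * Z i \<omega>) y" for \<omega>
  define V where "V = v + (w i)\<^sup>2"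
  let ?tb = "\<lambda>\<omega>. tilt_bound s x V (W \<omega>)" and ?f1 = "\<lambda>\<omega>. smooth_ind1 x v (W \<omega>)"
    and ?f2 = "\<lambda>\<omega>. smooth_ind2 x v (W \<omega>)"
  have wi: "0 < w i" using A by simp
  have v0: "0 < v" "0 < V" "v \<le> V" using v by (auto simp: V_def add_pos_nonneg)
  have [measurable]: "W \<in> borel_measurable M" "Y \<in> borel_measurable M"
    unfolding W_def Y_def by measurable
  have ind: "indep_var borel Y borel W"
    unfolding W_def Y_def using indep_Z_sum[of A i "\<lambda>i z. min (w i * z) y"] A by simp
  have ind': "indep_var borel (\<lambda>\<omega>. f (Y \<omega>)) borel (\<lambda>\<omega>. g (W \<omega>))"
    if "f \<in> borel_measurable borel" "g \<in> borel_measurable borel" for f g :: "real \<Rightarrow> real"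
    using indep_var_compose[OF ind that] by (simp add: comp_def)
  have mult: "integrable M (\<lambda>\<omega>. f (Y \<omega>) * g (W \<omega>))"
    "expectation (\<lambda>\<omega>. f (Y \<omega>) * g (W \<omega>)) = expectation (\<lambda>\<omega>. f (Y \<omega>)) * expectation (\<lambda>\<omega>. g (W \<omega>))"
    if "f \<in> borel_measurable borel" "g \<in> borel_measurable borel"
      "integrable M (\<lambda>\<omega>. f (Y \<omega>))" "integrable M (\<lambda>\<omega>. g (W \<omega>))" for f g :: "real \<Rightarrow> real"
    using indep_var_integrable[OF ind'[OF that(1,2)] that(3,4)]
      indep_var_lebesgue_integral[OF ind'[OF that(1,2)] that(3,4)] by auto
  have tb_eq: "tilt_bound s x V u = (27 * (1 + s * sqrt V) ^ 3 * exp (s\<^sup>2 * V / 2 - s * x)) * exp (s * u)" for u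
    by (simp add: tilt_bound_def exp_add[symmetric] exp_diff algebra_simps)
  have [measurable]: "tilt_bound s x V \<in> borel_measurable borel"
    unfolding tilt_bound_def by measurable
  have "integrable M (\<lambda>\<omega>. exp (s * W \<omega>))"
    unfolding W_def using A s by (intro integrable_exp_sum_trunc) auto
  then have int_tb [simp]: "integrable M ?tb" by (simp add: tb_eq)
  have E_tb: "0 \<le> expectation ?tb" "expectation ?tb \<le> Q"
    using tilt s v0 by (auto simp: W_def V_def intro!: integral_nonneg_AE AE_I2 tilt_bound_nonneg)
  note int_Y [simp] = integrable_trunc[OF wi s(2), of i, folded Y_def]
  note mom = trunc_moments[OF wi s(2), of i, folded Y_def]
  have int_f: "integrable M (\<lambda>\<omega>. smooth_ind x v' (g \<omega>))" if [measurable]: "g \<in> borel_measurable M" for v' g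
    by (rule integrable_const_bound[where B = 1]) (auto simp: smooth_ind_def normal_tail_bounds)
  have b1: "\<bar>?f1 \<omega>\<bar> \<le> 1 / v0\<^sup>2 * ?tb \<omega>" for \<omega>
  proof -
    have "\<bar>?f1 \<omega>\<bar> \<le> 1 / sqrt v * tilt_bound s x v (W \<omega>)"
      using smooth_ind1_bound[OF v0(1), of s x "W \<omega>"] s by simp
    also have "\<dots> \<le> 1 / v0\<^sup>2 * ?tb \<omega>"
      using inverse_powers_le[OF v] s v0 by (intro mult_mono tilt_bound_mono_var tilt_bound_nonneg) auto
    finally show ?thesis .
  qed
  have b2: "\<bar>?f2 \<omega>\<bar> \<le> 1 / v0\<^sup>2 * ?tb \<omega>" for \<omega>
  proof -
    have "\<bar>?f2 \<omega>\<bar> \<le> 1 / v * tilt_bound s x v (W \<omega>)"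
      using smooth_ind2_bound[OF v0(1), of s x "W \<omega>"] s by simp
    also have "\<dots> \<le> 1 / v0\<^sup>2 * ?tb \<omega>"
      using inverse_powers_le[OF v] s v0 by (intro mult_mono tilt_bound_mono_var tilt_bound_nonneg) auto
    finally show ?thesis .
  qed
  have tb_nn: "0 \<le> ?tb \<omega>" for \<omega> using s v0 by (intro tilt_bound_nonneg) auto
  have int1 [simp]: "integrable M ?f1"
    by (rule Bochner_Integration.integrable_bound[of M "\<lambda>\<omega>. 1 / v0\<^sup>2 * ?tb \<omega>"])
      (use b1 tb_nn in auto)
  have int2 [simp]: "integrable M ?f2"
    by (rule Bochner_Integration.integrable_bound[of M "\<lambda>\<omega>. 1 / v0\<^sup>2 * ?tb \<omega>"])
      (use b2 tb_nn in auto)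
  have E1: "\<bar>expectation ?f1\<bar> \<le> 1 / v0\<^sup>2 * Q"
  proof -
    have "\<bar>expectation ?f1\<bar> \<le> expectation (\<lambda>\<omega>. 1 / v0\<^sup>2 * ?tb \<omega>)"
      using b1 by (intro order_trans[OF integral_abs_bound] integral_mono) auto
    also have "\<dots> \<le> 1 / v0\<^sup>2 * Q" using E_tb by (simp add: divide_right_mono)
    finally show ?thesis .
  qed
  have E2: "\<bar>expectation ?f2\<bar> \<le> 1 / v0\<^sup>2 * Q"
  proof -
    have "\<bar>expectation ?f2\<bar> \<le> expectation (\<lambda>\<omega>. 1 / v0\<^sup>2 * ?tb \<omega>)"
      using b2 by (intro order_trans[OF integral_abs_bound] integral_mono) auto
    also have "\<dots> \<le> 1 / v0\<^sup>2 * Q" using E_tb by (simp add: divide_right_mono)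
    finally show ?thesis .
  qed
  note m1 = mult[of "\<lambda>z. z" "smooth_ind1 x v", simplified]
  note m2 = mult[of "\<lambda>z. z\<^sup>2" "smooth_ind2 x v", simplified]
  note mq = mult[of "\<lambda>z. \<bar>z\<bar> powr q" "tilt_bound s x V", simplified]
  \<comment> \<open>\<open>R1\<close> and \<open>R2\<close> are the Taylor remainders of the summand
    and of the variance step. Independence of \<open>Y\<close> and \<open>W\<close> factorizes the
    main terms as well as the bound for \<open>R1\<close>.\<close>
  define R1 where "R1 \<omega> = smooth_ind x v (W \<omega> + Y \<omega>) - smooth_ind x v (W \<omega>)
    - Y \<omega> * ?f1 \<omega> - (Y \<omega>)\<^sup>2 * ?f2 \<omega> / 2" for \<omega>
  define R2 where "R2 \<omega> = smooth_ind x V (W \<omega>) - smooth_ind x v (W \<omega>)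
    - (w i)\<^sup>2 * ?f2 \<omega> / 2" for \<omega>
  have int_R: "integrable M R1" "integrable M R2"
    unfolding R1_def R2_def using m1 m2
    by (intro Bochner_Integration.integrable_diff int_f integrable_divide integrable_mult_right int2, measurable)+
  have ER1: "\<bar>expectation R1\<bar> \<le> 3 / v0\<^sup>2 * (w i powr q * absmom q) * Q"
  proof -
    have "\<bar>R1 \<omega>\<bar> \<le> 3 / v0\<^sup>2 * (\<bar>Y \<omega>\<bar> powr q * ?tb \<omega>)" for \<omega>
    proof -
      have "s * Y \<omega> \<le> s * y" using s by (intro mult_left_mono) (auto simp: Y_def)
      then have "s * Y \<omega> \<le> 1" using s by linarith
      then have "\<bar>smooth_ind x v (W \<omega> + Y \<omega>) - smooth_ind x v (W \<omega>) - ?f1 \<omega> * Y \<omega>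
        - ?f2 \<omega> * (Y \<omega>)\<^sup>2 / 2\<bar> \<le> 3 / v0\<^sup>2 * tilt_bound s x v (W \<omega>) * \<bar>Y \<omega>\<bar> powr q"
        using v s q by (intro smooth_ind_taylor) auto
      also have "\<dots> \<le> 3 / v0\<^sup>2 * ?tb \<omega> * \<bar>Y \<omega>\<bar> powr q"
        using s v0 by (intro mult_right_mono mult_left_mono tilt_bound_mono_var) auto
      finally show ?thesis by (simp add: R1_def mult_ac)
    qed
    then have "\<bar>expectation R1\<bar> \<le> expectation (\<lambda>\<omega>. 3 / v0\<^sup>2 * (\<bar>Y \<omega>\<bar> powr q * ?tb \<omega>))"
      using int_R mq by (intro order_trans[OF integral_abs_bound] integral_mono) auto
    also have "\<dots> = 3 / v0\<^sup>2 * (expectation (\<lambda>\<omega>. \<bar>Y \<omega>\<bar> powr q) * expectation ?tb)" using mq by simp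
    also have "\<dots> \<le> 3 / v0\<^sup>2 * ((w i powr q * absmom q) * Q)"
      using mom(3) E_tb absmom_nonneg by (intro mult_left_mono mult_mono) auto
    finally show ?thesis by (simp add: mult_ac)
  qed
  have ER2: "\<bar>expectation R2\<bar> \<le> 1 / v0\<^sup>2 * w i powr q * Q"
  proof -
    \<comment> \<open>The variance step has an error of fourth order in \<open>w i\<close>; with w i
      \<le> 1 and q \<le> 4 it fits under the q-th power.\<close>
    have "((w i)\<^sup>2)\<^sup>2 = w i powr 4" using wi by (simp add: powr_numeral)
    also have "\<dots> \<le> w i powr q" using wi A(4) q by (intro powr_mono') auto
    finally have w4: "((w i)\<^sup>2)\<^sup>2 \<le> w i powr q" .
    have "\<bar>R2 \<omega>\<bar> \<le> (w i powr q / v0\<^sup>2) * ?tb \<omega>" for \<omega>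
    proof -
      have "\<bar>R2 \<omega>\<bar> \<le> ((w i)\<^sup>2)\<^sup>2 / v0\<^sup>2 * ?tb \<omega>"
        unfolding R2_def V_def using v s by (intro smooth_ind_time_step) auto
      also have "\<dots> \<le> (w i powr q / v0\<^sup>2) * ?tb \<omega>"
        using w4 s v0 by (intro mult_right_mono divide_right_mono tilt_bound_nonneg) auto
      finally show ?thesis .
    qed
    then have "\<bar>expectation R2\<bar> \<le> expectation (\<lambda>\<omega>. (w i powr q / v0\<^sup>2) * ?tb \<omega>)"
      using int_R by (intro order_trans[OF integral_abs_bound] integral_mono) auto
    also have "\<dots> \<le> (w i powr q / v0\<^sup>2) * Q" using E_tb
      unfolding integral_mult_right_zero by (intro mult_left_mono) auto
    finally show ?thesis by simp
  qed
  have Q0: "0 \<le> Q" using E_tb by linarith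
  have y1: "1 \<le> y powr (1 - q)" "y powr (2 - q) \<le> y powr (1 - q)"
  proof -
    have "1 powr (1 - q) \<le> y powr (1 - q)" using s q by (intro powr_mono2') auto
    then show "1 \<le> y powr (1 - q)" by simp
    show "y powr (2 - q) \<le> y powr (1 - q)" using s by (intro powr_mono') auto
  qed
  define c where "c = w i powr q * Q / v0\<^sup>2"
  have c0: "0 \<le> c" using Q0 by (simp add: c_def)
  let ?m = "absmom q" and ?p = "y powr (1 - q)"
  have mean: "\<bar>expectation Y * expectation ?f1\<bar> \<le> ?m * ?p * c"
  proof -
    have "\<bar>expectation Y\<bar> \<le> w i powr q * ?m * ?p" using mom(1,4) by auto
    then have "\<bar>expectation Y\<bar> * \<bar>expectation ?f1\<bar> \<le> (w i powr q * ?m * ?p) * (1 / v0\<^sup>2 * Q)"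
      using E1 absmom_nonneg by (intro mult_mono) auto
    then show ?thesis by (simp add: abs_mult c_def mult_ac)
  qed
  have var: "\<bar>(expectation (\<lambda>\<omega>. (Y \<omega>)\<^sup>2) - (w i)\<^sup>2) / 2 * expectation ?f2\<bar> \<le> ?m * ?p * c"
  proof -
    have "w i powr q * ?m * y powr (2 - q) \<le> w i powr q * ?m * ?p"
      using y1 absmom_nonneg by (intro mult_left_mono) auto
    then have "\<bar>(expectation (\<lambda>\<omega>. (Y \<omega>)\<^sup>2) - (w i)\<^sup>2) / 2\<bar> \<le> w i powr q * ?m * ?p" using mom(2,5) by auto
    then have "\<bar>(expectation (\<lambda>\<omega>. (Y \<omega>)\<^sup>2) - (w i)\<^sup>2) / 2\<bar> * \<bar>expectation ?f2\<bar> \<le> (w i powr q * ?m * ?p) * (1 / v0\<^sup>2 * Q)"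
      using E2 absmom_nonneg by (intro mult_mono) auto
    then show ?thesis by (simp add: abs_mult c_def mult_ac)
  qed
  have "expectation R1 = expectation (\<lambda>\<omega>. smooth_ind x v (W \<omega> + Y \<omega>)) - expectation (\<lambda>\<omega>. smooth_ind x v (W \<omega>))
    - expectation Y * expectation ?f1
    - expectation (\<lambda>\<omega>. (Y \<omega>)\<^sup>2) * expectation ?f2 / 2"
    unfolding R1_def using m1 m2 int_f[of W] int_f[of "\<lambda>\<omega>. W \<omega> + Y \<omega>"] by simp
  moreover have "expectation R2 = expectation (\<lambda>\<omega>. smooth_ind x V (W \<omega>)) - expectation (\<lambda>\<omega>. smooth_ind x v (W \<omega>))
    - (w i)\<^sup>2 * expectation ?f2 / 2"
    unfolding R2_def using int_f[of W] by simp
  \<comment> \<open>Truncation may push the mean below 0 and the second moment below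
    \<open>(w i)\<^sup>2\<close>; the first two terms on the right are these defects.\<close>
  ultimately have "expectation (\<lambda>\<omega>. smooth_ind x v (W \<omega> + Y \<omega>)) - expectation (\<lambda>\<omega>. smooth_ind x V (W \<omega>)) =
    expectation Y * expectation ?f1
    + (expectation (\<lambda>\<omega>. (Y \<omega>)\<^sup>2) - (w i)\<^sup>2) / 2 * expectation ?f2
    + expectation R1 - expectation R2"
    by (simp add: algebra_simps add_divide_distrib diff_divide_distrib)
  moreover have "3 / v0\<^sup>2 * (w i powr q * ?m) * Q = 3 * ?m * c" "1 / v0\<^sup>2 * w i powr q * Q = c"
    by (auto simp: c_def)
  moreover have "3 * ?m * c \<le> 3 * ?m * ?p * c" "c \<le> ?p * c"
  proof -
    have "3 * ?m * c * 1 \<le> 3 * ?m * c * ?p" using y1 c0 absmom_nonneg by (intro mult_left_mono) auto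
    then show "3 * ?m * c \<le> 3 * ?m * ?p * c" by (simp add: mult_ac)
    show "c \<le> ?p * c" using mult_right_mono[OF y1(1) c0] by simp
  qed
  ultimately have "\<bar>expectation (\<lambda>\<omega>. smooth_ind x v (W \<omega> + Y \<omega>)) - expectation (\<lambda>\<omega>. smooth_ind x V (W \<omega>))\<bar>
    \<le> ?m * ?p * c + ?m * ?p * c + 3 * ?m * ?p * c + ?p * c"
    using mean var ER1 ER2 by linarith
  \<comment> \<open>The terms with \<open>?m\<close> have total weight 1 + 1 + 3, rounded up to
    6.\<close>
  also have "\<dots> \<le> 6 * ?m * ?p * c + ?p * c"
    using absmom_nonneg c0 y1(1) by (auto simp: mult_nonneg_nonneg)
  also have "\<dots> = (6 * ?m + 1) * ?p / v0\<^sup>2 * Q * w i powr q"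
    by (simp add: c_def algebra_simps add_divide_distrib)
  finally have "\<bar>expectation (\<lambda>\<omega>. smooth_ind x v (W \<omega> + Y \<omega>)) - expectation (\<lambda>\<omega>. smooth_ind x V (W \<omega>))\<bar>
    \<le> (6 * ?m + 1) * ?p / v0\<^sup>2 * Q * w i powr q" .
  moreover have "trunc_sum (insert i A) w y \<omega> = W \<omega> + Y \<omega>" for \<omega>
    using A by (simp add: W_def Y_def)
  ultimately show ?thesis by (simp add: V_def W_def)
qed

text \<open>Induction over the summands: \<open>v\<close> plus the variance still in the sum is
  always \<open>V\<close>, and with no summand left the Gaussian value remains. Smoothing
  contributes exp (s^2 v / 2) to a tilted expectation and the sum at most its Gaussian exponential
  moment times exp 1; the product is of order exp (s^2 V / 2 + 1) at every step.\<close>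

lemma lindeberg:
  assumes fin: "finite A" and w: "\<And>j. j \<in> A \<Longrightarrow> 0 < w j" "\<And>j. j \<in> A \<Longrightarrow> w j \<le> 1"
    and v0: "0 < v0" "v0 \<le> 1" and s: "0 < s" "0 < y" "y \<le> 1" "s * y \<le> 1"
    and err: "exp_error s y (\<Sum>j\<in>A. w j powr q) (\<Sum>j\<in>A. w j powr r) \<le> 1"
    and V: "V = v0 + (\<Sum>j\<in>A. (w j)\<^sup>2)"
  shows "\<bar>expectation (\<lambda>\<omega>. smooth_ind x v0 (trunc_sum A w y \<omega>)) - normal_tail (x / sqrt V)\<bar>
    \<le> (6 * absmom q + 1) * y powr (1 - q) / v0\<^sup>2 * (27 * (1 + s * sqrt V) ^ 3 * exp (s\<^sup>2 * V / 2 - s * x + 1))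
      * (\<Sum>j\<in>A. w j powr q)"
proof -
  define K where "K = (6 * absmom q + 1) * y powr (1 - q) / v0\<^sup>2 * (27 * (1 + s * sqrt V) ^ 3 * exp (s\<^sup>2 * V / 2 - s * x + 1))"
  have "B \<subseteq> A \<Longrightarrow> v0 \<le> v \<Longrightarrow> v + (\<Sum>j\<in>B. (w j)\<^sup>2) = V \<Longrightarrow>
    \<bar>expectation (\<lambda>\<omega>. smooth_ind x v (trunc_sum B w y \<omega>)) - normal_tail (x / sqrt V)\<bar>
      \<le> K * (\<Sum>j\<in>B. w j powr q)" if "finite B" for B v
    using that
  proof (induction B arbitrary: v)
    case empty
    then show ?case by (simp add: smooth_ind_def prob_space)
  next
    case (insert i B)
    have iB: "i \<in> A" "B \<subseteq> A" using insert by auto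
    have Veq: "v + (w i)\<^sup>2 + (\<Sum>j\<in>B. (w j)\<^sup>2) = V" using insert by simp
    have pos: "0 < v + (w i)\<^sup>2" using insert v0 by (simp add: add_pos_nonneg)
    have IH: "\<bar>expectation (\<lambda>\<omega>. smooth_ind x (v + (w i)\<^sup>2) (trunc_sum B w y \<omega>)) - normal_tail (x / sqrt V)\<bar>
      \<le> K * (\<Sum>j\<in>B. w j powr q)"
      using insert Veq by (intro insert.IH) (auto intro: add_increasing2)
    \<comment> \<open>Monotonicity in the power sums carries the hypothesis from \<open>A\<close> to
      each subset met in the induction.\<close>
    have "exp_error s y (\<Sum>j\<in>B. w j powr q) (\<Sum>j\<in>B. w j powr r) \<le> exp_error s y (\<Sum>j\<in>A. w j powr q) (\<Sum>j\<in>A. w j powr r)"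
      unfolding exp_error_def using iB fin absmom_nonneg posmom_nonneg
      by (intro add_mono mult_left_mono sum_mono2) auto
    then have e1: "exp_error s y (\<Sum>j\<in>B. w j powr q) (\<Sum>j\<in>B. w j powr r) \<le> 1" using err by simp
    have Eexp: "expectation (\<lambda>\<omega>. exp (s * trunc_sum B w y \<omega>)) \<le> exp (s\<^sup>2 / 2 * (\<Sum>j\<in>B. (w j)\<^sup>2) + 1)"
      using exp_moment_sum_trunc[of B w y s] insert.hyps iB w s e1
      by (intro order_trans[OF exp_moment_sum_trunc]) auto
    let ?c = "27 * (1 + s * sqrt (v + (w i)\<^sup>2)) ^ 3 * exp (s\<^sup>2 * (v + (w i)\<^sup>2) / 2 - s * x)"
    have tilt: "expectation (\<lambda>\<omega>. tilt_bound s x (v + (w i)\<^sup>2) (trunc_sum B w y \<omega>)) \<le>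
      27 * (1 + s * sqrt V) ^ 3 * exp (s\<^sup>2 * V / 2 - s * x + 1)"
    proof -
      have "tilt_bound s x (v + (w i)\<^sup>2) u = ?c * exp (s * u)" for u
        by (simp add: tilt_bound_def exp_add[symmetric] exp_diff algebra_simps)
      then have "expectation (\<lambda>\<omega>. tilt_bound s x (v + (w i)\<^sup>2) (trunc_sum B w y \<omega>)) =
        ?c * expectation (\<lambda>\<omega>. exp (s * trunc_sum B w y \<omega>))" by simp
      also have "\<dots> \<le> ?c * exp (s\<^sup>2 / 2 * (\<Sum>j\<in>B. (w j)\<^sup>2) + 1)"
        using Eexp s pos by (intro mult_left_mono) auto
      also have "\<dots> = 27 * (1 + s * sqrt (v + (w i)\<^sup>2)) ^ 3 * exp (s\<^sup>2 * V / 2 - s * x + 1)"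
        unfolding Veq[symmetric] by (simp add: exp_add[symmetric] algebra_simps add_divide_distrib)
      also have "\<dots> \<le> 27 * (1 + s * sqrt V) ^ 3 * exp (s\<^sup>2 * V / 2 - s * x + 1)"
      proof -
        have "v + (w i)\<^sup>2 \<le> V" unfolding Veq[symmetric] by (simp add: sum_nonneg)
        then show ?thesis using s pos
          by (intro mult_right_mono mult_left_mono power_mono add_left_mono) auto
      qed
      finally show ?thesis .
    qed
    have "\<bar>expectation (\<lambda>\<omega>. smooth_ind x v (trunc_sum (insert i B) w y \<omega>)) -
      expectation (\<lambda>\<omega>. smooth_ind x (v + (w i)\<^sup>2) (trunc_sum B w y \<omega>))\<bar> \<le> K * w i powr q"
      unfolding K_def using insert.hyps insert.prems w v0 s iB tilt by (intro lindeberg_step) auto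
    then show ?case using IH insert.hyps by (simp add: distrib_left abs_le_iff)
  qed
  from this[of A v0] show ?thesis using fin V by (simp add: K_def)
qed

end

section \<open>Comparing indicators with their smoothings\<close>

lemma indicator_le_smooth_ind:
  assumes "0 < v0"
  shows "indicator {x..} u * normal_tail (- \<delta> / sqrt v0) \<le> smooth_ind (x - \<delta>) v0 u"
proof (cases "x \<le> u")
  case True
  then have "(x - \<delta> - u) / sqrt v0 \<le> - \<delta> / sqrt v0" using assms by (intro divide_right_mono) auto
  then show ?thesis using True by (simp add: smooth_ind_def normal_tail_antimono)
next
  case False
  then show ?thesis by (simp add: smooth_ind_def normal_tail_bounds)
qed

text \<open>Left of \<open>x\<close>, at distance h, the exponent (h + \<delta>)^2 / (2 v0) contains
  the cross term h \<delta> / v0 \<ge> h s, so the excess carries the weight exp (s (u - x)) and is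
  controlled by the exponential moment of the sum. The condition sqrt v0 \<le> \<delta> allows the
  denominator in Mills' upper bound to be dropped.\<close>

lemma smooth_ind_le_indicator:
  assumes "0 < v0" "0 \<le> s" "s \<le> \<delta> / v0" "sqrt v0 \<le> \<delta>"
  shows "smooth_ind (x + \<delta>) v0 u \<le> indicator {x..} u + exp (- \<delta>\<^sup>2 / (2 * v0)) * exp (s * (u - x))"
proof (cases "x \<le> u")
  case True
  then show ?thesis
    using normal_tail_bounds by (simp add: smooth_ind_def add_increasing2)
next
  case False
  define h where "h = x - u"
  have h: "0 < h" using False by (simp add: h_def)
  let ?z = "(h + \<delta>) / sqrt v0"
  have "1 \<le> \<delta> / sqrt v0" using assms by simp
  also have "\<dots> \<le> ?z" using h assms by (intro divide_right_mono) auto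
  finally have z: "1 \<le> ?z" .
  have "1 / sqrt (2 * pi) \<le> 1" using pi_gt3 by (simp add: divide_simps)
  then have phi: "std_normal_density ?z \<le> 1 * exp (- ?z\<^sup>2 / 2)"
    unfolding std_normal_density_def by (intro mult_right_mono) auto
  have "normal_tail ?z \<le> std_normal_density ?z / ?z" using z by (intro normal_tail_le) auto
  also have "\<dots> \<le> std_normal_density ?z / 1"
    using z std_normal_density_pos[of ?z] by (intro divide_left_mono) auto
  also have "\<dots> \<le> exp (- ?z\<^sup>2 / 2)" using phi by simp
  also have "- ?z\<^sup>2 / 2 \<le> - \<delta>\<^sup>2 / (2 * v0) + s * (u - x)"
  proof -
    have "?z\<^sup>2 / 2 = h\<^sup>2 / (2 * v0) + h * (\<delta> / v0) + \<delta>\<^sup>2 / (2 * v0)"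
      using assms(1) by (simp add: power_divide power2_sum add_divide_distrib)
    moreover have "0 \<le> h\<^sup>2 / (2 * v0)" using assms by simp
    moreover have "h * s \<le> h * (\<delta> / v0)" using h assms by (intro mult_left_mono) auto
    ultimately have "h * s + \<delta>\<^sup>2 / (2 * v0) \<le> ?z\<^sup>2 / 2" by linarith
    then show ?thesis by (simp add: h_def algebra_simps)
  qed
  finally have "normal_tail ?z \<le> exp (- \<delta>\<^sup>2 / (2 * v0) + s * (u - x))" by simp
  moreover have z_eq: "x + \<delta> - u = h + \<delta>" by (simp add: h_def)
  ultimately have "smooth_ind (x + \<delta>) v0 u \<le> exp (- \<delta>\<^sup>2 / (2 * v0)) * exp (s * (u - x))"
    unfolding smooth_ind_def exp_add[symmetric] z_eq by simp
  then show ?thesis using False by simp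
qed

context iid_standard_moments
begin

text \<open>\<open>T\<close> pays for the truncation at \<open>y\<close>, \<open>R\<close> is Lindeberg's error, and the shift by \<open>\<delta>\<close> lets
  \<open>smooth_ind\<close> with variance \<open>v0\<close> bound the indicator of \<open>{x..}\<close> from both sides.\<close>
lemma normal_approximation:
  assumes fin: "finite A" and w: "\<And>j. j \<in> A \<Longrightarrow> 0 < w j" and w2: "(\<Sum>j\<in>A. (w j)\<^sup>2) = 1"
    and v0: "0 < v0" "v0 \<le> 1" and s: "0 < x" "0 < y" "y \<le> 1" "x * y \<le> 1"
    and err: "exp_error x y (\<Sum>j\<in>A. w j powr q) (\<Sum>j\<in>A. w j powr r) \<le> 1"
    and \<delta>: "0 < \<delta>" "\<delta> \<le> 1" "x \<le> \<delta> / v0" "sqrt v0 \<le> \<delta>" "x * \<delta> \<le> 1" "x\<^sup>2 * v0 \<le> 1"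
  defines "T \<equiv> posmom r * y powr - r * (\<Sum>j\<in>A. w j powr r)"
    and "R \<equiv> (6 * absmom q + 1) * y powr (1 - q) / v0\<^sup>2 * (27 * (1 + 2 * x) ^ 3 * exp (3 - x\<^sup>2 / 2))
      * (\<Sum>j\<in>A. w j powr q)"
  shows "prob {\<omega> \<in> space M. x \<le> (\<Sum>j\<in>A. w j * Z j \<omega>)} * normal_tail (- \<delta> / sqrt v0)
      \<le> normal_tail (x - (\<delta> + x * v0)) + R + T"
    and "normal_tail (x + \<delta>) - R - exp (- \<delta>\<^sup>2 / (2 * v0)) * exp (1 - x\<^sup>2 / 2) - T
      \<le> prob {\<omega> \<in> space M. x \<le> (\<Sum>j\<in>A. w j * Z j \<omega>)}"
proof -
  define S where "S \<omega> = (\<Sum>j\<in>A. w j * Z j \<omega>)" for \<omega>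
  define U where "U \<omega> = trunc_sum A w y \<omega>" for \<omega>
  have [measurable]: "S \<in> borel_measurable M" "U \<in> borel_measurable M" unfolding S_def U_def by measurable
  \<comment> \<open>Smoothing variance plus the unit variance of the sum.\<close>
  define V where "V = v0 + 1"
  have w1: "w j \<le> 1" if "j \<in> A" for j
  proof -
    have "(w j)\<^sup>2 \<le> (\<Sum>j\<in>A. (w j)\<^sup>2)" using fin that by (intro member_le_sum) auto
    then have "(w j)\<^sup>2 \<le> 1\<^sup>2" using w2 by simp
    then show ?thesis by (rule power2_le_imp_le) simp
  qed
  have lind: "\<bar>expectation (\<lambda>\<omega>. smooth_ind x' v0 (U \<omega>)) - normal_tail (x' / sqrt V)\<bar> \<le> R"
    if x': "x - \<delta> \<le> x'" for x'
  proof -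
    have sq: "sqrt V \<le> 2" using v0 by (intro real_le_lsqrt) (auto simp: V_def)
    \<comment> \<open>The tilt is s = x. Replacing x' by x costs at most x \<delta> \<le> 1, the
      smoothing costs x^2 v0 / 2 \<le> 1 / 2, and 1 comes from the exponential moment; the constant
      3 covers the total.\<close>
    have "x * x - x * \<delta> \<le> x * x'" using mult_left_mono[OF x', of x] s by (simp add: algebra_simps)
    moreover have "x\<^sup>2 * V / 2 = x\<^sup>2 * v0 / 2 + x\<^sup>2 / 2" by (simp add: V_def distrib_left add_divide_distrib)
    ultimately have "x\<^sup>2 * V / 2 - x * x' + 1 \<le> 3 - x\<^sup>2 / 2"
      using \<delta>(5,6) power2_eq_square[of x] by linarith
    moreover have "x * sqrt V \<le> 2 * x" using sq s by simp
    ultimately have e: "27 * (1 + x * sqrt V) ^ 3 * exp (x\<^sup>2 * V / 2 - x * x' + 1) \<le> 27 * (1 + 2 * x) ^ 3 * exp (3 - x\<^sup>2 / 2)"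
      using s v0 by (intro mult_mono power_mono mult_left_mono) (auto simp: V_def intro!: add_nonneg_nonneg)
    have "\<bar>expectation (\<lambda>\<omega>. smooth_ind x' v0 (U \<omega>)) - normal_tail (x' / sqrt V)\<bar>
      \<le> (6 * absmom q + 1) * y powr (1 - q) / v0\<^sup>2 * (27 * (1 + x * sqrt V) ^ 3 * exp (x\<^sup>2 * V / 2 - x * x' + 1))
      * (\<Sum>j\<in>A. w j powr q)"
      unfolding U_def using fin w w1 v0 s err w2 by (intro lindeberg) (auto simp: V_def)
    also have "\<dots> \<le> R"
      unfolding R_def using e absmom_nonneg by (intro mult_right_mono mult_left_mono sum_nonneg) auto
    finally show ?thesis .
  qed
  have trunc: "\<bar>prob {\<omega> \<in> space M. x \<le> S \<omega>} - prob {\<omega> \<in> space M. x \<le> U \<omega>}\<bar> \<le> T"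
  proof -
    \<comment> \<open>Contains the event that some summand exceeds \<open>y\<close>; written with
      r-th powers so that Markov's inequality applies directly.\<close>
    define B where "B = (\<Union>j\<in>A. {\<omega> \<in> space M. y powr r \<le> w j powr r * max (Z j \<omega>) 0 powr r})"
    have [measurable]: "B \<in> sets M" unfolding B_def using fin by (intro sets.finite_UN) auto
    have "prob B \<le> (\<Sum>j\<in>A. prob {\<omega> \<in> space M. y powr r \<le> w j powr r * max (Z j \<omega>) 0 powr r})"
      unfolding B_def using fin by (intro finite_measure_subadditive_finite) auto
    also have "\<dots> \<le> (\<Sum>j\<in>A. expectation (\<lambda>\<omega>. w j powr r * max (Z j \<omega>) 0 powr r) / y powr r)"
      using s by (intro sum_mono integral_Markov_inequality_measure[where A = "{}"]) auto
    also have "\<dots> = T"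
      by (simp add: T_def sum_distrib_left powr_minus divide_inverse mult_ac)
    finally have B: "prob B \<le> T" .
    have SU: "S \<omega> = U \<omega>" if "\<omega> \<in> space M" "\<omega> \<notin> B" for \<omega>
      unfolding S_def U_def
    proof (rule sum.cong[OF refl])
      fix j assume j: "j \<in> A"
      have "w j * Z j \<omega> \<le> y"
      proof (rule ccontr)
        assume "\<not> w j * Z j \<omega> \<le> y"
        then have "y < w j * Z j \<omega>" by simp
        also have "\<dots> \<le> w j * max (Z j \<omega>) 0" using w[OF j] by (intro mult_left_mono) auto
        finally have "y powr r \<le> (w j * max (Z j \<omega>) 0) powr r" using s r by (intro powr_mono2) auto
        then have "y powr r \<le> w j powr r * max (Z j \<omega>) 0 powr r" using w[OF j] by (simp add: powr_mult)
        then show False using that j by (auto simp: B_def)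
      qed
      then show "w j * Z j \<omega> = min (w j * Z j \<omega>) y" by simp
    qed
    have "prob {\<omega> \<in> space M. x \<le> S \<omega>} \<le> prob ({\<omega> \<in> space M. x \<le> U \<omega>} \<union> B)"
      using SU by (intro finite_measure_mono) auto
    also have "\<dots> \<le> prob {\<omega> \<in> space M. x \<le> U \<omega>} + prob B" by (intro measure_Un_le) auto
    finally have 1: "prob {\<omega> \<in> space M. x \<le> S \<omega>} \<le> prob {\<omega> \<in> space M. x \<le> U \<omega>} + prob B" .
    have "prob {\<omega> \<in> space M. x \<le> U \<omega>} \<le> prob ({\<omega> \<in> space M. x \<le> S \<omega>} \<union> B)"
      using SU by (intro finite_measure_mono) auto
    also have "\<dots> \<le> prob {\<omega> \<in> space M. x \<le> S \<omega>} + prob B" by (intro measure_Un_le) auto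
    finally show ?thesis using 1 B by simp
  qed
  have int_f: "integrable M (\<lambda>\<omega>. smooth_ind x' v0 (U \<omega>))" for x'
    by (rule integrable_const_bound[where B = 1]) (auto simp: smooth_ind_def normal_tail_bounds)
  have ind_eq: "prob {\<omega> \<in> space M. x \<le> U \<omega>} = expectation (\<lambda>\<omega>. indicator {x..} (U \<omega>))"
  proof -
    have "expectation (\<lambda>\<omega>. indicator {x..} (U \<omega>)) = expectation (indicator {\<omega> \<in> space M. x \<le> U \<omega>} :: 'a \<Rightarrow> real)"
      by (intro Bochner_Integration.integral_cong) (auto simp: indicator_def)
    then show ?thesis by simp
  qed
  have int_ind: "integrable M (\<lambda>\<omega>. indicator {x..} (U \<omega>) :: real)"
    by (rule integrable_const_bound[where B = 1]) auto
  have V1: "1 \<le> sqrt V" "sqrt V \<le> 1 + v0"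
    using v0 by (auto simp: V_def power2_eq_square algebra_simps intro!: real_le_lsqrt)
  have "prob {\<omega> \<in> space M. x \<le> U \<omega>} * normal_tail (- \<delta> / sqrt v0) = expectation (\<lambda>\<omega>. indicator {x..} (U \<omega>) * normal_tail (- \<delta> / sqrt v0))"
    by (simp add: ind_eq)
  also have "\<dots> \<le> expectation (\<lambda>\<omega>. smooth_ind (x - \<delta>) v0 (U \<omega>))"
    using indicator_le_smooth_ind[OF v0(1)] int_f int_ind by (intro integral_mono) auto
  also have "\<dots> \<le> normal_tail ((x - \<delta>) / sqrt V) + R" using lind[of "x - \<delta>"] by simp
  also have "normal_tail ((x - \<delta>) / sqrt V) \<le> normal_tail (x - (\<delta> + x * v0))"
  proof (rule normal_tail_antimono)
    show "x - (\<delta> + x * v0) \<le> (x - \<delta>) / sqrt V"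
    \<comment> \<open>Dividing by sqrt V, which lies between 1 and 1 + v0, moves x - \<delta>
      towards 0: to the left by at most x v0 if \<delta> \<le> x, to the right otherwise.\<close>
    proof (cases "\<delta> \<le> x")
      case True
      have "x - (\<delta> + x * v0) \<le> (x - \<delta>) * (1 - v0)"
        using \<delta> v0 by (simp add: algebra_simps)
      also have "\<dots> \<le> (x - \<delta>) * (1 / (1 + v0))"
        using True v0 by (intro mult_left_mono) (auto simp: field_simps)
      also have "\<dots> \<le> (x - \<delta>) * (1 / sqrt V)"
        using True V1 v0 by (intro mult_left_mono divide_left_mono mult_pos_pos) auto
      finally show ?thesis by simp
    next
      case False
      have "(\<delta> - x) / sqrt V \<le> (\<delta> - x) / 1" using False V1 by (intro divide_left_mono) auto
      moreover have "0 \<le> x * v0" using s v0 by simp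
      ultimately show ?thesis by (simp add: diff_divide_distrib)
    qed
  qed
  finally have up: "prob {\<omega> \<in> space M. x \<le> U \<omega>} * normal_tail (- \<delta> / sqrt v0) \<le> normal_tail (x - (\<delta> + x * v0)) + R"
    by simp
  have T0: "0 \<le> T" unfolding T_def using posmom_nonneg by (intro mult_nonneg_nonneg sum_nonneg) auto
  have "prob {\<omega> \<in> space M. x \<le> S \<omega>} * normal_tail (- \<delta> / sqrt v0) \<le>
    (prob {\<omega> \<in> space M. x \<le> U \<omega>} + T) * normal_tail (- \<delta> / sqrt v0)"
    using trunc normal_tail_bounds by (intro mult_right_mono) auto
  also have "\<dots> \<le> normal_tail (x - (\<delta> + x * v0)) + R + T"
    using up mult_left_mono[OF normal_tail_bounds(2)[of "- \<delta> / sqrt v0"] T0] by (simp add: distrib_right)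
  finally show "prob {\<omega> \<in> space M. x \<le> (\<Sum>j\<in>A. w j * Z j \<omega>)} * normal_tail (- \<delta> / sqrt v0)
      \<le> normal_tail (x - (\<delta> + x * v0)) + R + T" by (simp add: S_def)
  have int_e: "integrable M (\<lambda>\<omega>. exp (x * U \<omega>))"
    unfolding U_def using fin w s by (intro integrable_exp_sum_trunc) auto
  have Ee: "expectation (\<lambda>\<omega>. exp (x * U \<omega>)) \<le> exp (x\<^sup>2 / 2 + 1)"
    unfolding U_def using exp_moment_sum_trunc[of A w y x, OF fin w s(2,1)] err w2
    by (intro order_trans[OF exp_moment_sum_trunc[of A w y x, OF fin w s(2,1)]]) auto
  let ?g = "exp (- \<delta>\<^sup>2 / (2 * v0))"
  have ex: "exp (x * (u - x)) = exp (- x\<^sup>2) * exp (x * u)" for u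
    by (simp add: exp_add[symmetric] power2_eq_square algebra_simps)
  have "normal_tail (x + \<delta>) \<le> normal_tail ((x + \<delta>) / sqrt V)"
  proof (rule normal_tail_antimono)
    have "(x + \<delta>) / sqrt V \<le> (x + \<delta>) / 1" using V1 s \<delta> by (intro divide_left_mono) auto
    then show "(x + \<delta>) / sqrt V \<le> x + \<delta>" by simp
  qed
  also have "\<dots> \<le> expectation (\<lambda>\<omega>. smooth_ind (x + \<delta>) v0 (U \<omega>)) + R"
    using lind[of "x + \<delta>"] \<delta> by simp
  also have "expectation (\<lambda>\<omega>. smooth_ind (x + \<delta>) v0 (U \<omega>)) \<le>
    expectation (\<lambda>\<omega>. indicator {x..} (U \<omega>) + ?g * (exp (- x\<^sup>2) * exp (x * U \<omega>)))"
  proof (intro integral_mono int_f)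
    show "integrable M (\<lambda>\<omega>. indicator {x..} (U \<omega>) + ?g * (exp (- x\<^sup>2) * exp (x * U \<omega>)))"
      using int_ind int_e by simp
    show "smooth_ind (x + \<delta>) v0 (U \<omega>) \<le> indicator {x..} (U \<omega>) + ?g * (exp (- x\<^sup>2) * exp (x * U \<omega>))" for \<omega>
      using smooth_ind_le_indicator[OF v0(1) less_imp_le[OF s(1)] \<delta>(3,4), of x "U \<omega>"] by (simp only: ex)
  qed
  also have "\<dots> = prob {\<omega> \<in> space M. x \<le> U \<omega>} + ?g * (exp (- x\<^sup>2) * expectation (\<lambda>\<omega>. exp (x * U \<omega>)))"
    using int_ind int_e by (simp add: ind_eq)
  also have "\<dots> \<le> prob {\<omega> \<in> space M. x \<le> U \<omega>} + ?g * (exp (- x\<^sup>2) * exp (x\<^sup>2 / 2 + 1))"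
    using Ee by (intro add_left_mono mult_left_mono) auto
  also have "exp (- x\<^sup>2) * exp (x\<^sup>2 / 2 + 1) = exp (1 - x\<^sup>2 / 2)"
    by (simp add: exp_add[symmetric])
  finally have "normal_tail (x + \<delta>) \<le> prob {\<omega> \<in> space M. x \<le> U \<omega>} + ?g * exp (1 - x\<^sup>2 / 2) + R" by simp
  then show "normal_tail (x + \<delta>) - R - exp (- \<delta>\<^sup>2 / (2 * v0)) * exp (1 - x\<^sup>2 / 2) - T
      \<le> prob {\<omega> \<in> space M. x \<le> (\<Sum>j\<in>A. w j * Z j \<omega>)}"
    using trunc by (simp add: S_def)
qed

end

section \<open>Normal approximation uniformly over unit weights\<close>

context iid_regular_tail
begin

lemma moderate_deviations:
  assumes "0 < b" "b < sqrt 2" "0 < \<epsilon>"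
  shows "\<exists>L0. \<forall>A w x. unit_weights A w \<longrightarrow> L0 \<le> log_D A w \<longrightarrow> 0 < x \<longrightarrow> x \<le> b * sqrt (log_D A w) \<longrightarrow>
    \<bar>sum_prob A w x - normal_tail x\<bar> \<le> \<epsilon> * normal_tail x"
proof -
  have b2: "b\<^sup>2 < 2"
  proof -
    have "b\<^sup>2 < (sqrt 2)\<^sup>2" using assms by (intro power_strict_mono) auto
    then show ?thesis by simp
  qed
  \<comment> \<open>Midway between b^2 / 2 and 1: above b^2 / 2 the truncation cost of order exp (-
    \<kappa>r L) is negligible against exp (- x^2 / 2); below 1 the exponent \<open>r\<close> stays
    below \<open>t\<close>.\<close>
  define \<kappa>r where "\<kappa>r = (1 + b\<^sup>2 / 2) / 2"
  define r where "r = 2 + (t - 2) * \<kappa>r"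
  define \<kappa>q where "\<kappa>q = (q - 2) / (t - 2)"
  have t2: "0 < t - 2" using t_gt_2 by simp
  have \<kappa>r: "b\<^sup>2 / 2 < \<kappa>r" "\<kappa>r < 1" "0 < \<kappa>r" using b2 by (auto simp: \<kappa>r_def add_pos_nonneg)
  have rt: "2 < r" "r < t" "(r - 2) / (t - 2) = \<kappa>r"
  proof -
    have "(t - 2) * \<kappa>r < (t - 2) * 1" using t2 \<kappa>r by (intro mult_strict_left_mono) auto
    then show "r < t" by (simp add: r_def)
  qed (use t2 \<kappa>r in \<open>auto simp: r_def\<close>)
  have \<kappa>q: "0 < \<kappa>q" using q_gt by (simp add: \<kappa>q_def)
  interpret iid_standard_moments M Z q r by (rule moments_locale[OF rt(1,2)])
  define m where "m = 6 * absmom q + 1"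
  define P where "P = posmom r"
  have mP: "0 \<le> m" "0 \<le> P" by (auto simp: m_def P_def absmom_nonneg posmom_nonneg)
  define CR where "CR = m * (27 * 8 * exp 3) * 3"
  define CX where "CX = exp r * absmom q"
  have CC: "0 \<le> CR" "0 \<le> CX" using mP absmom_nonneg by (auto simp: CR_def CX_def)
  \<comment> \<open>Relative errors: \<open>e1\<close> for shifting the Gaussian tail,
    \<open>e2\<close> for Lindeberg's exchange, \<open>e3\<close> for truncation, \<open>e4\<close>
    for smoothing the indicator; \<open>e5\<close> bounds \<open>exp_error\<close>.\<close>
  define e1 where "e1 L = (2 / L) * (1 + b * sqrt L) * exp (b * sqrt L * (2 / L))" for L
  \<comment> \<open>The 11 collects - 1 from \<open>y powr (1 - q)\<close>, 8 from
    \<open>1 / v0\<^sup>2\<close>, 3 from the cubic factor and 1 from Mills' bound.\<close>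
  define e2 where "e2 L = CR * L powr (q + 11) * exp (- \<kappa>q * L)" for L
  define e3 where "e3 L = P * 3 * L powr (r + 1) * exp (- (\<kappa>r - b\<^sup>2 / 2) * L)" for L
  define e4 where "e4 L = 9 * L * exp (- L\<^sup>2 / 2)" for L :: real
  define e5 where "e5 L = CX * L powr q * exp (- \<kappa>q * L) + P * 3 * L powr r * exp (- \<kappa>r * L)" for L
  \<comment> \<open>Leaves room for the division by 1 - e: for such e, (1 + 3 e) / (1 - e) \<le> 1 +
    8 e.\<close>
  define e where "e = min \<epsilon> 1 / 8"
  have e: "0 < e" "8 * e \<le> \<epsilon>" "e \<le> 1 / 8" using assms by (auto simp: e_def)
  have lim: "((\<lambda>L. C * L powr f * exp (- k * L)) \<longlongrightarrow> 0) at_top" if "0 < k" for C f k :: real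
    using that by real_asymp
  have "(e1 \<longlongrightarrow> 0) at_top" unfolding e1_def using assms(1) by real_asymp
  moreover have "(e2 \<longlongrightarrow> 0) at_top" unfolding e2_def by (rule lim[OF \<kappa>q])
  moreover have "(e3 \<longlongrightarrow> 0) at_top" unfolding e3_def using \<kappa>r by (intro lim) auto
  moreover have "(e4 \<longlongrightarrow> 0) at_top" unfolding e4_def by real_asymp
  moreover have "(e5 \<longlongrightarrow> 0 + 0) at_top" unfolding e5_def by (intro tendsto_add lim \<kappa>q \<kappa>r)
  ultimately have "\<forall>\<^sub>F L in at_top. e1 L < e" "\<forall>\<^sub>F L in at_top. e2 L < e" "\<forall>\<^sub>F L in at_top. e3 L < e"
    "\<forall>\<^sub>F L in at_top. e4 L < e" "\<forall>\<^sub>F L in at_top. e5 L < 1"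
    using e(1) by (auto intro: order_tendstoD)
  moreover have "\<forall>\<^sub>F L in at_top. 1 - e < normal_tail (- L)"
  proof (rule order_tendstoD)
    show "((\<lambda>L. normal_tail (- L)) \<longlongrightarrow> 1) at_top"
      by (rule filterlim_compose[OF normal_tail_tendsto_at_bot filterlim_uminus_at_bot_at_top])
  qed (use e in simp)
  moreover have "\<forall>\<^sub>F L in at_top. 1 + b * sqrt L \<le> L" by real_asymp
  ultimately have "\<forall>\<^sub>F L in at_top. e1 L < e \<and> e2 L < e \<and> e3 L < e \<and> e4 L < e \<and> e5 L < 1 \<and>
    1 - e < normal_tail (- L) \<and> 1 + b * sqrt L \<le> L"
    by eventually_elim auto
  then obtain L1 where L1: "\<And>L. L1 \<le> L \<Longrightarrow> e1 L < e \<and> e2 L < e \<and> e3 L < e \<and> e4 L < e \<and> e5 L < 1 \<and>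
    1 - e < normal_tail (- L) \<and> 1 + b * sqrt L \<le> L"
    unfolding eventually_at_top_linorder by blast
  show ?thesis
  proof (intro exI[of _ "max L1 1"] allI impI)
    fix A w x assume w: "unit_weights A w" and L0: "max L1 1 \<le> log_D A w" and x: "0 < x" "x \<le> b * sqrt (log_D A w)"
    define L where "L = log_D A w"
    have L: "1 \<le> L" "L1 \<le> L" using L0 by (auto simp: L_def)
    note eL = L1[OF L(2)]
    have xb: "x \<le> b * sqrt L" using x by (simp add: L_def)
    have xL: "1 + x \<le> L" "x \<le> L" using xb eL by auto
    note wD = unit_weightsD[OF w]
    let ?Dq = "\<Sum>i\<in>A. w i powr q" and ?Dr = "\<Sum>i\<in>A. w i powr r"
    have Dq: "?Dq \<le> exp (- \<kappa>q * L)"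
      using sum_powr_le[OF w, of q] q_gt by (simp add: \<kappa>q_def L_def)
    have Dr: "?Dr \<le> exp (- \<kappa>r * L)"
    proof -
      have "?Dr \<le> exp (- ((r - 2) / (t - 2)) * log_D A w)"
        using rt(1,2) by (intro sum_powr_le[OF w]) auto
      then show ?thesis unfolding rt(3) L_def .
    qed
    \<comment> \<open>Serves as truncation level and as shift \<open>\<delta>\<close>. It is small
      against 1 / (1 + x), as x is at most of order sqrt L, so the shift changes
      \<open>normal_tail\<close> by a factor near 1; its inverse powers cost only powers of
      \<open>L\<close>.\<close>
    define y where "y = 1 / L"
    \<comment> \<open>Now sqrt v0 = 1 / L^2 is smaller than the shift by the factor
      \<open>L\<close>, so the defects of smoothing become \<open>normal_tail (- L)\<close>, close
      to 1, and exp (- L^2 / 2).\<close>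
    define v0 where "v0 = 1 / L ^ 4"
    have y: "0 < y" "y \<le> 1" "x * y \<le> 1" using L xL by (auto simp: y_def field_simps)
    have v0: "0 < v0" "v0 \<le> 1" "sqrt v0 = 1 / L\<^sup>2"
    proof -
      have "1 \<le> L ^ 4" using L by simp
      then show "0 < v0" "v0 \<le> 1" using L by (auto simp: v0_def divide_le_eq)
      have "sqrt (L ^ 4) = L\<^sup>2" by (rule real_sqrt_unique) auto
      then show "sqrt v0 = 1 / L\<^sup>2" by (simp add: v0_def real_sqrt_divide)
    qed
    have pow: "L \<le> L\<^sup>2" "L \<le> L ^ 3" "L\<^sup>2 \<le> L ^ 4"
      using L power_increasing[of 1 2 L] power_increasing[of 1 3 L] power_increasing[of 2 4 L] by auto
    have y_powr: "y powr - f = L powr f" for f using L by (simp add: y_def powr_divide powr_minus_divide)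
    have err: "exp_error x y ?Dq ?Dr \<le> 1"
    proof -
      have "exp r * absmom q * x powr q * ?Dq \<le> CX * L powr q * exp (- \<kappa>q * L)"
        unfolding CX_def[symmetric] using x xL Dq CC q_gt L
        by (intro mult_mono powr_mono2 mult_nonneg_nonneg sum_nonneg) auto
      moreover have "posmom r * exp (x * y) * y powr - r * ?Dr \<le> P * 3 * L powr r * exp (- \<kappa>r * L)"
      proof -
        have "exp (x * y) \<le> exp 1" using y by simp
        then have "exp (x * y) \<le> 3" using exp_le by linarith
        then show ?thesis unfolding P_def[symmetric] y_powr using Dr mP
          by (intro mult_mono mult_nonneg_nonneg sum_nonneg) auto
      qed
      ultimately show ?thesis using eL by (simp add: exp_error_def e5_def)
    qed
    have \<delta>: "0 < y" "y \<le> 1" "x \<le> y / v0" "sqrt v0 \<le> y" "x * y \<le> 1" "x\<^sup>2 * v0 \<le> 1"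
    proof -
      have "y / v0 = L ^ 3" using L by (simp add: y_def v0_def eval_nat_numeral)
      then show "x \<le> y / v0" using xL pow by simp
      show "sqrt v0 \<le> y" unfolding v0 y_def using pow L by (intro divide_left_mono) auto
      have "x\<^sup>2 \<le> L\<^sup>2" using x xL by (intro power_mono) auto
      then have "x\<^sup>2 \<le> L ^ 4" using pow by simp
      then show "x\<^sup>2 * v0 \<le> 1" using L by (simp add: v0_def)
    qed (use y in auto)
    define T where "T = posmom r * y powr - r * ?Dr"
    define R where "R = (6 * absmom q + 1) * y powr (1 - q) / v0\<^sup>2 * (27 * (1 + 2 * x) ^ 3 * exp (3 - x\<^sup>2 / 2)) * ?Dq"
    let ?\<Psi> = "normal_tail x"
    let ?p = "sum_prob A w x"
    have \<Psi>0: "0 \<le> ?\<Psi>" by (rule normal_tail_bounds)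
    \<comment> \<open>Mills' lower bound with sqrt (2 pi) \<le> 3 and 1 + x \<le> L; each error with
      factor exp (- x^2 / 2) becomes a relative one at the cost of a power of
      \<open>L\<close>.\<close>
    have gauss: "exp (- x\<^sup>2 / 2) \<le> 3 * L * ?\<Psi>"
    proof -
      have "sqrt (2 * pi) \<le> 3" using pi_less_4 by (intro real_le_lsqrt) auto
      have "std_normal_density x / (1 + x) \<le> ?\<Psi>" using x by (intro normal_tail_ge) auto
      then have "std_normal_density x \<le> (1 + x) * ?\<Psi>" using x by (simp add: divide_simps mult.commute)
      then have "sqrt (2 * pi) * std_normal_density x \<le> sqrt (2 * pi) * ((1 + x) * ?\<Psi>)"
        by (intro mult_left_mono) auto
      also have "\<dots> \<le> 3 * (L * ?\<Psi>)"
        using \<open>sqrt (2 * pi) \<le> 3\<close> xL x \<Psi>0 by (intro mult_mono mult_right_mono mult_nonneg_nonneg) auto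
      finally show ?thesis by (simp add: std_normal_density_def)
    qed
    have Rb: "R \<le> e * ?\<Psi>"
    proof -
      have yq: "y powr (1 - q) / v0\<^sup>2 = L powr (q + 7)"
      proof -
        have "y powr (1 - q) = L powr (q - 1)" using y_powr[of "q - 1"] by simp
        moreover have "1 / v0\<^sup>2 = L powr 8" using L by (simp add: v0_def power_divide powr_numeral)
        ultimately have "y powr (1 - q) / v0\<^sup>2 = L powr (q - 1) * L powr 8"
          by (metis times_divide_eq_right mult_1_right)
        then show ?thesis by (simp add: powr_add[symmetric] add.commute)
      qed
      have x3: "(1 + 2 * x) ^ 3 \<le> 8 * L powr 3"
      proof -
        have "(1 + 2 * x) ^ 3 \<le> (2 * L) ^ 3" using xL x by (intro power_mono) auto
        then show ?thesis using L by (simp add: power_mult_distrib powr_numeral)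
      qed
      have "exp (3 - x\<^sup>2 / 2) = exp 3 * exp (- x\<^sup>2 / 2)" by (simp add: exp_add[symmetric])
      also have "\<dots> \<le> exp 3 * (3 * L * ?\<Psi>)" using gauss by (intro mult_left_mono) auto
      finally have ex: "exp (3 - x\<^sup>2 / 2) \<le> exp 3 * (3 * L * ?\<Psi>)" .
      have "R = m * L powr (q + 7) * (27 * (1 + 2 * x) ^ 3 * exp (3 - x\<^sup>2 / 2)) * ?Dq"
        unfolding R_def m_def yq[symmetric] by simp
      also have "\<dots> \<le> m * L powr (q + 7) * (27 * (8 * L powr 3) * (exp 3 * (3 * L * ?\<Psi>))) * exp (- \<kappa>q * L)"
        using x3 ex Dq mP L x \<Psi>0 by (intro mult_mono mult_left_mono mult_nonneg_nonneg sum_nonneg) auto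
      also have "\<dots> = CR * (L powr (q + 7) * L powr 3 * L powr 1) * exp (- \<kappa>q * L) * ?\<Psi>"
        using L by (simp add: CR_def mult_ac)
      also have "L powr (q + 7) * L powr 3 * L powr 1 = L powr (q + 11)"
      proof -
        have "q + 11 = q + 7 + 3 + 1" by simp
        then show ?thesis by (simp only: powr_add)
      qed
      also have "CR * L powr (q + 11) * exp (- \<kappa>q * L) * ?\<Psi> = e2 L * ?\<Psi>" by (simp add: e2_def)
      also have "\<dots> \<le> e * ?\<Psi>" using eL \<Psi>0 by (intro mult_right_mono) auto
      finally show ?thesis .
    qed
    \<comment> \<open>Here x \<le> b sqrt L is decisive: a part exp (- b^2 L / 2) of the decay is
      spent on reaching exp (- x^2 / 2), and a positive rate \<kappa>r - b^2 / 2 remains.\<close>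
    have Tb: "T \<le> e * ?\<Psi>"
    proof -
      have "x\<^sup>2 \<le> (b * sqrt L)\<^sup>2" using x xb by (intro power_mono) auto
      then have "- b\<^sup>2 / 2 * L \<le> - x\<^sup>2 / 2" using L by (simp add: power_mult_distrib)
      then have "exp (- b\<^sup>2 / 2 * L) \<le> exp (- x\<^sup>2 / 2)" by simp
      then have g: "exp (- b\<^sup>2 / 2 * L) \<le> 3 * L * ?\<Psi>" using gauss by linarith
      have "T \<le> P * L powr r * exp (- \<kappa>r * L)"
        unfolding T_def y_powr P_def[symmetric] using Dr mP by (intro mult_left_mono) auto
      also have "exp (- \<kappa>r * L) = exp (- (\<kappa>r - b\<^sup>2 / 2) * L) * exp (- b\<^sup>2 / 2 * L)"
        by (simp add: exp_add[symmetric] algebra_simps)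
      also have "P * L powr r * (exp (- (\<kappa>r - b\<^sup>2 / 2) * L) * exp (- b\<^sup>2 / 2 * L)) \<le>
        P * L powr r * (exp (- (\<kappa>r - b\<^sup>2 / 2) * L) * (3 * L * ?\<Psi>))"
        using g mP by (intro mult_left_mono) auto
      also have "\<dots> = P * 3 * (L powr r * L powr 1) * exp (- (\<kappa>r - b\<^sup>2 / 2) * L) * ?\<Psi>"
        using L by (simp add: mult_ac)
      also have "\<dots> = e3 L * ?\<Psi>" by (simp only: e3_def powr_add[symmetric])
      also have "\<dots> \<le> e * ?\<Psi>" using eL \<Psi>0 by (intro mult_right_mono) auto
      finally show ?thesis .
    qed
    have Gb: "exp (- y\<^sup>2 / (2 * v0)) * exp (1 - x\<^sup>2 / 2) \<le> e * ?\<Psi>"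
    proof -
      have eq: "- y\<^sup>2 / (2 * v0) = - L\<^sup>2 / 2"
        using L by (simp add: y_def v0_def power_divide eval_nat_numeral)
      have "exp (1 - x\<^sup>2 / 2) \<le> 3 * (3 * L * ?\<Psi>)"
      proof -
        have "exp (1 - x\<^sup>2 / 2) = exp 1 * exp (- x\<^sup>2 / 2)" by (simp add: exp_add[symmetric])
        also have "\<dots> \<le> 3 * (3 * L * ?\<Psi>)" using gauss exp_le by (intro mult_mono) auto
        finally show ?thesis .
      qed
      then have "exp (- y\<^sup>2 / (2 * v0)) * exp (1 - x\<^sup>2 / 2) \<le> exp (- L\<^sup>2 / 2) * (3 * (3 * L * ?\<Psi>))"
        unfolding eq by (intro mult_left_mono) auto
      also have "\<dots> = e4 L * ?\<Psi>" by (simp add: e4_def)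
      also have "\<dots> \<le> e * ?\<Psi>" using eL \<Psi>0 by (intro mult_right_mono) auto
      finally show ?thesis .
    qed
    define h where "h = y + x * v0"
    have h: "0 \<le> h" "h \<le> 2 / L"
    proof -
      show "0 \<le> h" using y v0 x by (simp add: h_def)
      have "x * v0 \<le> L ^ 3 * v0" using xL pow v0 by (intro mult_right_mono) auto
      also have "\<dots> = 1 / L" using L by (simp add: v0_def eval_nat_numeral)
      finally show "h \<le> 2 / L" by (simp add: h_def y_def)
    qed
    have left: "normal_tail (x - h) \<le> (1 + e) * ?\<Psi>"
    proof -
      have "h * (1 + x) * exp (x * h) \<le> (2 / L) * (1 + b * sqrt L) * exp (b * sqrt L * (2 / L))"
      proof (intro mult_mono)
        have "x * h \<le> b * sqrt L * (2 / L)" using h xb x L assms(1) by (intro mult_mono) auto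
        then show "exp (x * h) \<le> exp (b * sqrt L * (2 / L))" by (simp only: exp_le_cancel_iff)
      qed (use h xb x L assms(1) in auto)
      then have "h * (1 + x) * exp (x * h) \<le> e" using eL by (simp add: e1_def)
      then have "(1 + h * (1 + x) * exp (x * h)) * ?\<Psi> \<le> (1 + e) * ?\<Psi>"
        using \<Psi>0 by (intro mult_right_mono) auto
      then show ?thesis using normal_tail_shift_left[OF x(1) h(1)] by linarith
    qed
    have right: "(1 - e) * ?\<Psi> \<le> normal_tail (x + y)"
    proof -
      have "y * (1 + x) * 1 \<le> (2 / L) * (1 + b * sqrt L) * exp (b * sqrt L * (2 / L))"
        using xb x L assms(1) by (intro mult_mono) (auto simp: y_def intro!: divide_right_mono)
      then have "y * (1 + x) \<le> e" using eL by (simp add: e1_def)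
      then have "(1 - e) * ?\<Psi> \<le> (1 - y * (1 + x)) * ?\<Psi>" using \<Psi>0 by (intro mult_right_mono) auto
      then show ?thesis using normal_tail_shift_right[OF x(1), of y] y by linarith
    qed
    note approx = normal_approximation[of A w v0 x y, OF wD(1,2,3) v0(1,2) x(1) y err \<delta>, folded T_def R_def h_def]
    have "?p * (1 - e) \<le> ?p * normal_tail (- y / sqrt v0)"
    proof (rule mult_left_mono)
      have "- y / sqrt v0 = - L" unfolding v0 using L by (simp add: y_def power2_eq_square)
      then show "1 - e \<le> normal_tail (- y / sqrt v0)" using eL by simp
    qed simp
    also have "\<dots> \<le> (1 + e) * ?\<Psi> + e * ?\<Psi> + e * ?\<Psi>" using approx(1) left Rb Tb by linarith
    finally have "?p * (1 - e) \<le> (1 + 3 * e) * ?\<Psi>" by (simp add: algebra_simps)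
    also have "\<dots> \<le> ((1 + 8 * e) * (1 - e)) * ?\<Psi>"
    proof (rule mult_right_mono[OF _ \<Psi>0])
      have "0 \<le> e * (4 - 8 * e)" using e by (intro mult_nonneg_nonneg) auto
      then show "1 + 3 * e \<le> (1 + 8 * e) * (1 - e)" by (simp add: algebra_simps)
    qed
    also have "\<dots> = ((1 + 8 * e) * ?\<Psi>) * (1 - e)" by (simp only: mult_ac)
    finally have "?p \<le> (1 + 8 * e) * ?\<Psi>" using e by (subst (asm) mult_le_cancel_right_pos) auto
    moreover have "(1 - 4 * e) * ?\<Psi> \<le> ?p"
      using approx(2) right Rb Tb Gb by (simp add: left_diff_distrib)
    moreover have "0 \<le> e * ?\<Psi>" using e \<Psi>0 by simp
    ultimately have "\<bar>?p - ?\<Psi>\<bar> \<le> (8 * e) * ?\<Psi>"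
      by (simp add: abs_le_iff distrib_right left_diff_distrib)
    also have "\<dots> \<le> \<epsilon> * ?\<Psi>" using e \<Psi>0 by (intro mult_right_mono) auto
    finally show "\<bar>?p - ?\<Psi>\<bar> \<le> \<epsilon> * ?\<Psi>" .
  qed
qed

end

section \<open>Reduction to unit weights\<close>

lemma slowly_varying_tail_ratio:
  assumes "slowly_varying h" "eventually (\<lambda>x. F x = h x / x powr t) at_top" "0 < l"
  shows "((\<lambda>x. F (l * x) / F x) \<longlongrightarrow> l powr - t) at_top"
proof (rule Lim_transform_eventually)
  have "((\<lambda>x. h (l * x) / h x * l powr - t) \<longlongrightarrow> 1 * l powr - t) at_top"
    using assms(1,3) unfolding slowly_varying_def by (intro tendsto_mult tendsto_const) blast
  then show "((\<lambda>x. h (l * x) / h x * l powr - t) \<longlongrightarrow> l powr - t) at_top" by simp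
  have "filterlim (\<lambda>x. l * x) at_top at_top"
    using assms(3) by (intro filterlim_tendsto_pos_mult_at_top[OF tendsto_const] filterlim_ident)
  then have "\<forall>\<^sub>F x in at_top. F (l * x) = h (l * x) / (l * x) powr t"
    by (rule eventually_compose_filterlim[OF assms(2)])
  then show "\<forall>\<^sub>F x in at_top. h (l * x) / h x * l powr - t = F (l * x) / F x"
    using assms(2) eventually_gt_at_top[of 0]
  proof eventually_elim
    case (elim x)
    \<comment> \<open>Where \<open>h x = 0\<close>, both sides are 0 by the convention on division
      by zero.\<close>
    show ?case unfolding elim(1,2)
      using assms(3) elim(3) by (cases "h x = 0") (auto simp: powr_mult powr_minus divide_simps)
  qed
qed

text \<open>The slowly varying factor is eliminated here. Positivity holds at every point because a
  monotone tail that is positive far out is positive everywhere; the scale \<open>s\<close> provides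
  for standardization.\<close>

lemma regular_tail_of_slowly_varying:
  fixes X :: "'a \<Rightarrow> real"
  assumes "prob_space M" and [measurable]: "X \<in> borel_measurable M"
    and h: "slowly_varying h"
    and F: "eventually (\<lambda>x. measure M {\<omega> \<in> space M. x \<le> X \<omega>} = h x / x powr t) at_top"
    and "2 < t" "0 < s"
  shows "regular_tail (\<lambda>u. measure M {\<omega> \<in> space M. u \<le> X \<omega> / s}) t"
proof -
  interpret prob_space M by fact
  define F where "F x = prob {\<omega> \<in> space M. x \<le> X \<omega>}" for x
  have anti: "F y \<le> F x" if "x \<le> y" for x y
    unfolding F_def using that by (intro finite_measure_mono) auto
  have eq: "prob {\<omega> \<in> space M. u \<le> X \<omega> / s} = F (s * u)" for u
    using assms(6) by (simp add: F_def pos_le_divide_eq mult.commute)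
  have F': "eventually (\<lambda>x. F x = h x / x powr t) at_top" using F by (simp add: F_def)
  have lim: "filterlim (\<lambda>u. s * u) at_top at_top"
    using assms(6) by (intro filterlim_tendsto_pos_mult_at_top[OF tendsto_const] filterlim_ident)
  show ?thesis unfolding eq
  proof
    show "F (s * y) \<le> F (s * x)" if "x \<le> y" for x y using that assms(6) by (intro anti) auto
    have "\<forall>\<^sub>F x in at_top. 0 < F x"
      using F' h[unfolded slowly_varying_def, THEN conjunct2, THEN conjunct1] eventually_gt_at_top[of 0]
      by eventually_elim auto
    then obtain N where N: "\<And>x. N \<le> x \<Longrightarrow> 0 < F x" unfolding eventually_at_top_linorder by blast
    show "0 < F (s * x)" for x using N[of "max N (s * x)"] anti[of "s * x" "max N (s * x)"] by simp
    show "((\<lambda>x. F (s * (l * x)) / F (s * x)) \<longlongrightarrow> l powr - t) at_top" if "0 < l" for l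
      using filterlim_compose[OF slowly_varying_tail_ratio[OF h F' that] lim] by (simp add: mult.left_commute)
  qed fact
qed

text \<open>Passes from variables indexed by the integers to the subfamily used in the sums. Events
  indexed by J are read as events indexed by the image of J, with \<open>inv f\<close> undoing the
  renaming.\<close>

lemma (in prob_space) indep_vars_reindex:
  assumes "inj f" "indep_vars M' X UNIV"
  shows "indep_vars (\<lambda>i. M' (f i)) (\<lambda>i. X (f i)) UNIV"
proof -
  let ?F = "\<lambda>i. sigma_sets (space M) {X i -` A \<inter> space M |A. A \<in> sets (M' i)}"
  have X: "\<forall>i. random_variable (M' i) (X i)" and ind: "indep_sets ?F UNIV"
    using assms(2) by (auto simp: indep_vars_def)
  have "indep_sets (\<lambda>i. ?F (f i)) UNIV"
  proof (rule indep_setsI)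
    show "?F (f i) \<subseteq> events" for i using ind by (auto simp: indep_sets_def)
    fix A J assume J: "J \<noteq> {}" "finite J" and A: "\<forall>j\<in>J. A j \<in> ?F (f j)"
    have inv: "inv f (f j) = j" for j using assms(1) by simp
    have "prob (\<Inter>i\<in>f ` J. A (inv f i)) = (\<Prod>i\<in>f ` J. prob (A (inv f i)))"
      using J A by (intro indep_setsD[OF ind]) (auto simp: inv)
    then show "prob (\<Inter>j\<in>J. A j) = (\<Prod>j\<in>J. prob (A j))"
      using assms(1) by (simp add: image_image inv prod.reindex inj_on_subset[of f UNIV])
  qed
  then show ?thesis using X by (simp add: indep_vars_def)
qed

text \<open>The quotient P n / N n - 1 packs the eventual bounds for all accuracies into one error
  sequence; positivity of N from n = 1 on makes the identity exact at early indices as well.\<close>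

lemma relative_error_exists:
  fixes P N :: "nat \<Rightarrow> real"
  assumes "\<And>n. 1 \<le> n \<Longrightarrow> 0 < N n"
    and "\<And>\<epsilon>. 0 < \<epsilon> \<Longrightarrow> \<forall>\<^sub>F n in sequentially. \<bar>P n - N n\<bar> \<le> \<epsilon> * N n"
  shows "\<exists>\<epsilon>. \<epsilon> \<longlonglongrightarrow> 0 \<and> (\<forall>n\<ge>1. P n = (1 + \<epsilon> n) * N n)"
proof (intro exI conjI allI impI)
  let ?e = "\<lambda>n. P n / N n - 1"
  show "P n = (1 + ?e n) * N n" if "1 \<le> n" for n using assms(1)[OF that] by simp
  show "?e \<longlonglongrightarrow> 0"
  proof (rule tendstoI)
    fix \<epsilon> :: real assume "0 < \<epsilon>"
    \<comment> \<open>Half the accuracy, to end with a strict inequality.\<close>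
    then have "\<forall>\<^sub>F n in sequentially. \<bar>P n - N n\<bar> \<le> \<epsilon> / 2 * N n" by (intro assms(2)) simp
    then show "\<forall>\<^sub>F n in sequentially. dist (?e n) 0 < \<epsilon>"
      using eventually_ge_at_top[of 1]
    proof eventually_elim
      case (elim n)
      have N: "0 < N n" using assms(1) elim by simp
      have "\<bar>?e n\<bar> = \<bar>P n - N n\<bar> / N n" using N by (simp add: diff_divide_distrib[symmetric] field_simps abs_divide)
      also have "\<dots> \<le> \<epsilon> / 2" using elim N by (simp add: divide_le_eq)
      finally show ?case using \<open>0 < \<epsilon>\<close> by (simp add: dist_real_def)
    qed
  qed
qed

theorem corollary2p1:
  fixes M :: "'a measure"
    and \<xi> :: "int \<Rightarrow> 'a \<Rightarrow> real"
    and h :: "real \<Rightarrow> real"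
    and t p :: real
    and k :: "nat \<Rightarrow> nat"
    and c :: "nat \<Rightarrow> nat \<Rightarrow> real"
  assumes "prob_space M"
    and "prob_space.indep_vars M (\<lambda>_. borel) \<xi> UNIV"
    and "\<And>i. distr M borel (\<xi> i) = distr M borel (\<xi> 0)"
    and "integrable M (\<xi> 0)"
    and "prob_space.expectation M (\<xi> 0) = 0"
    and "integrable M (\<lambda>\<omega>. (\<xi> 0 \<omega>)\<^sup>2)"
    and "t > 2"
    and "slowly_varying h"
    and "eventually (\<lambda>x. measure M {\<omega> \<in> space M. \<xi> 0 \<omega> \<ge> x} = h x / x powr t) at_top"
    and "p > 2"
    and "integrable M (\<lambda>\<omega>. \<bar>\<xi> 0 \<omega>\<bar> powr p)"
    and "\<And>n. n \<ge> 1 \<Longrightarrow> k n \<ge> 1"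
    and "\<And>n i. n \<ge> 1 \<Longrightarrow> 1 \<le> i \<Longrightarrow> i \<le> k n \<Longrightarrow> c n i > 0"
    and "(\<lambda>n. Max ((\<lambda>i. (c n i)\<^sup>2 / var_sum M \<xi> c k n) ` {1..k n})) \<longlonglongrightarrow> 0"
  shows
    "(\<forall>(a::real) (x::nat \<Rightarrow> real).
        a > sqrt 2 \<longrightarrow>
        (\<forall>n\<ge>1. x n \<ge> a * sqrt (ln (inverse (D_ratio c k t n)))) \<longrightarrow>
        (\<exists>\<epsilon>::nat \<Rightarrow> real. \<epsilon> \<longlonglongrightarrow> 0 \<and>
          (\<forall>n\<ge>1.
             measure M {\<omega> \<in> space M. weighted_sum \<xi> c k n \<omega> \<ge> x n * sd_sum M \<xi> c k n} =
             (1 + \<epsilon> n) *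
             (\<Sum>i = 1..k n. measure M {\<omega> \<in> space M. c n i * \<xi> 0 \<omega> \<ge> x n * sd_sum M \<xi> c k n})))) \<and>
     (\<forall>(b::real) (x::nat \<Rightarrow> real).
        b < sqrt 2 \<longrightarrow>
        (\<forall>n\<ge>1. 0 < x n \<and> x n \<le> b * sqrt (ln (inverse (D_ratio c k t n)))) \<longrightarrow>
        (\<exists>\<epsilon>::nat \<Rightarrow> real. \<epsilon> \<longlonglongrightarrow> 0 \<and>
          (\<forall>n\<ge>1.
             measure M {\<omega> \<in> space M. weighted_sum \<xi> c k n \<omega> \<ge> x n * sd_sum M \<xi> c k n} =
             (1 - cdf std_normal_distribution (x n)) * (1 + \<epsilon> n))))"
proof -
  interpret prob_space M by fact
  note indep = assms(2) and ident = assms(3)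
  have meas [measurable]: "\<xi> i \<in> borel_measurable M" for i
    using indep by (auto simp: indep_vars_def)
  define F where "F x = prob {\<omega> \<in> space M. x \<le> \<xi> 0 \<omega>}" for x
  define \<sigma> where "\<sigma> = sqrt (expectation (\<lambda>\<omega>. (\<xi> 0 \<omega>)\<^sup>2))"
  have \<sigma>: "0 < \<sigma>"
  proof -
    \<comment> \<open>A zero second moment would make \<xi> 0 vanish almost surely, whereas the
      right tail is positive at 1. The division by 1 matches the scaled form of the tail
      lemma.\<close>
    have "expectation (\<lambda>\<omega>. (\<xi> 0 \<omega>)\<^sup>2) \<noteq> 0"
    proof
      assume "expectation (\<lambda>\<omega>. (\<xi> 0 \<omega>)\<^sup>2) = 0"
      then have "AE \<omega> in M. (\<xi> 0 \<omega>)\<^sup>2 = 0"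
        using integral_nonneg_eq_0_iff_AE[OF assms(6)] by simp
      then have "AE \<omega> in M. \<not> 1 \<le> \<xi> 0 \<omega> / 1" by eventually_elim auto
      then have "prob {\<omega> \<in> space M. 1 \<le> \<xi> 0 \<omega> / 1} = 0"
        by (subst prob_eq_0) auto
      moreover have "0 < prob {\<omega> \<in> space M. 1 \<le> \<xi> 0 \<omega> / 1}"
        using regular_tail.G_pos[OF regular_tail_of_slowly_varying[OF assms(1) meas assms(8,9,7), of 1]] by simp
      ultimately show False by simp
    qed
    then show ?thesis by (simp add: \<sigma>_def less_le)
  qed
  have \<sigma>2: "\<sigma>\<^sup>2 = expectation (\<lambda>\<omega>. (\<xi> 0 \<omega>)\<^sup>2)" by (simp add: \<sigma>_def)
  define Z where "Z i \<omega> = \<xi> (int i) \<omega> / \<sigma>" for i \<omega>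
  \<comment> \<open>At most 3 for the Taylor estimates, at most \<open>p\<close> for integrability,
    and at most the midpoint of 2 and \<open>t\<close> to stay strictly below
    \<open>t\<close>.\<close>
  define q where "q = min (min p 3) ((2 + t) / 2)"
  have "q \<le> (2 + t) / 2" unfolding q_def by (rule min.cobounded2)
  then have q: "2 < q" "q \<le> 3" "q < t" "q \<le> p" using assms(7,10) by (auto simp: q_def)
  have int_q: "integrable M (\<lambda>\<omega>. \<bar>Z 0 \<omega>\<bar> powr q)"
  proof (rule Bochner_Integration.integrable_bound)
    show "integrable M (\<lambda>\<omega>. (1 + \<bar>\<xi> 0 \<omega>\<bar> powr p) / \<sigma> powr q)" using assms(11) by simp
    show "AE \<omega> in M. norm (\<bar>Z 0 \<omega>\<bar> powr q) \<le> norm ((1 + \<bar>\<xi> 0 \<omega>\<bar> powr p) / \<sigma> powr q)"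
    proof (rule AE_I2)
      fix \<omega>
      have "\<bar>\<xi> 0 \<omega>\<bar> powr q \<le> 1 + \<bar>\<xi> 0 \<omega>\<bar> powr p"
      proof (cases "1 \<le> \<bar>\<xi> 0 \<omega>\<bar>")
        case True
        then have "\<bar>\<xi> 0 \<omega>\<bar> powr q \<le> \<bar>\<xi> 0 \<omega>\<bar> powr p" using q by (intro powr_mono) auto
        then show ?thesis by simp
      next
        case False
        then have "\<bar>\<xi> 0 \<omega>\<bar> powr q \<le> 1" using q by (intro powr_le1) auto
        then show ?thesis by (simp add: add_increasing2)
      qed
      then show "norm (\<bar>Z 0 \<omega>\<bar> powr q) \<le> norm ((1 + \<bar>\<xi> 0 \<omega>\<bar> powr p) / \<sigma> powr q)"
        using \<sigma> by (simp add: Z_def powr_divide divide_right_mono abs_of_nonneg)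
    qed
  qed (simp add: Z_def)
  have indep_nat: "indep_vars (\<lambda>_. borel) (\<lambda>i. \<xi> (int i)) UNIV"
    by (rule indep_vars_reindex[OF inj_of_nat indep])
  have distr_scaled: "distr M borel (Z i) = distr (distr M borel (\<xi> (int i))) borel (\<lambda>x. x / \<sigma>)" for i
    by (subst distr_distr) (auto simp: comp_def Z_def[abs_def])
  have standard: "iid_standard M Z"
  proof
    show "indep_vars (\<lambda>_. borel) Z UNIV"
      using indep_vars_compose2[OF indep_nat, of "\<lambda>_ x. x / \<sigma>" "\<lambda>_. borel"] by (simp add: Z_def[abs_def])
    show "distr M borel (Z i) = distr M borel (Z 0)" for i
      unfolding distr_scaled using ident[of "int i"] by simp
    show "integrable M (\<lambda>\<omega>. (Z 0 \<omega>)\<^sup>2)" using assms(6) by (simp add: Z_def power_divide)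
    show "expectation (Z 0) = 0" using assms(5) by (simp add: Z_def[abs_def])
    show "expectation (\<lambda>\<omega>. (Z 0 \<omega>)\<^sup>2) = 1"
      using \<sigma> by (simp add: Z_def power_divide \<sigma>2[symmetric])
  qed
  have "regular_tail (\<lambda>u. prob {\<omega> \<in> space M. u \<le> Z 0 \<omega>}) t"
    using regular_tail_of_slowly_varying[OF assms(1) meas assms(8,9,7) \<sigma>] by (simp add: Z_def)
  then interpret iid_regular_tail M Z q t
    using standard q int_q by (intro iid_regular_tail.intro iid_regular_tail_axioms.intro)
  define C where "C n = sqrt (\<Sum>i = 1..k n. (c n i)\<^sup>2)" for n
  define w where "w n i = c n i / C n" for n i
  define A where "A n = {1..k n}" for n
  have C: "0 < C n" if "1 \<le> n" for n
  proof -
    have "0 < (\<Sum>i = 1..k n. (c n i)\<^sup>2)"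
    proof (rule sum_pos)
      show "0 < (c n i)\<^sup>2" if "i \<in> {1..k n}" for i using assms(13)[OF \<open>1 \<le> n\<close>, of i] that by simp
    qed (use assms(12)[OF that] in auto)
    then show ?thesis by (simp add: C_def)
  qed
  have C2: "(C n)\<^sup>2 = (\<Sum>i = 1..k n. (c n i)\<^sup>2)" for n by (simp add: C_def sum_nonneg)
  have wpos: "0 < w n i" if "1 \<le> n" "i \<in> A n" for n i
    using assms(13)[of n i] C[OF that(1)] that by (simp add: w_def A_def)
  have unit: "unit_weights (A n) (w n)" if n: "1 \<le> n" for n
  proof -
    have "(\<Sum>i\<in>A n. (w n i)\<^sup>2) = (C n)\<^sup>2 / (C n)\<^sup>2"
      unfolding C2 by (simp add: w_def A_def power_divide sum_divide_distrib[symmetric] C2)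
    then show ?thesis
      unfolding unit_weights_def using wpos[OF n] C[OF n] by (auto simp: A_def)
  qed
  have ws: "weighted_sum \<xi> c k n \<omega> = \<sigma> * C n * (\<Sum>i\<in>A n. w n i * Z i \<omega>)" if "1 \<le> n" for n \<omega>
    using C[OF that] \<sigma> by (simp add: weighted_sum_def A_def w_def Z_def sum_distrib_left)
  have var: "var_sum M \<xi> c k n = (\<sigma> * C n)\<^sup>2" if n: "1 \<le> n" for n
  proof -
    have fun_eq: "weighted_sum \<xi> c k n = (\<lambda>\<omega>. \<sigma> * C n * (\<Sum>i\<in>A n. w n i * Z i \<omega>))" using ws[OF n] by auto
    have "expectation (\<lambda>\<omega>. \<sigma> * C n * (\<Sum>i\<in>A n. w n i * Z i \<omega>)) = 0" by simp
    moreover have "expectation (\<lambda>\<omega>. (\<Sum>i\<in>A n. w n i * Z i \<omega>)\<^sup>2) = 1"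
      using unit[OF n] by (simp add: second_moment_weighted_sum unit_weights_def)
    ultimately show ?thesis unfolding var_sum_def fun_eq by (simp add: power_mult_distrib)
  qed
  have sd: "sd_sum M \<xi> c k n = \<sigma> * C n" if "1 \<le> n" for n
    using var[OF that] \<sigma> C[OF that] by (simp add: sd_sum_def)
  \<comment> \<open>\<open>D_ratio\<close> is invariant under scaling of the coefficients, so
    normalizing to unit weights leaves it unchanged.\<close>
  have D: "D_ratio c k t n = (\<Sum>i\<in>A n. w n i powr t)" if n: "1 \<le> n" for n
  proof -
    have "(\<Sum>i = 1..k n. (c n i)\<^sup>2) powr (- t / 2) = C n powr - t"
      using C[OF n] unfolding C2[symmetric] by (simp add: powr_numeral[symmetric] powr_powr del: powr_numeral)
    moreover have "w n i powr t = C n powr - t * c n i powr t" if "i \<in> A n" for i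
      using C[OF n] assms(13)[OF n, of i] that by (simp add: w_def A_def powr_divide powr_minus field_simps)
    ultimately show ?thesis by (simp add: D_ratio_def A_def sum_distrib_left)
  qed
  define L where "L n = log_D (A n) (w n)" for n
  have L_eq: "ln (inverse (D_ratio c k t n)) = L n" if "1 \<le> n" for n
    using D[OF that] by (simp add: L_def log_D_def)
  have L_lim: "filterlim L at_top sequentially"
    unfolding filterlim_at_top
  proof
    fix K :: real
    \<comment> \<open>Then \<eta>^(t - 2) = exp (- \<bar>K\<bar>). Once all normalized weights are
      at most \<open>\<eta>\<close>, their t-th power sum is at most \<eta>^(t - 2) times the sum of
      squares, which is 1.\<close>
    define \<eta> where "\<eta> = exp (- \<bar>K\<bar> / (t - 2))"
    have \<eta>: "0 < \<eta>" by (simp add: \<eta>_def)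
    have "\<forall>\<^sub>F n in sequentially. Max ((\<lambda>i. (c n i)\<^sup>2 / var_sum M \<xi> c k n) ` {1..k n}) < \<eta>\<^sup>2 / \<sigma>\<^sup>2"
      using order_tendstoD(2)[OF assms(14)] \<eta> \<sigma> by simp
    then show "\<forall>\<^sub>F n in sequentially. K \<le> L n"
      using eventually_ge_at_top[of 1]
    proof eventually_elim
      case (elim n)
      then have n: "1 \<le> n" by simp
      have wle: "w n i \<le> \<eta>" if i: "i \<in> A n" for i
      proof -
        have Max: "(c n i)\<^sup>2 / var_sum M \<xi> c k n \<le> Max ((\<lambda>i. (c n i)\<^sup>2 / var_sum M \<xi> c k n) ` {1..k n})"
          using i by (intro Max_ge) (auto simp: A_def)
        have "(w n i)\<^sup>2 / \<sigma>\<^sup>2 \<le> \<eta>\<^sup>2 / \<sigma>\<^sup>2"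
        proof -
          have "(c n i)\<^sup>2 / var_sum M \<xi> c k n = (w n i)\<^sup>2 / \<sigma>\<^sup>2"
            unfolding var[OF n] w_def by (simp add: power_mult_distrib power_divide)
          then show ?thesis using Max elim(1) by linarith
        qed
        then have "(w n i)\<^sup>2 \<le> \<eta>\<^sup>2" using \<sigma> by (simp add: divide_le_cancel)
        then show ?thesis by (rule power2_le_imp_le) (use \<eta> in simp)
      qed
      have "exp (- L n) = (\<Sum>i\<in>A n. w n i powr t)"
        using sum_powr_t[OF unit[OF n]] by (simp add: L_def)
      also have "\<dots> \<le> (\<Sum>i\<in>A n. (w n i)\<^sup>2 * \<eta> powr (t - 2))"
      proof (rule sum_mono)
        fix i assume i: "i \<in> A n"
        have "w n i powr t = w n i powr 2 * w n i powr (t - 2)" by (simp add: powr_add[symmetric] del: powr_numeral)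
        also have "\<dots> \<le> w n i powr 2 * \<eta> powr (t - 2)"
          using wle[OF i] wpos[OF n i] assms(7) by (intro mult_left_mono powr_mono2) auto
        finally show "w n i powr t \<le> (w n i)\<^sup>2 * \<eta> powr (t - 2)" using wpos[OF n i] by (simp add: powr_numeral)
      qed
      also have "\<dots> = \<eta> powr (t - 2)"
        using unit[OF n] by (simp add: sum_distrib_right[symmetric] unit_weights_def)
      also have "\<dots> = exp (- \<bar>K\<bar>)" using assms(7) by (simp add: \<eta>_def powr_def)
      finally show ?case by simp
    qed
  qed
  have prob_S: "prob {\<omega> \<in> space M. weighted_sum \<xi> c k n \<omega> \<ge> y * sd_sum M \<xi> c k n}
    = prob {\<omega> \<in> space M. y \<le> (\<Sum>i\<in>A n. w n i * Z i \<omega>)}" if n: "1 \<le> n" for n y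
  proof -
    have "y * (\<sigma> * C n) \<le> \<sigma> * C n * u \<longleftrightarrow> y \<le> u" for u
      using \<sigma> C[OF n] mult_le_cancel_left_pos[of "\<sigma> * C n" y u] by (simp add: mult.commute)
    then show ?thesis unfolding sd[OF n] ws[OF n] by simp
  qed
  have prob_one: "prob {\<omega> \<in> space M. c n i * \<xi> 0 \<omega> \<ge> y * sd_sum M \<xi> c k n} = G (y / w n i)"
    if n: "1 \<le> n" and i: "i \<in> A n" for n i y
  proof -
    have ci: "0 < c n i" using assms(13)[OF n] i by (simp add: A_def)
    have "y * (\<sigma> * C n) \<le> c n i * u \<longleftrightarrow> y / w n i \<le> u / \<sigma>" for u
      using \<sigma> C[OF n] ci by (simp add: w_def field_simps)
    then show ?thesis unfolding sd[OF n] G_def Z_def by simp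
  qed
  let ?P = "\<lambda>x n. prob {\<omega> \<in> space M. weighted_sum \<xi> c k n \<omega> \<ge> x n * sd_sum M \<xi> c k n}"
  let ?S = "\<lambda>x n. \<Sum>i = 1..k n. prob {\<omega> \<in> space M. c n i * \<xi> 0 \<omega> \<ge> x n * sd_sum M \<xi> c k n}"
  show ?thesis
  proof (intro conjI allI impI)
    fix a :: real and x :: "nat \<Rightarrow> real"
    assume a: "sqrt 2 < a" and x: "\<forall>n\<ge>1. a * sqrt (ln (inverse (D_ratio c k t n))) \<le> x n"
    show "\<exists>\<epsilon>. \<epsilon> \<longlonglongrightarrow> 0 \<and> (\<forall>n\<ge>1.
      ?P x n =
      (1 + \<epsilon> n) * ?S x n)"
    proof (rule relative_error_exists)
      have S_eq: "?S x n = (\<Sum>i\<in>A n. G (x n / w n i))"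
        if "1 \<le> n" for n
        using prob_one[OF that] by (intro sum.cong) (auto simp: A_def)
      show "0 < ?S x n" if "1 \<le> n" for n
        unfolding S_eq[OF that] using unit_weightsD[OF unit[OF that]] G_pos by (intro sum_pos) auto
      fix \<epsilon> :: real assume "0 < \<epsilon>"
      from large_deviations[OF a this] obtain L0 where L0: "\<forall>A w x. unit_weights A w \<longrightarrow> L0 \<le> log_D A w \<longrightarrow> a * sqrt (log_D A w) \<le> x \<longrightarrow>
        \<bar>sum_prob A w x - tail_sum A w x\<bar> \<le> \<epsilon> * tail_sum A w x" by blast
      have "\<forall>\<^sub>F n in sequentially. L0 \<le> L n" using L_lim by (simp add: filterlim_at_top)
      then show "\<forall>\<^sub>F n in sequentially.
        \<bar>?P x n -
          ?S x n\<bar>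
        \<le> \<epsilon> * ?S x n"
        using eventually_ge_at_top[of 1]
      proof eventually_elim
        case (elim n)
        then have "a * sqrt (L n) \<le> x n" using x L_eq by auto
        then show ?case
          unfolding S_eq[OF elim(2)] prob_S[OF elim(2)] using L0 unit[OF elim(2)] elim(1) by (simp add: L_def)
      qed
    qed
  next
    fix b :: real and x :: "nat \<Rightarrow> real"
    assume b: "b < sqrt 2" and x: "\<forall>n\<ge>1. 0 < x n \<and> x n \<le> b * sqrt (ln (inverse (D_ratio c k t n)))"
    have "\<exists>\<epsilon>. \<epsilon> \<longlonglongrightarrow> 0 \<and> (\<forall>n\<ge>1.
      ?P x n = (1 + \<epsilon> n) * normal_tail (x n))"
    proof (rule relative_error_exists)
      show "0 < normal_tail (x n)" if "1 \<le> n" for n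
      proof -
        have "0 < std_normal_density (x n) / (1 + x n)"
          using x that std_normal_density_pos[of "x n"] by (intro divide_pos_pos) auto
        also have "\<dots> \<le> normal_tail (x n)" using x that by (intro normal_tail_ge) (auto intro: less_imp_le)
        finally show ?thesis .
      qed
      fix \<epsilon> :: real assume \<epsilon>: "0 < \<epsilon>"
      have "\<forall>\<^sub>F n in sequentially. 0 \<le> L n" using L_lim by (simp add: filterlim_at_top)
      then obtain N where "\<And>n. N \<le> n \<Longrightarrow> 0 \<le> L n" unfolding eventually_sequentially by blast
      then obtain n0 where n0: "1 \<le> n0" "0 \<le> L n0" using that[of "max N 1"] by simp
      \<comment> \<open>At an index with L \<ge> 0 a nonpositive \<open>b\<close> would contradict 0
        < x n \<le> b sqrt (L n). The sign of L matters because the real \<open>sqrt\<close> is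
        negative at negative arguments.\<close>
      have b0: "0 < b"
      proof (rule ccontr)
        assume "\<not> 0 < b"
        then have "b * sqrt (L n0) \<le> 0" using n0 by (intro mult_nonpos_nonneg) auto
        then show False using x L_eq[OF n0(1)] n0(1) by fastforce
      qed
      from moderate_deviations[OF b0 b \<epsilon>] obtain L0 where L0: "\<forall>A w x. unit_weights A w \<longrightarrow> L0 \<le> log_D A w \<longrightarrow> 0 < x \<longrightarrow> x \<le> b * sqrt (log_D A w) \<longrightarrow>
        \<bar>sum_prob A w x - normal_tail x\<bar> \<le> \<epsilon> * normal_tail x" by blast
      have "\<forall>\<^sub>F n in sequentially. L0 \<le> L n" using L_lim by (simp add: filterlim_at_top)
      then show "\<forall>\<^sub>F n in sequentially.
        \<bar>?P x n - normal_tail (x n)\<bar> \<le> \<epsilon> * normal_tail (x n)"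
        using eventually_ge_at_top[of 1]
      proof eventually_elim
        case (elim n)
        then have "0 < x n" "x n \<le> b * sqrt (L n)" using x L_eq by auto
        then show ?case
          unfolding prob_S[OF elim(2)] using L0 unit[OF elim(2)] elim(1) by (simp add: L_def)
      qed
    qed
    then show "\<exists>\<epsilon>. \<epsilon> \<longlonglongrightarrow> 0 \<and> (\<forall>n\<ge>1.
      ?P x n =
      (1 - cdf std_normal_distribution (x n)) * (1 + \<epsilon> n))"
      by (simp add: normal_tail_def mult.commute)
  qed
qed

end
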